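(* Let $f$, $\Lambda$, $(\Lambda_m)_m$ be as in the setting described in the context. If $\mathcal L(0)$ is nonempty, then \[ \dim_{\rm H}\mathcal L(0)=\dim_{\rm H}\Lambda\ge F(0) \quad\text{and}\quad h_{\rm top}(f|\mathcal L(0))=0. \]
   Context: Setting. $I\subset\mathbb R$ is an interval and $f\colon I\to I$ is a map for which there is a partition of $I$ into finitely many sub-intervals on each of which $f$ is monotone and continuously differentiable. $\Lambda\subset I$ is a compact $f$-invariant set such that $f|\Lambda$ is topologically conjugate to a topologically mixing subshift of finite type $(\Sigma_A,\sigma)$, $\Sigma_A\subset\{1,\dots,p\}^{\mathbb N}$. The function $\log|f'|\colon\Lambda\to\mathbb R$ is continuous and is not cohomologous to a constant, i.e. there are no continuous $\psi\colon\Lambda\to\mathbb R$ and $c\in\mathbb R$ with $\log|f'|=\psi-\psi\circ f+c$ on $\Lambda$. Cylinders. $J_1,\dots,J_p$ are compact subintervals of $I$ with pairwise disjoint interiors, and $g_i(I)\subset J_i$, where $g_i$ is the inverse branch of $f$ conjugate to the inverse branch $\sigma_i\colon\omega\mapsto i\omega$ of the shift. Put $\Delta_{i_1\ldots i_n}=g_{i_1}\circ\cdots\circ g_{i_{n-1}}(J_{i_n})$. Tempered distortion. $f$ has tempered distortion on $\Lambda$: there is a positive sequence $(\rho_n)_n$ decreasing to $0$ such that for every $n$, $\sup_{(i_1\ldots i_n)}\sup_{x,y\in\Delta_{i_1\ldots i_n}}\frac{|(f^n)'(x)|}{|(f^n)'(y)|}\le e^{n\rho_n}$. Subsystems. $(\Lambda_m)_m$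 is an increasing family of compact $f$-invariant subsets of $\Lambda$ converging to $\Lambda$ in the Hausdorff topology such that each $f|\Lambda_m$ is topologically conjugate to a subshift of finite type, is uniformly expanding (there are $c>0$, $\lambda>1$ with $|(f^n)'|\ge c\lambda^n$ on $\Lambda_m$ for all $n\ge1$), and has bounded distortion (there is $D\ge1$ with $|(f^n)'(x)|\le D|(f^n)'(y)|$ for all $n$ and all $x,y\in\Lambda_m$ in a common cylinder of level $n$). Level set. $\mathcal L(0)=\{x\in\Lambda:\lim_{n\to\infty}\frac1n\log|(f^n)'(x)|=0\}$. Pressure. For continuous $\varphi\colon\Lambda\to\mathbb R$, $P(\varphi)=\lim_{n\to\infty}\frac1n\log\sum_{(i_1\ldots i_n)}\exp\max_{x\in\Delta_{i_1\ldots i_n}\cap\Lambda}\sum_{k=0}^{n-1}\varphi(f^k(x))$, the sum taken over the cylinders meeting $\Lambda$ (the topological pressure with respect to $f|\Lambda$). The function $F$. For $\alpha>0$, $F(\alpha)=\frac1\alpha\inf_{d\in\mathbb R}\left(P(-d\log|f'|)+\alpha d\right)\in\{-\infty\}\cup[0,\infty)$, and $F(0)=\lim_{\alpha\to0+}F(\alpha)$. $\dim_{\rm H}$ denotes Hausdorff dimension. Entropy. For $Z\subset\Lambda$ not necessarily compact or invariant, $h_{\rm top}(f|Z)$ is Bowen's topological entropy: for $\varepsilon>0$, $s\in\mathbb R$, $N\in\mathbb N$ let $M(Z,s,\varepsilon,N)=\inf\sum_i e^{-sn_i}$ over all countable covers of $Z$ by Bowen balls $B_{n_i}(x_i,\varepsilon)=\{y\in\Lambda:|f^k(y)-f^k(x_i)|<\varepsilon,\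 0\le k<n_i\}$ with $x_i\in\Lambda$, $n_i\ge N$; then $h_{\rm top}(f|Z)=\lim_{\varepsilon\to0}\inf\{s:\lim_{N\to\infty}M(Z,s,\varepsilon,N)=0\}$. *)

theory Defs
  imports "HOL-Analysis.Analysis"
begin

section \<open>Subshifts of finite type\<close>

definition shift :: "(nat \<Rightarrow> 'a) \<Rightarrow> nat \<Rightarrow> 'a" where
  "shift \<omega> = (\<lambda>k. \<omega> (Suc k))"

definition prepend :: "'a \<Rightarrow> (nat \<Rightarrow> 'a) \<Rightarrow> nat \<Rightarrow> 'a" where
  "prepend i \<omega> = case_nat i \<omega>"

text \<open>The one-sided subshift over the alphabet \<open>{1..p}\<close>. The 0-1 matrix is a predicate. Since the
  type \<^typ>\<open>nat \<Rightarrow> nat\<close> carries the product of the discrete topologies, all topological notions below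
  refer to the usual topology.\<close>

definition SFT :: "nat \<Rightarrow> (nat \<Rightarrow> nat \<Rightarrow> bool) \<Rightarrow> (nat \<Rightarrow> nat) set" where
  "SFT p A = {\<omega>. \<forall>k. \<omega> k \<in> {1..p} \<and> A (\<omega> k) (\<omega> (Suc k))}"

definition topologically_mixing_on :: "'a::topological_space set \<Rightarrow> ('a \<Rightarrow> 'a) \<Rightarrow> bool" where
  "topologically_mixing_on X T \<longleftrightarrow>
     (\<forall>U V. openin (top_of_set X) U \<and> openin (top_of_set X) V \<and> U \<noteq> {} \<and> V \<noteq> {} \<longrightarrow>
        (\<exists>N. \<forall>n\<ge>N. (T ^^ n) ` U \<inter> V \<noteq> {}))"

definition topological_conjugacy ::
  "'a::topological_space set \<Rightarrow> ('a \<Rightarrow> 'a) \<Rightarrow> 'b::topological_space set \<Rightarrow> ('b \<Rightarrow> 'b)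
    \<Rightarrow> ('a \<Rightarrow> 'b) \<Rightarrow> bool" where
  "topological_conjugacy X S Y T h \<longleftrightarrow>
     (\<exists>k. homeomorphism X Y h k) \<and> (\<forall>x\<in>X. h (S x) = T (h x))"


section \<open>Piecewise monotone and continuously differentiable maps\<close>

text \<open>The derivative at \<open>x\<close> is taken within the unique partition element containing \<open>x\<close>, so it is
  one-sided when \<open>x\<close> is an endpoint of that element.\<close>

definition piece_deriv :: "real set set \<Rightarrow> (real \<Rightarrow> real) \<Rightarrow> real \<Rightarrow> real" where
  "piece_deriv \<P> f x = (THE D. \<exists>P\<in>\<P>. x \<in> P \<and> (f has_real_derivative D) (at x within P))"

definition piecewise_monotone_C1 :: "real set \<Rightarrow> real set set \<Rightarrow> (real \<Rightarrow> real) \<Rightarrow> bool" where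
  "piecewise_monotone_C1 I \<P> f \<longleftrightarrow>
     finite \<P> \<and> partition_on I \<P> \<and>
     (\<forall>P\<in>\<P>. is_interval P \<and> interior P \<noteq> {} \<and> (mono_on P f \<or> antimono_on P f) \<and>
        f differentiable_on P \<and> continuous_on P (piece_deriv \<P> f))"

text \<open>The derivative of the \<open>n\<close>-th iterate, by the chain rule along the orbit.\<close>

definition iter_deriv :: "real set set \<Rightarrow> (real \<Rightarrow> real) \<Rightarrow> nat \<Rightarrow> real \<Rightarrow> real" where
  "iter_deriv \<P> f n x = (\<Prod>k<n. piece_deriv \<P> f ((f ^^ k) x))"


section \<open>Cylinders and distortion\<close>

text \<open>The set \<open>g\<^sub>i\<^sub>1 \<circ> \<dots> \<circ> g\<^sub>i\<^sub>n\<^sub>-\<^sub>1 (J\<^sub>i\<^sub>n)\<close>; only nonempty words are meaningful.\<close>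

definition cylinder ::
  "(nat \<Rightarrow> real \<Rightarrow> real) \<Rightarrow> (nat \<Rightarrow> real set) \<Rightarrow> nat list \<Rightarrow> real set" where
  "cylinder g J w = foldr (\<lambda>i S. g i ` S) (butlast w) (J (last w))"

definition words_meeting ::
  "nat \<Rightarrow> (nat \<Rightarrow> real \<Rightarrow> real) \<Rightarrow> (nat \<Rightarrow> real set) \<Rightarrow> real set \<Rightarrow> nat \<Rightarrow> nat list set" where
  "words_meeting p g J \<Lambda> n =
     {w. length w = n \<and> set w \<subseteq> {1..p} \<and> cylinder g J w \<inter> \<Lambda> \<noteq> {}}"

text \<open>The distortion bounds are multiplied out, so that a vanishing derivative in the denominator
  cannot make them hold by the convention \<open>x / 0 = 0\<close>.\<close>

definition tempered_distortion ::
  "nat \<Rightarrow> (nat \<Rightarrow> real \<Rightarrow> real) \<Rightarrow> (nat \<Rightarrow> real set) \<Rightarrow> real set set \<Rightarrow> (real \<Rightarrow> real) \<Rightarrow> real set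
    \<Rightarrow> bool" where
  "tempered_distortion p g J \<P> f \<Lambda> \<longleftrightarrow>
     (\<exists>\<rho> :: nat \<Rightarrow> real. (\<forall>n. \<rho> n > 0) \<and> decseq \<rho> \<and> \<rho> \<longlonglongrightarrow> 0 \<and>
        (\<forall>n\<ge>1. \<forall>w\<in>words_meeting p g J \<Lambda> n. \<forall>x\<in>cylinder g J w. \<forall>y\<in>cylinder g J w.
           \<bar>iter_deriv \<P> f n x\<bar> \<le> exp (real n * \<rho> n) * \<bar>iter_deriv \<P> f n y\<bar>))"

definition bounded_distortion ::
  "nat \<Rightarrow> (nat \<Rightarrow> real \<Rightarrow> real) \<Rightarrow> (nat \<Rightarrow> real set) \<Rightarrow> real set set \<Rightarrow> (real \<Rightarrow> real) \<Rightarrow> real set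
    \<Rightarrow> bool" where
  "bounded_distortion p g J \<P> f K \<longleftrightarrow>
     (\<exists>D\<ge>1. \<forall>n\<ge>1. \<forall>w\<in>words_meeting p g J K n. \<forall>x\<in>cylinder g J w \<inter> K. \<forall>y\<in>cylinder g J w \<inter> K.
        \<bar>iter_deriv \<P> f n x\<bar> \<le> D * \<bar>iter_deriv \<P> f n y\<bar>)"

definition uniformly_expanding :: "real set set \<Rightarrow> (real \<Rightarrow> real) \<Rightarrow> real set \<Rightarrow> bool" where
  "uniformly_expanding \<P> f K \<longleftrightarrow>
     (\<exists>c>0. \<exists>l>1. \<forall>n\<ge>1. \<forall>x\<in>K. \<bar>iter_deriv \<P> f n x\<bar> \<ge> c * l ^ n)"

text \<open>Meaningful for nonempty bounded sets (note \<open>infdist x {} = 0\<close>).\<close>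

definition hausdorff_distance :: "'a::metric_space set \<Rightarrow> 'a set \<Rightarrow> real" where
  "hausdorff_distance S T = max (SUP x\<in>S. infdist x T) (SUP y\<in>T. infdist y S)"


section \<open>Pressure, level sets and the function \<open>F\<close>\<close>

definition zero_level_set :: "real set set \<Rightarrow> (real \<Rightarrow> real) \<Rightarrow> real set \<Rightarrow> real set" where
  "zero_level_set \<P> f \<Lambda> = {x\<in>\<Lambda>. (\<lambda>n. ln \<bar>iter_deriv \<P> f n x\<bar> / real n) \<longlonglongrightarrow> 0}"

definition pressure ::
  "nat \<Rightarrow> (nat \<Rightarrow> real \<Rightarrow> real) \<Rightarrow> (nat \<Rightarrow> real set) \<Rightarrow> (real \<Rightarrow> real) \<Rightarrow> real set
    \<Rightarrow> (real \<Rightarrow> real) \<Rightarrow> real" where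
  "pressure p g J f \<Lambda> \<phi> =
     lim (\<lambda>n. ln (\<Sum>w\<in>words_meeting p g J \<Lambda> n.
                    exp (SUP x\<in>cylinder g J w \<inter> \<Lambda>. \<Sum>k<n. \<phi> ((f ^^ k) x))) / real n)"

definition F_fun ::
  "nat \<Rightarrow> (nat \<Rightarrow> real \<Rightarrow> real) \<Rightarrow> (nat \<Rightarrow> real set) \<Rightarrow> real set set \<Rightarrow> (real \<Rightarrow> real) \<Rightarrow> real set
    \<Rightarrow> real \<Rightarrow> ereal" where
  "F_fun p g J \<P> f \<Lambda> \<alpha> =
     ereal (1 / \<alpha>) *
       (INF d::real. ereal (pressure p g J f \<Lambda> (\<lambda>x. - d * ln \<bar>piece_deriv \<P> f x\<bar>) + \<alpha> * d))"

definition F_zero ::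
  "nat \<Rightarrow> (nat \<Rightarrow> real \<Rightarrow> real) \<Rightarrow> (nat \<Rightarrow> real set) \<Rightarrow> real set set \<Rightarrow> (real \<Rightarrow> real) \<Rightarrow> real set
    \<Rightarrow> ereal" where
  "F_zero p g J \<P> f \<Lambda> = Lim (at_right 0) (F_fun p g J \<P> f \<Lambda>)"


section \<open>Hausdorff dimension\<close>

text \<open>With the usual convention that for \<open>s = 0\<close> every nonempty set has weight 1. Boundedness is
  required of the covering sets because \<^const>\<open>diameter\<close> is only meaningful for bounded sets.\<close>

definition hausdorff_weight :: "real \<Rightarrow> 'a::metric_space set \<Rightarrow> ennreal" where
  "hausdorff_weight s U =
     (if U = {} then 0 else if s = 0 then 1 else ennreal (diameter U powr s))"

definition hausdorff_premeasure :: "real \<Rightarrow> real \<Rightarrow> 'a::metric_space set \<Rightarrow> ennreal" where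
  "hausdorff_premeasure s \<delta> S =
     (INF U\<in>{U :: nat \<Rightarrow> 'a set. S \<subseteq> (\<Union>i. U i) \<and> (\<forall>i. bounded (U i) \<and> diameter (U i) \<le> \<delta>)}.
        \<Sum>i. hausdorff_weight s (U i))"

definition hausdorff_measure :: "real \<Rightarrow> 'a::metric_space set \<Rightarrow> ennreal" where
  "hausdorff_measure s S = (SUP \<delta>\<in>{0<..}. hausdorff_premeasure s \<delta> S)"

definition hausdorff_dim :: "'a::metric_space set \<Rightarrow> ereal" where
  "hausdorff_dim S = (INF s\<in>{s. 0 \<le> s \<and> hausdorff_measure s S = 0}. ereal s)"


section \<open>Bowen's topological entropy\<close>

definition bowen_ball ::
  "('a::metric_space \<Rightarrow> 'a) \<Rightarrow> 'a set \<Rightarrow> real \<Rightarrow> nat \<Rightarrow> 'a \<Rightarrow> 'a set" where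
  "bowen_ball f \<Lambda> \<epsilon> n x = {y\<in>\<Lambda>. \<forall>k<n. dist ((f ^^ k) y) ((f ^^ k) x) < \<epsilon>}"

text \<open>A countable (possibly finite) cover by Bowen balls is given by its set of centres and lengths.\<close>

definition bowen_M ::
  "('a::metric_space \<Rightarrow> 'a) \<Rightarrow> 'a set \<Rightarrow> 'a set \<Rightarrow> real \<Rightarrow> real \<Rightarrow> nat \<Rightarrow> ennreal" where
  "bowen_M f \<Lambda> Z s \<epsilon> N =
     (INF C\<in>{C. countable C \<and> C \<subseteq> \<Lambda> \<times> {N..} \<and> Z \<subseteq> (\<Union>(x, n)\<in>C. bowen_ball f \<Lambda> \<epsilon> n x)}.
        \<Sum>\<^sub>\<infinity>(x, n)\<in>C. ennreal (exp (- s * real n)))"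

definition bowen_entropy :: "('a::metric_space \<Rightarrow> 'a) \<Rightarrow> 'a set \<Rightarrow> 'a set \<Rightarrow> ereal" where
  "bowen_entropy f \<Lambda> Z =
     Lim (at_right 0) (\<lambda>\<epsilon>. INF s\<in>{s::real. bowen_M f \<Lambda> Z s \<epsilon> \<longlonglongrightarrow> 0}. ereal s)"

end

theory Submission
  imports Defs "HOL-Probability.Infinite_Product_Measure" "HOL-Library.Discrete_Functions"
begin

text \<open>
  Write \<open>L\<^sub>0\<close> for the level set, \<open>\<chi>\<^sub>n(x) = ln \<bar>(f\<^sup>n)'(x)\<bar>\<close> and \<open>P(d)\<close> for the pressure of
  \<open>- d ln \<bar>f'\<bar>\<close>. Everything rests on a comparison of lengths and derivatives: since an inverse branch
  along a word \<open>w\<close> of length \<open>n\<close> is defined on all of \<open>I\<close>, the mean value inequality and tempered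
  distortion show that the cylinder of \<open>w\<close> has length \<open>exp (- \<beta> w)\<close> up to a factor \<open>exp (o(n))\<close>, where
  \<open>\<beta> w\<close> is the supremum of \<open>\<chi>\<^sub>n\<close> over the branch. Distinct cylinders of the same level overlap in at
  most one point, and all of them lie in a bounded set. Hence \<open>\<chi>\<^sub>n \<ge> - o(n)\<close> on \<open>\<Lambda>\<close>, and there are at
  most \<open>C exp (n \<epsilon>)\<close> admissible words of length \<open>n\<close> with \<open>\<beta> w \<le> n \<epsilon>\<close>.

  Entropy. By the last remark the points of \<open>L\<^sub>0\<close> are covered, from any level on, by
  subexponentially many cylinders of each level, and cylinders are contained in Bowen balls of nearly
  the same length. So Bowen's sums vanish for every positive exponent (\<open>entropy_level_set\<close>).

  The function \<open>F\<close>. An orbit of exponent zero shows \<open>P \<ge> 0\<close>. Hence \<open>P(d) / \<alpha> + d\<close> does not increase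
  with \<open>\<alpha>\<close>, and \<open>F(0)\<close> is the supremum of all \<open>F(\<alpha>)\<close>. Consequently \<open>P(t) > 0\<close> whenever \<open>t < F(0)\<close>,
  while for \<open>t > F(0)\<close> and every \<open>\<alpha> > 0\<close> there is \<open>d\<close> with \<open>P(d) < \<alpha> (t - d)\<close>.

  Upper bound off the level set. A point of \<open>\<Lambda> - L\<^sub>0\<close> satisfies \<open>\<chi>\<^sub>n(x) > \<alpha> n\<close> infinitely often,
  for some \<open>\<alpha> > 0\<close>. The corresponding cylinders satisfy
  \<open>\<Sum> exp (- t \<beta> w) \<le> exp (- \<alpha> (t - d) n) \<Sum> exp (- d \<beta> w)\<close>, which decays exponentially by the choice of
  \<open>d\<close>. So \<open>\<Lambda> - L\<^sub>0\<close> has dimension at most \<open>max (F(0)) 0\<close> (\<open>complement_level_set_null\<close>).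

  Lower bound on the level set. Let \<open>P(t) > 0\<close>. For a large \<open>N\<close> the words of length \<open>N\<close>, completed by
  connecting words so that they can be concatenated freely, satisfy \<open>\<Sum> exp (- t b(w)) > 1\<close>, where
  \<open>b(w)\<close> exceeds \<open>\<beta> w\<close> by a constant. Independent choices of such words alone would give a Cantor
  set of dimension greater than \<open>t\<close>, but in general with positive exponents. At sparse times a long initial
  piece of the code of a point \<open>x\<^sub>0 \<in> L\<^sub>0\<close> is inserted. These pieces fill almost all of the time,
  so that the resulting points have exponent zero. Since a piece of length \<open>l\<close> shrinks cylinders
  only by \<open>exp (- o(l))\<close>, the pieces can be chosen such that the total shrinking is paid for by the excess
  of the sum over 1. The product measure then satisfies the mass distribution principle with
  exponent \<open>t\<close> (\<open>dimension_ge\<close>), and \<open>dim L\<^sub>0 \<ge> F(0)\<close>.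

  Together the two bounds give \<open>dim \<Lambda> = dim L\<^sub>0 \<ge> F(0)\<close>.
\<close>

section \<open>Packing, averages and derivative bounds\<close>

text \<open>Every interval contains one of length \<open>r\<close> that still meets the window; these are pairwise
  disjoint up to endpoints and lie in the \<open>r\<close>-neighbourhood of the window.\<close>

lemma interval_packing:
  fixes a b :: "'i \<Rightarrow> real"
  assumes "finite F" "r > 0" "D \<ge> 0"
    and len: "\<And>i. i \<in> F \<Longrightarrow> b i - a i \<ge> r"
    and disj: "\<And>i j. i \<in> F \<Longrightarrow> j \<in> F \<Longrightarrow> i \<noteq> j \<Longrightarrow> {a i<..<b i} \<inter> {a j<..<b j} = {}"
    and meet: "\<And>i. i \<in> F \<Longrightarrow> {a i..b i} \<inter> {c..c + D} \<noteq> {}"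
  shows "real (card F) * r \<le> D + 2 * r"
proof -
  have "\<exists>x. \<forall>i\<in>F. x i \<in> {a i..b i} \<inter> {c..c + D}"
    using meet by (intro bchoice) blast
  then obtain x where x: "\<And>i. i \<in> F \<Longrightarrow> x i \<in> {a i..b i} \<inter> {c..c + D}" by blast
  define s where "s i = max (a i) (x i - r)" for i
  have s: "a i \<le> s i" "s i + r \<le> b i" "c - r \<le> s i" "s i + r \<le> c + D + r" if "i \<in> F" for i
  proof -
    have "a i \<le> x i" "x i \<le> b i" "c \<le> x i" "x i \<le> c + D"
      using x[OF that] unfolding Int_iff atLeastAtMost_iff by blast+
    then show "a i \<le> s i" "s i + r \<le> b i" "c - r \<le> s i" "s i + r \<le> c + D + r"
      using len[OF that] \<open>r > 0\<close> by (auto simp: s_def max_def)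
  qed
  have "measure lborel (\<Union>i\<in>F. {s i<..<s i + r}) = (\<Sum>i\<in>F. measure lborel {s i<..<s i + r})"
  proof (rule measure_finite_Union)
    show "disjoint_family_on (\<lambda>i. {s i<..<s i + r}) F"
      unfolding disjoint_family_on_def
    proof (intro ballI impI)
      fix i j assume ij: "i \<in> F" "j \<in> F" "i \<noteq> j"
      have "{s i<..<s i + r} \<subseteq> {a i<..<b i}" "{s j<..<s j + r} \<subseteq> {a j<..<b j}"
        using s[of i] s[of j] ij by auto
      then show "{s i<..<s i + r} \<inter> {s j<..<s j + r} = {}" using disj[OF ij] by blast
    qed
  qed (use \<open>finite F\<close> \<open>r > 0\<close> in auto)
  also have "\<dots> = real (card F) * r" using \<open>r > 0\<close> by simp
  finally have "real (card F) * r = measure lborel (\<Union>i\<in>F. {s i<..<s i + r})" by simp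
  also have "\<dots> \<le> measure lborel {c - r..c + D + r}"
  proof (rule measure_mono_fmeasurable)
    show "(\<Union>i\<in>F. {s i<..<s i + r}) \<subseteq> {c - r..c + D + r}"
      using s(3,4) by fastforce
  qed (auto intro!: sets.finite_UN \<open>finite F\<close> simp: fmeasurable_def emeasure_lborel_Icc_eq)
  also have "\<dots> = D + 2 * r" using \<open>r > 0\<close> \<open>D \<ge> 0\<close> by simp
  finally show ?thesis .
qed

text \<open>Fekete's lemma. Subadditivity is available for positive indices only, because cylinders
  are meaningful for nonempty words only; so \<open>n\<close> is divided by \<open>m\<close> with remainder in \<open>{1..m}\<close>.\<close>

lemma subadditive_average_convergent:
  fixes a :: "nat \<Rightarrow> real"
  assumes sub: "\<And>m n. m \<ge> 1 \<Longrightarrow> n \<ge> 1 \<Longrightarrow> a (m + n) \<le> a m + a n"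
    and bdd: "\<And>n. n \<ge> 1 \<Longrightarrow> - C * real n \<le> a n"
  shows "convergent (\<lambda>n. a n / real n)"
proof -
  define L where "L = (INF n\<in>{1..}. a n / real n)"
  have bb: "bdd_below ((\<lambda>n. a n / real n) ` {1..})"
    by (rule bdd_belowI2[of _ "- C"]) (use bdd in \<open>auto simp: field_simps\<close>)
  have low: "L \<le> a n / real n" if "n \<ge> 1" for n
    unfolding L_def by (rule cINF_lower[OF bb]) (use that in auto)
  have mult: "a (q * m) \<le> real q * a m" if "m \<ge> 1" "q \<ge> 1" for q m
    using that(2)
  proof (induction q rule: dec_induct)
    case (step q)
    have "a (q * m + m) \<le> a (q * m) + a m" using sub[of "q * m" m] step that by auto
    then show ?case using step by (auto simp: algebra_simps)
  qed simp
  have "(\<lambda>n. a n / real n) \<longlonglongrightarrow> L"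
  proof (rule order_tendstoI)
    fix y assume "y < L"
    then show "\<forall>\<^sub>F n in sequentially. y < a n / real n"
      by (intro eventually_sequentiallyI[of 1] less_le_trans[OF \<open>y < L\<close> low])
  next
    fix y assume y: "L < y"
    then obtain m where m: "m \<ge> 1" "a m / real m < y"
      unfolding L_def by (subst (asm) cINF_less_iff[OF _ bb]) auto
    define B where "B = Max (a ` {1..m})"
    have B: "a k \<le> B" if "k \<ge> 1" "k \<le> m" for k
      unfolding B_def using that by (intro Max_ge) auto
    have "\<forall>\<^sub>F n in sequentially. a m / real m + (\<bar>B\<bar> + \<bar>a m\<bar>) / real n < y"
    proof -
      have "(\<lambda>n. a m / real m + (\<bar>B\<bar> + \<bar>a m\<bar>) / real n) \<longlonglongrightarrow> a m / real m + 0"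
        by (intro tendsto_add tendsto_const lim_const_over_n)
      then show ?thesis using m by (intro order_tendstoD) auto
    qed
    then show "\<forall>\<^sub>F n in sequentially. a n / real n < y"
      using eventually_gt_at_top[of m]
    proof eventually_elim
      case (elim n)
      define q where "q = (n - 1) div m"
      define k where "k = Suc ((n - 1) mod m)"
      have nqk: "n = q * m + k" using elim by (simp add: q_def k_def)
      have k: "k \<ge> 1" "k \<le> m" using m by (auto simp: k_def Suc_le_eq)
      have "q \<ge> 1"
      proof (rule ccontr)
        assume "\<not> q \<ge> 1" then have "q = 0" by simp
        then show False using nqk k elim by simp
      qed
      have "a n \<le> a (q * m) + a k" unfolding nqk using sub[of "q * m" k] k m \<open>q \<ge> 1\<close> by simp
      also have "\<dots> \<le> real q * a m + B" using mult[OF m(1) \<open>q \<ge> 1\<close>] B[OF k] by simp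
      also have "real q * a m = (real n - real k) * (a m / real m)"
        using nqk m by (simp add: field_simps)
      also have "\<dots> = real n * (a m / real m) - (real k / real m) * a m"
        by (simp add: field_simps diff_divide_distrib)
      also have "- ((real k / real m) * a m) \<le> \<bar>a m\<bar>"
      proof -
        have "\<bar>(real k / real m) * a m\<bar> \<le> 1 * \<bar>a m\<bar>"
          unfolding abs_mult by (rule mult_right_mono) (use k m in \<open>auto simp: field_simps\<close>)
        then show ?thesis by linarith
      qed
      then have "real n * (a m / real m) - (real k / real m) * a m + B
          \<le> real n * (a m / real m) + (\<bar>B\<bar> + \<bar>a m\<bar>)" by linarith
      finally have "a n / real n \<le> (real n * (a m / real m) + (\<bar>B\<bar> + \<bar>a m\<bar>)) / real n"
        using elim by (intro divide_right_mono) auto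
      also have "\<dots> = a m / real m + (\<bar>B\<bar> + \<bar>a m\<bar>) / real n" using elim by (simp add: field_simps)
      finally show ?case using elim by linarith
    qed
  qed
  then show ?thesis by (rule convergentI)
qed

text \<open>A point of an interval that is not interior is its least or its greatest element.\<close>

lemma finite_interval_minus_interior:
  fixes P :: "real set"
  assumes "is_interval P"
  shows "finite (P - interior P)"
proof -
  have "P - interior P \<subseteq> {x\<in>P. \<forall>y\<in>P. x \<le> y} \<union> {x\<in>P. \<forall>y\<in>P. y \<le> x}"
  proof
    fix x assume x: "x \<in> P - interior P"
    show "x \<in> {x\<in>P. \<forall>y\<in>P. x \<le> y} \<union> {x\<in>P. \<forall>y\<in>P. y \<le> x}"
    proof (rule ccontr)
      assume "\<not> ?thesis"
      then obtain y z where "y \<in> P" "z \<in> P" "y < x" "x < z" using x by (auto simp: not_le)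
      moreover then have "{y<..<z} \<subseteq> P" using assms unfolding is_interval_1 by fastforce
      ultimately have "x \<in> interior P" by (intro interiorI[of "{y<..<z}"]) auto
      then show False using x by simp
    qed
  qed
  moreover have "finite {x\<in>P. \<forall>y\<in>P. x \<le> y}"
  proof (cases "{x\<in>P. \<forall>y\<in>P. x \<le> y} = {}")
    case False
    then obtain z where "z \<in> P" "\<forall>y\<in>P. z \<le> y" by blast
    then have "{x\<in>P. \<forall>y\<in>P. x \<le> y} \<subseteq> {z}" by (auto intro: antisym)
    then show ?thesis using finite_subset by blast
  qed (simp only: finite.emptyI)
  moreover have "finite {x\<in>P. \<forall>y\<in>P. y \<le> x}"
  proof (cases "{x\<in>P. \<forall>y\<in>P. y \<le> x} = {}")
    case False
    then obtain z where "z \<in> P" "\<forall>y\<in>P. y \<le> z" by blast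
    then have "{x\<in>P. \<forall>y\<in>P. y \<le> x} \<subseteq> {z}" by (auto intro: antisym)
    then show ?thesis using finite_subset by blast
  qed (simp only: finite.emptyI)
  ultimately show ?thesis by (meson finite_Un finite_subset)
qed

text \<open>The mean value inequality in the form needed for iterates of a piecewise
  differentiable map: finitely many points of a cylinder may reach an endpoint of a partition element.\<close>

lemma derivative_bound_off_finite_Icc:
  fixes F F' :: "real \<Rightarrow> real"
  assumes "a \<le> b" "finite S" "continuous_on {a..b} F"
    and der: "\<And>x. x \<in> {a<..<b} - S \<Longrightarrow> (F has_real_derivative F' x) (at x)"
    and bound: "\<And>x. x \<in> {a<..<b} - S \<Longrightarrow> \<bar>F' x\<bar> \<le> B"
    and "0 \<le> B"
  shows "\<bar>F b - F a\<bar> \<le> B * (b - a)"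
proof -
  have "(F' has_integral (F b - F a)) {a..b}"
    using assms(1-3) der
    by (intro fundamental_theorem_of_calculus_interior_strong[of S])
       (auto simp: has_real_derivative_iff_has_vector_derivative)
  from has_integral_bound_real[OF \<open>0 \<le> B\<close> _ this, of "insert a (insert b S)"]
  show ?thesis using bound assms by auto
qed

lemma derivative_bound_off_finite:
  fixes F F' :: "real \<Rightarrow> real"
  assumes "finite S" "continuous_on (closed_segment a b) F"
    and der: "\<And>x. x \<in> open_segment a b - S \<Longrightarrow> (F has_real_derivative F' x) (at x)"
    and bound: "\<And>x. x \<in> open_segment a b - S \<Longrightarrow> \<bar>F' x\<bar> \<le> B"
    and "0 \<le> B"
  shows "\<bar>F b - F a\<bar> \<le> B * \<bar>b - a\<bar>"
proof (cases "a \<le> b")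
  case True
  then show ?thesis
    using derivative_bound_off_finite_Icc[of a b S F F' B] assms
    by (auto simp: closed_segment_eq_real_ivl open_segment_eq_real_ivl)
next
  case False
  then show ?thesis
    using derivative_bound_off_finite_Icc[of b a S F F' B] assms
    by (auto simp: closed_segment_eq_real_ivl open_segment_eq_real_ivl abs_minus_commute)
qed

text \<open>If an excursion of length \<open>L\<close> costs \<open>lam L = o(L)\<close>, then excursions can be scheduled such that
  their total cost up to time \<open>k\<close> is at most \<open>\<theta> (k + 1)\<close> although their total length outgrows \<open>k\<close>.
  They take place at the powers of two only. At time \<open>2 ^ i\<close> the length is the largest multiple
  \<open>a * 2 ^ i\<close> with \<open>a \<le> i\<close> whose cost is at most \<open>\<theta> * 2 ^ i / 2\<close>; the costs then add up to a
  geometric sum, and \<open>a\<close> tends to infinity with \<open>i\<close> because \<open>lam\<close> is sublinear.\<close>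

lemma sparse_schedule:
  fixes lam :: "nat \<Rightarrow> real"
  assumes "lam 0 \<le> 0" and lim: "(\<lambda>L. lam L / real L) \<longlonglongrightarrow> 0" and "\<theta> > 0"
  obtains L :: "nat \<Rightarrow> nat" where
    "\<And>k. (\<Sum>j\<le>k. lam (L j)) \<le> \<theta> * real (Suc k)"
    "filterlim (\<lambda>k. real (\<Sum>j<k. L j) / real (Suc k)) at_top sequentially"
proof -
  define ok where "ok i = {a. a \<le> i \<and> lam (a * 2 ^ i) \<le> \<theta> * 2 ^ i / 2}" for i :: nat
  define mult where "mult i = Max (ok i)" for i
  have fin: "finite (ok i)" for i by (simp add: ok_def)
  have ok0: "0 \<in> ok i" for i
  proof -
    have "0 \<le> \<theta> * 2 ^ i / 2" using \<open>\<theta> > 0\<close> by simp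
    then show ?thesis using assms(1) unfolding ok_def mem_Collect_eq by (metis le0 mult_zero_left order_trans)
  qed
  have mult_ok: "mult i \<in> ok i" for i
    unfolding mult_def by (rule Max_in) (use fin ok0 in auto)
  have mult_large: "\<forall>\<^sub>F i in sequentially. A \<le> mult i" for A
  proof (cases "A = 0")
    case False
    have "\<forall>\<^sub>F L in sequentially. lam L / real L < \<theta> / (2 * real A)"
      by (rule order_tendstoD(2)[OF lim]) (use False \<open>\<theta> > 0\<close> in simp)
    then obtain L0 where L0: "\<And>L. L \<ge> L0 \<Longrightarrow> lam L / real L < \<theta> / (2 * real A)"
      unfolding eventually_sequentially by blast
    show ?thesis unfolding eventually_sequentially
    proof (intro exI allI impI)
      fix i assume i: "max A L0 \<le> i"
      have "L0 \<le> i" using i by simp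
      also have "i < 2 ^ i" by simp
      also have "2 ^ i \<le> A * 2 ^ i" using False by simp
      finally have "lam (A * 2 ^ i) / real (A * 2 ^ i) < \<theta> / (2 * real A)" by (intro L0) simp
      then have "lam (A * 2 ^ i) < \<theta> / (2 * real A) * real (A * 2 ^ i)"
        by (rule iffD1[OF pos_divide_less_eq, rotated]) (use False in simp)
      also have "\<dots> = \<theta> * 2 ^ i / 2" using False by simp
      finally have "A \<in> ok i" using i unfolding ok_def by auto
      then show "A \<le> mult i" unfolding mult_def using fin by (intro Max_ge)
    qed
  qed simp
  define L where "L k = (if \<exists>i. k = 2 ^ i then mult (floor_log k) * k else 0)" for k
  have L_pow: "L (2 ^ i) = mult i * 2 ^ i" for i by (auto simp: L_def)
  have partial: "(\<Sum>j\<le>k. lam (L j)) \<le> \<theta> * 2 ^ i / 2" if "k < 2 ^ i" for k i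
    using that
  proof (induction i arbitrary: k)
    case 0
    then show ?case using assms(1) \<open>\<theta> > 0\<close> by (auto simp: L_def)
  next
    case (Suc i)
    have zero: "(\<Sum>j\<in>{2^i<..k}. lam (L j)) \<le> 0"
    proof (rule sum_nonpos)
      fix j assume j: "j \<in> {2^i<..k}"
      have "\<not> (\<exists>i'. j = 2 ^ i')"
      proof
        assume "\<exists>i'. j = 2 ^ i'"
        then obtain i' where i': "j = 2 ^ i'" by blast
        have "(2::nat) ^ i < 2 ^ i'" using j i' by simp
        then have "i < i'" by (rule power_less_imp_less_exp[rotated]) simp
        have "(2::nat) ^ i' < 2 ^ Suc i" using j i' Suc.prems
          by (simp only: greaterThanAtMost_iff) linarith
        then have "i' < Suc i" by (rule power_less_imp_less_exp[rotated]) simp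
        with \<open>i < i'\<close> show False by simp
      qed
      then show "lam (L j) \<le> 0" using assms(1) by (simp add: L_def)
    qed
    show ?case
    proof (cases "k < 2 ^ i")
      case False
      then have k: "2 ^ i \<le> k" by simp
      have split: "{..k} = insert (2 ^ i) {..2 ^ i - 1} \<union> {2 ^ i<..k}" using k by auto
      have "(\<Sum>j\<le>k. lam (L j)) = (\<Sum>j\<in>insert (2 ^ i) {..2 ^ i - 1}. lam (L j))
          + (\<Sum>j\<in>{2^i<..k}. lam (L j))"
        unfolding split by (rule sum.union_disjoint) auto
      also have "(\<Sum>j\<in>insert (2 ^ i) {..2 ^ i - 1}. lam (L j))
          = lam (L (2 ^ i)) + (\<Sum>j\<le>2 ^ i - 1. lam (L j))"
        by (rule sum.insert) (auto simp: not_le)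
      also have "\<dots> \<le> \<theta> * 2 ^ i / 2 + \<theta> * 2 ^ i / 2"
        using Suc.IH[of "2 ^ i - 1"] mult_ok[of i] by (intro add_mono) (auto simp: L_pow ok_def)
      finally show ?thesis using zero by simp
    next
      case True
      have "\<theta> * 2 ^ i / 2 \<le> \<theta> * 2 ^ Suc i / 2" using \<open>\<theta> > 0\<close> by simp
      then show ?thesis using Suc.IH[OF True] by linarith
    qed
  qed
  show thesis
  proof
    fix k :: nat
    have "(2::nat) ^ floor_log (Suc k) \<le> Suc k" by (rule floor_log_exp2_le) simp
    then have "real (2 ^ floor_log (Suc k)) \<le> real (Suc k)" by (simp only: of_nat_le_iff)
    then have "\<theta> * 2 ^ Suc (floor_log (Suc k)) / 2 \<le> \<theta> * real (Suc k)" using \<open>\<theta> > 0\<close> by simp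
    moreover have "k < 2 ^ Suc (floor_log (Suc k))" using floor_log_exp2_gt[of "Suc k"] by simp
    ultimately show "(\<Sum>j\<le>k. lam (L j)) \<le> \<theta> * real (Suc k)" using partial by fastforce
  next
    show "filterlim (\<lambda>k. real (\<Sum>j<k. L j) / real (Suc k)) at_top sequentially"
      unfolding filterlim_at_top_ge[where c = 1]
    proof (intro allI impI)
      fix Z :: real assume "1 \<le> Z"
      obtain i0 where i0: "\<And>i. i \<ge> i0 \<Longrightarrow> nat \<lceil>3 * Z\<rceil> \<le> mult i"
        using mult_large unfolding eventually_sequentially by blast
      show "\<forall>\<^sub>F k in sequentially. Z \<le> real (\<Sum>j<k. L j) / real (Suc k)"
        unfolding eventually_sequentially
      proof (intro exI allI impI)
        fix k :: nat assume k: "2 ^ Suc i0 + 2 \<le> k"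
        define i where "i = floor_log (k - 1)"
        have i: "2 ^ i \<le> k - 1" "k - 1 < 2 * 2 ^ i"
          unfolding i_def using k by (auto intro: floor_log_exp2_le floor_log_exp2_gt)
        have "(2::nat) ^ i0 < 2 ^ Suc i" using k i by simp
        then have "i0 < Suc i" by (rule power_less_imp_less_exp[rotated]) simp
        then have "3 * Z \<le> real (mult i)" using i0[of i] by linarith
        then have "3 * Z * 2 ^ i \<le> real (mult i) * 2 ^ i" by (rule mult_right_mono) simp
        also have "\<dots> = real (L (2 ^ i))" unfolding L_pow by simp
        also have "\<dots> \<le> real (\<Sum>j<k. L j)"
          unfolding of_nat_le_iff by (rule member_le_sum) (use i k in auto)
        finally have *: "3 * Z * 2 ^ i \<le> real (\<Sum>j<k. L j)" .
        have "Suc k \<le> 3 * 2 ^ i" using i k by (cases "i = 0") auto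
        then have "real (Suc k) \<le> real (3 * 2 ^ i)" by (simp only: of_nat_le_iff)
        then have "Z * real (Suc k) \<le> Z * (3 * 2 ^ i)"
          by (intro mult_left_mono) (use \<open>1 \<le> Z\<close> in auto)
        also have "\<dots> \<le> real (\<Sum>j<k. L j)" using * by simp
        finally show "Z \<le> real (\<Sum>j<k. L j) / real (Suc k)" by (subst pos_le_divide_eq) auto
      qed
    qed
  qed
qed

lemma sum_geometric_tail:
  fixes q :: real
  assumes "0 \<le> q" "q < 1"
  shows "(\<Sum>n=N..<M. q ^ n) \<le> q ^ N / (1 - q)"
proof (cases "N \<le> M")
  case True
  have "(\<Sum>n=N..<M. q ^ n) * (1 - q) = q ^ N - q ^ M"
    using True
  proof (induction M rule: dec_induct)
    case (step M)
    then show ?case by (simp add: distrib_right step.IH) (simp add: right_diff_distrib)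
  qed simp
  then have "(\<Sum>n=N..<M. q ^ n) * (1 - q) \<le> q ^ N" using assms by simp
  then show ?thesis using assms by (simp add: pos_le_divide_eq)
qed (use assms in simp)

lemma sum_by_length_le:
  fixes a :: "'a list \<Rightarrow> real"
  assumes "finite F" "0 \<le> q" "q < 1" "0 \<le> C"
    and "\<And>w. w \<in> F \<Longrightarrow> N \<le> length w"
    and "\<And>n. N \<le> n \<Longrightarrow> (\<Sum>w\<in>{w\<in>F. length w = n}. a w) \<le> C * q ^ n"
  shows "(\<Sum>w\<in>F. a w) \<le> C * q ^ N / (1 - q)"
proof -
  obtain M where M: "\<And>w. w \<in> F \<Longrightarrow> length w < M"
    using finite_nat_set_iff_bounded[of "length ` F"] assms(1) by auto
  have "(\<Sum>w\<in>F. a w) = (\<Sum>n=N..<M. \<Sum>w\<in>{w\<in>F. length w = n}. a w)"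
    by (rule sum.group[symmetric]) (use assms M in auto)
  also have "\<dots> \<le> (\<Sum>n=N..<M. C * q ^ n)" by (rule sum_mono) (use assms in auto)
  also have "\<dots> = C * (\<Sum>n=N..<M. q ^ n)" by (simp add: sum_distrib_left)
  also have "\<dots> \<le> C * (q ^ N / (1 - q))"
    by (rule mult_left_mono[OF sum_geometric_tail]) (use assms in auto)
  finally show ?thesis by simp
qed

section \<open>Hausdorff measure and dimension\<close>

lemma hausdorff_null_cover:
  assumes "hausdorff_measure s S = 0" "\<delta> > 0" "e > 0"
  obtains U where "S \<subseteq> (\<Union>i::nat. U i)" "\<And>i. bounded (U i)" "\<And>i. diameter (U i) \<le> \<delta>"
    "(\<Sum>i. hausdorff_weight s (U i)) < ennreal e"
proof -
  have "hausdorff_premeasure s \<delta> S \<le> hausdorff_measure s S"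
    unfolding hausdorff_measure_def using \<open>\<delta> > 0\<close> by (intro SUP_upper) auto
  then have "hausdorff_premeasure s \<delta> S < ennreal e" using assms by simp
  then show thesis unfolding hausdorff_premeasure_def INF_less_iff using that by blast
qed

lemma hausdorff_nullI:
  assumes "\<And>\<delta> e. \<delta> > 0 \<Longrightarrow> e > 0 \<Longrightarrow> \<exists>U. S \<subseteq> (\<Union>i::nat. U i) \<and> (\<forall>i. bounded (U i) \<and> diameter (U i) \<le> \<delta>)
    \<and> (\<Sum>i. hausdorff_weight s (U i)) \<le> ennreal e"
  shows "hausdorff_measure s S = 0"
proof -
  have "hausdorff_premeasure s \<delta> S \<le> 0" if "\<delta> > 0" for \<delta>
  proof (rule ennreal_le_epsilon)
    fix e :: real assume "e > 0"
    from assms[OF that this] show "hausdorff_premeasure s \<delta> S \<le> 0 + ennreal e"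
      unfolding hausdorff_premeasure_def by (auto intro: INF_lower2)
  qed
  then show ?thesis unfolding hausdorff_measure_def by (auto intro!: SUP_eq_const)
qed

lemma hausdorff_null_subset:
  assumes "hausdorff_measure s T = 0" "S \<subseteq> T"
  shows "hausdorff_measure s S = 0"
proof (rule hausdorff_nullI)
  fix \<delta> e :: real assume "\<delta> > 0" "e > 0"
  from hausdorff_null_cover[OF assms(1) this] obtain U where
    "T \<subseteq> (\<Union>i::nat. U i)" "\<And>i. bounded (U i)" "\<And>i. diameter (U i) \<le> \<delta>"
    "(\<Sum>i. hausdorff_weight s (U i)) < ennreal e" by metis
  then show "\<exists>U. S \<subseteq> (\<Union>i::nat. U i) \<and> (\<forall>i. bounded (U i) \<and> diameter (U i) \<le> \<delta>)
    \<and> (\<Sum>i. hausdorff_weight s (U i)) \<le> ennreal e"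
    using assms(2) by (intro exI[of _ U]) auto
qed

lemma hausdorff_dim_mono: "S \<subseteq> T \<Longrightarrow> hausdorff_dim S \<le> hausdorff_dim T"
  unfolding hausdorff_dim_def by (rule INF_superset_mono) (auto intro: hausdorff_null_subset)

lemma hausdorff_dim_nonneg: "0 \<le> hausdorff_dim S"
  unfolding hausdorff_dim_def by (rule INF_greatest) auto

text \<open>Covers by cylinders are indexed by words rather than by numbers, and their weights are
  estimated level by level, that is, on finite subfamilies.\<close>

lemma hausdorff_null_countable_cover:
  fixes S :: "'a::metric_space set" and s :: real
  assumes "\<And>\<delta> e. \<delta> > 0 \<Longrightarrow> e > 0 \<Longrightarrow> \<exists>U :: 'b::countable \<Rightarrow> 'a set. S \<subseteq> (\<Union>i. U i)
    \<and> (\<forall>i. bounded (U i) \<and> diameter (U i) \<le> \<delta>)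
    \<and> (\<forall>F. finite F \<longrightarrow> (\<Sum>i\<in>F. hausdorff_weight s (U i)) \<le> ennreal e)"
  shows "hausdorff_measure s S = 0"
proof (rule hausdorff_nullI)
  fix \<delta> e :: real assume "\<delta> > 0" "e > 0"
  from assms[OF this] obtain U :: "'b \<Rightarrow> 'a set" where U: "S \<subseteq> (\<Union>i. U i)"
    "\<And>i. bounded (U i)" "\<And>i. diameter (U i) \<le> \<delta>"
    "\<And>F. finite F \<Longrightarrow> (\<Sum>i\<in>F. hausdorff_weight s (U i)) \<le> ennreal e" by blast
  define V where "V n = (if n \<in> range (to_nat :: 'b \<Rightarrow> nat) then U (from_nat n) else {})" for n
  have "S \<subseteq> (\<Union>n. V n)"
  proof
    fix x assume "x \<in> S"
    then obtain i where "x \<in> U i" using U(1) by blast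
    then have "x \<in> V (to_nat i)" by (simp add: V_def)
    then show "x \<in> (\<Union>n. V n)" by blast
  qed
  moreover have "bounded (V n) \<and> diameter (V n) \<le> \<delta>" for n
    using U \<open>\<delta> > 0\<close> by (simp add: V_def)
  moreover have "(\<Sum>n. hausdorff_weight s (V n)) \<le> ennreal e"
  proof (rule suminf_le_const)
    fix n :: nat
    have "(\<Sum>k<n. hausdorff_weight s (V k))
        = (\<Sum>k\<in>{..<n} \<inter> range (to_nat :: 'b \<Rightarrow> nat). hausdorff_weight s (V k))"
      by (rule sum.mono_neutral_right) (auto simp: V_def hausdorff_weight_def)
    also have "\<dots> = (\<Sum>k\<in>to_nat ` (to_nat -` {..<n} :: 'b set). hausdorff_weight s (V k))"
      by (rule sum.cong) auto
    also have "\<dots> = (\<Sum>i\<in>(to_nat -` {..<n} :: 'b set). hausdorff_weight s (U i))"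
      by (subst sum.reindex) (auto simp: V_def)
    also have "\<dots> \<le> ennreal e"
      by (rule U(4)) (auto intro: finite_vimageI)
    finally show "(\<Sum>k<n. hausdorff_weight s (V k)) \<le> ennreal e" .
  qed simp
  ultimately show "\<exists>U. S \<subseteq> (\<Union>i::nat. U i) \<and> (\<forall>i. bounded (U i) \<and> diameter (U i) \<le> \<delta>)
    \<and> (\<Sum>i. hausdorff_weight s (U i)) \<le> ennreal e" by blast
qed

lemma hausdorff_null_UN:
  fixes S :: "nat \<Rightarrow> 'a::metric_space set"
  assumes "\<And>m. hausdorff_measure s (S m) = 0"
  shows "hausdorff_measure s (\<Union>m. S m) = 0"
proof (rule hausdorff_null_countable_cover[where 'b = "nat \<times> nat"])
  fix \<delta> e :: real assume de: "\<delta> > 0" "e > 0"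
  have "\<exists>U. S m \<subseteq> (\<Union>i::nat. U i) \<and> (\<forall>i. bounded (U i)) \<and> (\<forall>i. diameter (U i) \<le> \<delta>)
      \<and> (\<Sum>i. hausdorff_weight s (U i)) < ennreal (e * (1/2) ^ Suc m)" for m
  proof -
    have "e * (1/2) ^ Suc m > 0" using de by simp
    from hausdorff_null_cover[OF assms de(1) this] obtain U where "S m \<subseteq> (\<Union>i::nat. U i)" "\<And>i. bounded (U i)"
      "\<And>i. diameter (U i) \<le> \<delta>" "(\<Sum>i. hausdorff_weight s (U i)) < ennreal (e * (1/2) ^ Suc m)"
      by metis
    then show ?thesis by (intro exI[of _ U] conjI allI)
  qed
  then have "\<exists>U. \<forall>m. S m \<subseteq> (\<Union>i::nat. U m i) \<and> (\<forall>i. bounded (U m i)) \<and> (\<forall>i. diameter (U m i) \<le> \<delta>)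
      \<and> (\<Sum>i. hausdorff_weight s (U m i)) < ennreal (e * (1/2) ^ Suc m)"
    by (intro choice allI)
  then obtain U where U': "\<forall>m. S m \<subseteq> (\<Union>i::nat. U m i) \<and> (\<forall>i. bounded (U m i)) \<and> (\<forall>i. diameter (U m i) \<le> \<delta>)
      \<and> (\<Sum>i. hausdorff_weight s (U m i)) < ennreal (e * (1/2) ^ Suc m)" ..
  have U: "\<And>m. S m \<subseteq> (\<Union>i::nat. U m i)" "\<And>m i. bounded (U m i)"
    "\<And>m i. diameter (U m i) \<le> \<delta>"
    "\<And>m. (\<Sum>i. hausdorff_weight s (U m i)) < ennreal (e * (1/2) ^ Suc m)"
    by (rule U'[rule_format, THEN conjunct1], rule U'[rule_format, THEN conjunct2, THEN conjunct1, rule_format],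
      rule U'[rule_format, THEN conjunct2, THEN conjunct2, THEN conjunct1, rule_format],
      rule U'[rule_format, THEN conjunct2, THEN conjunct2, THEN conjunct2])
  have "(\<Sum>mi\<in>F. hausdorff_weight s (case_prod U mi)) \<le> ennreal e" if "finite F" for F
  proof -
    have "(\<Sum>mi\<in>F. hausdorff_weight s (case_prod U mi))
        \<le> (\<Sum>mi\<in>fst ` F \<times> snd ` F. hausdorff_weight s (case_prod U mi))"
      using that by (intro sum_mono2) force+
    also have "\<dots> = (\<Sum>m\<in>fst ` F. \<Sum>i\<in>snd ` F. hausdorff_weight s (U m i))"
      by (subst sum.cartesian_product) (simp add: case_prod_unfold)
    also have "\<dots> \<le> (\<Sum>m\<in>fst ` F. ennreal (e * (1/2) ^ Suc m))"
    proof (rule sum_mono)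
      fix m
      have "(\<Sum>i\<in>snd ` F. hausdorff_weight s (U m i)) \<le> (\<Sum>i. hausdorff_weight s (U m i))"
        using that by (intro sum_le_suminf) auto
      then show "(\<Sum>i\<in>snd ` F. hausdorff_weight s (U m i)) \<le> ennreal (e * (1/2) ^ Suc m)"
        using U(4)[of m] by simp
    qed
    also have "\<dots> = ennreal (\<Sum>m\<in>fst ` F. e * (1/2) ^ Suc m)"
      using de by (intro sum_ennreal) simp
    also have "(\<Sum>m\<in>fst ` F. e * (1/2) ^ Suc m) \<le> (\<Sum>m. e * (1/2) ^ Suc m)"
      using that de by (intro sum_le_suminf summable_mult) (auto intro: power_half_series[THEN sums_summable])
    also have "\<dots> = e"
      using sums_mult[OF power_half_series, of e] by (simp add: sums_iff)
    finally show ?thesis by (simp add: ennreal_leI)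
  qed
  moreover have "(\<Union>m. S m) \<subseteq> (\<Union>mi. case_prod U mi)"
  proof
    fix x assume "x \<in> (\<Union>m. S m)"
    then obtain m i where "x \<in> U m i" using U(1) by blast
    then show "x \<in> (\<Union>mi. case_prod U mi)" by (intro UN_I[of "(m, i)"]) auto
  qed
  ultimately show "\<exists>U :: nat \<times> nat \<Rightarrow> _. (\<Union>m. S m) \<subseteq> (\<Union>i. U i)
    \<and> (\<forall>i. bounded (U i) \<and> diameter (U i) \<le> \<delta>)
    \<and> (\<forall>F. finite F \<longrightarrow> (\<Sum>i\<in>F. hausdorff_weight s (U i)) \<le> ennreal e)"
    using U by (intro exI[of _ "case_prod U"]) auto
qed

lemma hausdorff_null_Un:
  assumes "hausdorff_measure s S = 0" "hausdorff_measure s T = 0"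
  shows "hausdorff_measure s (S \<union> T) = 0"
proof -
  have "hausdorff_measure s (\<Union>m::nat. if m = 0 then S else T) = 0"
    by (rule hausdorff_null_UN) (simp add: assms)
  then show ?thesis by (rule hausdorff_null_subset) (auto intro: exI[of _ 0] exI[of _ 1])
qed

lemma hausdorff_weight_antimono_exponent:
  assumes "0 \<le> s" "s \<le> t" "bounded U" "diameter U \<le> 1"
  shows "hausdorff_weight t U \<le> hausdorff_weight s U"
proof (cases "U = {} \<or> t = 0")
  case False
  have d: "0 \<le> diameter U" by (rule diameter_ge_0[OF assms(3)])
  show ?thesis
  proof (cases "s = 0")
    case True
    have "diameter U powr t \<le> 1" by (rule powr_le1) (use d assms in auto)
    then show ?thesis using False True by (simp add: hausdorff_weight_def)
  next
    case s: False
    have "diameter U powr t \<le> diameter U powr s"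
      by (rule powr_mono') (use d assms in auto)
    then show ?thesis using False s by (simp add: hausdorff_weight_def ennreal_leI)
  qed
qed (use assms in \<open>auto simp: hausdorff_weight_def\<close>)

lemma hausdorff_null_larger_exponent:
  assumes "hausdorff_measure s S = 0" "0 \<le> s" "s \<le> t"
  shows "hausdorff_measure t S = 0"
proof (rule hausdorff_nullI)
  fix \<delta> e :: real assume de: "\<delta> > 0" "e > 0"
  then have "min \<delta> 1 > 0" by simp
  from hausdorff_null_cover[OF assms(1) this de(2)] obtain U where U:
    "S \<subseteq> (\<Union>i::nat. U i)" "\<And>i. bounded (U i)" "\<And>i. diameter (U i) \<le> min \<delta> 1"
    "(\<Sum>i. hausdorff_weight s (U i)) < ennreal e" by metis
  have "(\<Sum>i. hausdorff_weight t (U i)) \<le> (\<Sum>i. hausdorff_weight s (U i))"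
    by (intro suminf_le hausdorff_weight_antimono_exponent) (use U assms in auto)
  then show "\<exists>U. S \<subseteq> (\<Union>i::nat. U i) \<and> (\<forall>i. bounded (U i) \<and> diameter (U i) \<le> \<delta>)
    \<and> (\<Sum>i. hausdorff_weight t (U i)) \<le> ennreal e"
    using U by (intro exI[of _ U]) auto
qed

lemma hausdorff_dim_le_of_null_difference:
  assumes "\<And>t. ereal t > hausdorff_dim S \<Longrightarrow> hausdorff_measure t (T - S) = 0"
  shows "hausdorff_dim T \<le> hausdorff_dim S"
proof (rule dense_ge)
  fix u assume u: "hausdorff_dim S < u"
  then obtain t where t: "hausdorff_dim S < ereal t" "ereal t < u"
    using ereal_dense2 by blast
  then obtain s where s: "0 \<le> s" "hausdorff_measure s S = 0" "s < t"
    unfolding hausdorff_dim_def INF_less_iff by auto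
  have "hausdorff_measure t (S \<union> (T - S)) = 0"
    by (rule hausdorff_null_Un[OF hausdorff_null_larger_exponent[OF s(2,1)] assms]) (use s t in auto)
  then have "hausdorff_measure t T = 0" by (rule hausdorff_null_subset) auto
  then have "hausdorff_dim T \<le> ereal t"
    unfolding hausdorff_dim_def using s by (intro INF_lower) auto
  then show "hausdorff_dim T \<le> u" using t by simp
qed

text \<open>The probability on the parameter space is thought of as carried to \<open>S\<close> by \<open>x\<close>. The
  preimage of \<open>U\<close> may fail to be measurable and is enclosed in a measurable \<open>E\<close>.\<close>

lemma mass_distribution_principle:
  fixes x :: "'w \<Rightarrow> 'a::metric_space"
  assumes "prob_space M" "0 < t" "0 < R" "0 \<le> C"
    and S: "\<And>\<omega>. \<omega> \<in> space M \<Longrightarrow> x \<omega> \<in> S"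
    and mass: "\<And>U r. 0 < r \<Longrightarrow> r \<le> R \<Longrightarrow> bounded U \<Longrightarrow> diameter U \<le> r \<Longrightarrow>
      \<exists>E\<in>sets M. {\<omega>\<in>space M. x \<omega> \<in> U} \<subseteq> E \<and> emeasure M E \<le> ennreal (C * r powr t)"
  shows "ereal t \<le> hausdorff_dim S"
  unfolding hausdorff_dim_def
proof (rule INF_greatest, rule ccontr)
  interpret prob_space M by fact
  fix s assume "s \<in> {s. 0 \<le> s \<and> hausdorff_measure s S = 0}" "\<not> ereal t \<le> ereal s"
  then have s: "0 \<le> s" "hausdorff_measure s S = 0" "s < t" by auto
  define e where "e = 1 / (2 * (C + 1))"
  have "e > 0" "min R 1 > 0" using assms by (auto simp: e_def)
  from hausdorff_null_cover[OF s(2) this(2,1)] obtain U where U: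
    "S \<subseteq> (\<Union>i::nat. U i)" "\<And>i. bounded (U i)" "\<And>i. diameter (U i) \<le> min R 1"
    "(\<Sum>i. hausdorff_weight s (U i)) < ennreal e" by metis
  have "\<exists>E\<in>sets M. {\<omega>\<in>space M. x \<omega> \<in> U i} \<subseteq> E \<and>
      emeasure M E \<le> ennreal C * hausdorff_weight s (U i) + ennreal ((1/2) ^ i / 4)" for i
  proof (cases "diameter (U i) = 0")
    case True
    \<comment> \<open>A set of diameter 0 may have weight 0, so it is given a radius whose mass bound is summable.\<close>
    define r where "r = min R (((1/2) ^ i / 4 / (C + 1)) powr (1 / t))"
    have r: "0 < r" "r \<le> R" using assms by (auto simp: r_def)
    have "r powr t \<le> (((1/2) ^ i / 4 / (C + 1)) powr (1 / t)) powr t"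
      by (rule powr_mono2) (use r assms in \<open>auto simp: r_def\<close>)
    also have "\<dots> = (1/2) ^ i / 4 / (C + 1)" using assms by (simp add: powr_powr)
    finally have "C * r powr t \<le> C * ((1/2) ^ i / 4 / (C + 1))"
      by (rule mult_left_mono) (use assms in auto)
    also have "\<dots> = (C / (C + 1)) * ((1/2) ^ i / 4)" by simp
    also have "\<dots> \<le> 1 * ((1/2) ^ i / 4)" by (rule mult_right_mono) (use assms in auto)
    finally have "ennreal (C * r powr t) \<le> ennreal ((1/2) ^ i / 4)" by (simp add: ennreal_leI)
    then have le: "ennreal (C * r powr t) \<le> ennreal C * hausdorff_weight s (U i) + ennreal ((1/2) ^ i / 4)"
      by (rule add_increasing[OF zero_le])
    have "diameter (U i) \<le> r" using True r(1) by simp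
    from mass[OF r U(2) this] le show ?thesis by (meson order_trans)
  next
    case False
    then have ne: "U i \<noteq> {}" by auto
    have pos: "0 < diameter (U i)" using False diameter_ge_0[OF U(2)[of i]] by simp
    have "ennreal (diameter (U i) powr t) = hausdorff_weight t (U i)"
      using ne \<open>0 < t\<close> by (simp add: hausdorff_weight_def)
    also have "\<dots> \<le> hausdorff_weight s (U i)"
      by (rule hausdorff_weight_antimono_exponent) (use s U(2,3)[of i] in auto)
    finally have "ennreal (C * diameter (U i) powr t) \<le> ennreal C * hausdorff_weight s (U i)"
      using \<open>0 \<le> C\<close> by (simp add: ennreal_mult mult_left_mono)
    then have le: "ennreal (C * diameter (U i) powr t)
        \<le> ennreal C * hausdorff_weight s (U i) + ennreal ((1/2) ^ i / 4)"
      by (rule add_increasing2[OF zero_le])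
    have "diameter (U i) \<le> R" using U(3)[of i] by simp
    from mass[OF pos this U(2) order_refl] le show ?thesis by (meson order_trans)
  qed
  then have "\<forall>i. \<exists>E. E \<in> sets M \<and> {\<omega>\<in>space M. x \<omega> \<in> U i} \<subseteq> E \<and>
      emeasure M E \<le> ennreal C * hausdorff_weight s (U i) + ennreal ((1/2) ^ i / 4)"
    by (simp only: Bex_def) simp
  from choice[OF this] obtain E where E: "\<And>i. E i \<in> sets M" "\<And>i. {\<omega>\<in>space M. x \<omega> \<in> U i} \<subseteq> E i"
    "\<And>i. emeasure M (E i) \<le> ennreal C * hausdorff_weight s (U i) + ennreal ((1/2) ^ i / 4)"
    by blast
  have "space M \<subseteq> (\<Union>i. E i)" using S U(1) E(2) by fastforce
  then have "1 \<le> emeasure M (\<Union>i. E i)"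
    using emeasure_mono[of "space M" "\<Union>i. E i" M] E(1) emeasure_space_1 by auto
  also have "\<dots> \<le> (\<Sum>i. emeasure M (E i))"
    using E(1) by (intro emeasure_subadditive_countably) auto
  also have "\<dots> \<le> (\<Sum>i. ennreal C * hausdorff_weight s (U i) + ennreal ((1/2) ^ i / 4))"
    by (intro suminf_le E(3)) auto
  also have "\<dots> = ennreal C * (\<Sum>i. hausdorff_weight s (U i)) + (\<Sum>i. ennreal ((1/2) ^ i / 4))"
    by (simp add: suminf_add[symmetric] ennreal_suminf_cmult)
  also have "(\<Sum>i. ennreal ((1/2) ^ i / 4)) = ennreal (1/2)"
  proof -
    have "(\<lambda>i. (1/2::real) ^ i / 4) sums ((1 / (1 - 1/2)) / 4)"
      by (intro sums_divide geometric_sums) simp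
    then show ?thesis by (intro sums_unique[symmetric] sums_ennreal[THEN iffD2]) auto
  qed
  also have "ennreal C * (\<Sum>i. hausdorff_weight s (U i)) \<le> ennreal C * ennreal e"
    by (rule mult_left_mono[OF less_imp_le[OF U(4)] zero_le])
  also have "ennreal C * ennreal e + ennreal (1/2) = ennreal (C * e + 1/2)"
    unfolding ennreal_mult[OF \<open>0 \<le> C\<close> less_imp_le[OF \<open>0 < e\<close>], symmetric]
    by (rule ennreal_plus[symmetric]) (use \<open>0 \<le> C\<close> \<open>0 < e\<close> in simp_all)
  also have "ennreal (C * e + 1/2) < ennreal 1"
  proof (rule ennreal_lessI)
    have "C * e < 1 / 2" using \<open>0 \<le> C\<close> by (simp add: e_def field_split_simps)
    then show "C * e + 1/2 < 1" by simp
  qed simp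
  finally show False by simp
qed

lemma emeasure_product_cylinder:
  fixes q :: "'a \<Rightarrow> real"
  assumes W: "finite W" "(\<Sum>w\<in>W. q w) = 1" "\<And>w. w \<in> W \<Longrightarrow> 0 \<le> q w"
    and \<tau>: "set \<tau> \<subseteq> W"
  defines "M \<equiv> Pi\<^sub>M (UNIV :: nat set) (\<lambda>_. point_measure W (\<lambda>w. ennreal (q w)))"
  defines "E \<equiv> {\<omega>\<in>space M. \<forall>i<length \<tau>. \<omega> i = \<tau> ! i}"
  shows "prob_space M" "E \<in> sets M" "emeasure M E = ennreal (\<Prod>i<length \<tau>. q (\<tau> ! i))"
proof -
  have pm: "prob_space (point_measure W (\<lambda>w. ennreal (q w)))"
    by (rule prob_spaceI)
      (use W in \<open>simp add: space_point_measure emeasure_point_measure_finite sum_ennreal\<close>)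
  then interpret P: product_prob_space "\<lambda>_::nat. point_measure W (\<lambda>w. ennreal (q w))" UNIV
    by (simp add: product_prob_space_def product_sigma_finite_def product_prob_space_axioms_def
        prob_space_imp_sigma_finite)
  show "prob_space M" unfolding M_def by (rule P.P.prob_space_axioms)
  let ?X = "\<lambda>i. {\<tau> ! i}"
  have mem: "\<tau> ! i \<in> W" if "i < length \<tau>" for i using that \<tau> nth_mem by blast
  have E: "E = prod_emb UNIV (\<lambda>_. point_measure W (\<lambda>w. ennreal (q w))) {..<length \<tau>}
      (Pi\<^sub>E {..<length \<tau>} ?X)"
    unfolding E_def M_def prod_emb_def
    by (auto simp: space_PiM space_point_measure PiE_def Pi_def extensional_def restrict_def)
  have sets: "?X i \<in> sets (point_measure W (\<lambda>w. ennreal (q w)))" if "i \<in> {..<length \<tau>}" for i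
    using mem that by (simp add: sets_point_measure)
  show "E \<in> sets M" unfolding E M_def using sets by (intro sets_PiM_I) auto
  have "emeasure M E = (\<Prod>i<length \<tau>. emeasure (point_measure W (\<lambda>w. ennreal (q w))) (?X i))"
    unfolding E M_def by (rule P.emeasure_PiM_emb) (use sets in auto)
  also have "\<dots> = (\<Prod>i<length \<tau>. ennreal (q (\<tau> ! i)))"
    by (rule prod.cong) (use W mem in \<open>auto simp: emeasure_point_measure_finite\<close>)
  also have "\<dots> = ennreal (\<Prod>i<length \<tau>. q (\<tau> ! i))"
    by (rule prod_ennreal) (use W mem in auto)
  finally show "emeasure M E = ennreal (\<Prod>i<length \<tau>. q (\<tau> ! i))" .
qed

section \<open>Words and symbolic sequences\<close>

definition initial :: "(nat \<Rightarrow> 'a) \<Rightarrow> nat \<Rightarrow> 'a list" where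
  "initial \<omega> n = map \<omega> [0..<n]"

lemma length_initial [simp]: "length (initial \<omega> n) = n"
  by (simp add: initial_def)

lemma nth_initial [simp]: "k < n \<Longrightarrow> initial \<omega> n ! k = \<omega> k"
  by (simp add: initial_def)

lemma initial_0 [simp]: "initial \<omega> 0 = []"
  by (simp add: initial_def)

lemma funpow_shift: "(shift ^^ n) \<omega> k = \<omega> (n + k)"
  by (induction n arbitrary: k) (auto simp: shift_def)

lemma initial_add: "initial \<omega> (m + n) = initial \<omega> m @ initial ((shift ^^ m) \<omega>) n"
  by (rule nth_equalityI) (auto simp: nth_append funpow_shift)

lemma initial_Suc: "initial \<omega> (Suc n) = initial \<omega> n @ [\<omega> n]"
  by (simp add: initial_def)

lemma initial_cong: "(\<And>k. k < n \<Longrightarrow> \<omega> k = \<omega>' k) \<Longrightarrow> initial \<omega> n = initial \<omega>' n"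
  by (auto simp: initial_def)

lemma SFT_shift: "\<omega> \<in> SFT p A \<Longrightarrow> (shift ^^ n) \<omega> \<in> SFT p A"
  by (simp add: SFT_def funpow_shift)

lemma differ_index:
  assumes "length u = length v" "u \<noteq> v"
  shows "\<exists>k<length u. u ! k \<noteq> v ! k"
  using assms nth_equalityI by blast

lemma successively_glue:
  "successively R (u @ [a]) \<Longrightarrow> successively R (a # v) \<Longrightarrow> successively R (u @ a # v)"
  by (auto simp: successively_append_iff)

definition pre :: "(nat \<Rightarrow> 'a list) \<Rightarrow> nat \<Rightarrow> 'a list" where
  "pre v k = concat (map v [0..<k])"

text \<open>The first \<open>n + 1\<close> blocks have total length greater than \<open>n\<close> if no block is empty.\<close>

definition flatten :: "(nat \<Rightarrow> 'a list) \<Rightarrow> nat \<Rightarrow> 'a" where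
  "flatten v n = pre v (Suc n) ! n"

lemma pre_0 [simp]: "pre v 0 = []"
  by (simp add: pre_def)

lemma pre_Suc: "pre v (Suc k) = pre v k @ v k"
  by (simp add: pre_def)

lemma pre_cong: "(\<And>i. i < k \<Longrightarrow> v i = v' i) \<Longrightarrow> pre v k = pre v' k"
  by (auto simp: pre_def intro!: arg_cong[where f = concat])

lemma pre_extend: "i \<le> k \<Longrightarrow> \<exists>r. pre v k = pre v i @ r"
  by (induction k rule: dec_induct) (auto simp: pre_Suc)

lemma length_pre_ge:
  assumes "\<And>i. v i \<noteq> []"
  shows "k \<le> length (pre v k)"
proof (induction k)
  case (Suc k)
  have "0 < length (v k)" using assms[of k] by simp
  then show ?case unfolding pre_Suc length_append using Suc.IH by linarith
qed simp

lemma nth_pre: "i \<le> k \<Longrightarrow> n < length (pre v i) \<Longrightarrow> pre v k ! n = pre v i ! n"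
  using pre_extend[of i k v] by (auto simp: nth_append)

lemma flatten_nth:
  assumes "\<And>i. v i \<noteq> []" "n < length (pre v k)"
  shows "flatten v n = pre v k ! n"
proof -
  have n: "n < length (pre v (Suc n))" using length_pre_ge[of v "Suc n", OF assms(1)] by linarith
  show ?thesis unfolding flatten_def
    using nth_pre[of k "Suc n" n v] nth_pre[of "Suc n" k n v] n assms(2) by (cases "k \<le> Suc n") auto
qed

lemma initial_flatten:
  assumes "\<And>i. v i \<noteq> []" "n \<le> length (pre v k)"
  shows "initial (flatten v) n = take n (pre v k)"
  by (rule nth_equalityI) (use assms flatten_nth[OF assms(1)] in auto)

lemma iter_deriv_add:
  "iter_deriv \<P> f (m + n) x = iter_deriv \<P> f m x * iter_deriv \<P> f n ((f ^^ m) x)"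
proof -
  have "iter_deriv \<P> f (m + n) x = (\<Prod>k<m. piece_deriv \<P> f ((f ^^ k) x))
      * (\<Prod>k=m..<m+n. piece_deriv \<P> f ((f ^^ k) x))"
    unfolding iter_deriv_def lessThan_atLeast0
    by (subst prod.atLeastLessThan_concat) auto
  also have "(\<Prod>k=m..<m+n. piece_deriv \<P> f ((f ^^ k) x))
      = (\<Prod>k<n. piece_deriv \<P> f ((f ^^ k) ((f ^^ m) x)))"
    unfolding lessThan_atLeast0
    using prod.shift_bounds_nat_ivl[of "\<lambda>k. piece_deriv \<P> f ((f ^^ k) x)" 0 m n]
    by (simp add: funpow_add add.commute)
  finally show ?thesis by (simp add: iter_deriv_def)
qed

section \<open>Interval maps coded by a subshift\<close>

text \<open>The map with its coding and its inverse branches. The sequence \<open>\<rho>\<close> of tempered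
  distortion is a parameter of the locale since almost all estimates refer to it.\<close>

locale coded_interval_map =
  fixes I \<Lambda> :: "real set" and f :: "real \<Rightarrow> real" and \<P> :: "real set set"
    and p :: nat and A :: "nat \<Rightarrow> nat \<Rightarrow> bool" and h :: "(nat \<Rightarrow> nat) \<Rightarrow> real"
    and J :: "nat \<Rightarrow> real set" and g :: "nat \<Rightarrow> real \<Rightarrow> real" and \<rho> :: "nat \<Rightarrow> real"
  assumes I_interval: "is_interval I"
    and pieces: "piecewise_monotone_C1 I \<P> f"
    and \<Lambda>_compact: "compact \<Lambda>" and \<Lambda>_subset: "\<Lambda> \<subseteq> I" and \<Lambda>_nonempty: "\<Lambda> \<noteq> {}"
    and \<Lambda>_invariant: "f ` \<Lambda> \<subseteq> \<Lambda>"
    and mixing: "topologically_mixing_on (SFT p A) shift"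
    and conjugacy: "topological_conjugacy (SFT p A) shift \<Lambda> f h"
    and deriv_nonzero: "\<And>x. x \<in> \<Lambda> \<Longrightarrow> piece_deriv \<P> f x \<noteq> 0"
    and log_deriv_continuous: "continuous_on \<Lambda> (\<lambda>x. ln \<bar>piece_deriv \<P> f x\<bar>)"
    and J_compact: "\<And>i. i \<in> {1..p} \<Longrightarrow> compact (J i)"
    and J_interval: "\<And>i. i \<in> {1..p} \<Longrightarrow> is_interval (J i)"
    and J_subset: "\<And>i. i \<in> {1..p} \<Longrightarrow> J i \<subseteq> I"
    and J_disjoint: "disjoint_family_on (\<lambda>i. interior (J i)) {1..p}"
    and g_continuous: "\<And>i. i \<in> {1..p} \<Longrightarrow> continuous_on I (g i)"
    and g_image: "\<And>i. i \<in> {1..p} \<Longrightarrow> g i ` I \<subseteq> J i"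
    and f_g: "\<And>i y. i \<in> {1..p} \<Longrightarrow> y \<in> I \<Longrightarrow> f (g i y) = y"
    and g_h: "\<And>i \<omega>. \<omega> \<in> SFT p A \<Longrightarrow> prepend i \<omega> \<in> SFT p A \<Longrightarrow> g i (h \<omega>) = h (prepend i \<omega>)"
    and \<rho>_pos: "\<And>n. \<rho> n > 0" and \<rho>_decseq: "decseq \<rho>" and \<rho>_limit: "\<rho> \<longlonglongrightarrow> 0"
    and distortion: "\<And>n w x y. n \<ge> 1 \<Longrightarrow> w \<in> words_meeting p g J \<Lambda> n \<Longrightarrow> x \<in> cylinder g J w \<Longrightarrow>
      y \<in> cylinder g J w \<Longrightarrow>
      \<bar>iter_deriv \<P> f n x\<bar> \<le> exp (real n * \<rho> n) * \<bar>iter_deriv \<P> f n y\<bar>"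
begin

abbreviation X :: "(nat \<Rightarrow> nat) set" where "X \<equiv> SFT p A"
abbreviation Df :: "nat \<Rightarrow> real \<Rightarrow> real" where "Df \<equiv> iter_deriv \<P> f"
abbreviation branch :: "nat list \<Rightarrow> real \<Rightarrow> real" where "branch w \<equiv> foldr g w"
abbreviation cyl :: "nat list \<Rightarrow> real set" where "cyl \<equiv> cylinder g J"
abbreviation letters :: "nat list \<Rightarrow> bool" where "letters w \<equiv> set w \<subseteq> {1..p}"

text \<open>The words occurring in the subshift. Only for these the cylinder is known to meet \<open>\<Lambda>\<close>, which
  is what distortion estimates require.\<close>

definition admissible :: "nat list \<Rightarrow> bool" where
  "admissible w \<longleftrightarrow> (\<exists>\<omega>\<in>X. w = initial \<omega> (length w))"

section \<open>The coding\<close>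

lemma X_letter: "\<omega> \<in> X \<Longrightarrow> \<omega> k \<in> {1..p}"
  by (simp add: SFT_def)

lemma letters_initial: "\<omega> \<in> X \<Longrightarrow> letters (initial \<omega> n)"
  using X_letter by (auto simp: initial_def)

lemma admissible_initial: "\<omega> \<in> X \<Longrightarrow> admissible (initial \<omega> n)"
  by (auto simp: admissible_def)

lemma admissible_letters: "admissible w \<Longrightarrow> letters w"
  unfolding admissible_def using letters_initial by metis

lemma admissible_append:
  assumes "admissible (u @ v)"
  shows "admissible u" "admissible v"
proof -
  obtain \<omega> where \<omega>: "\<omega> \<in> X" "u @ v = initial \<omega> (length (u @ v))"
    using assms unfolding admissible_def by blast
  then have "u @ v = initial \<omega> (length u) @ initial ((shift ^^ length u) \<omega>) (length v)"
    by (simp add: initial_add)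
  then have "u = initial \<omega> (length u)" "v = initial ((shift ^^ length u) \<omega>) (length v)"
    by simp_all
  then show "admissible u" "admissible v"
    unfolding admissible_def using \<omega>(1) SFT_shift by blast+
qed

lemma finite_admissible: "finite {w. admissible w \<and> length w = n}"
proof (rule finite_subset)
  show "{w. admissible w \<and> length w = n} \<subseteq> {w. set w \<subseteq> {1..p} \<and> length w = n}"
    using admissible_letters by auto
  show "finite {w. set w \<subseteq> {1..p} \<and> length w = n}" by (rule finite_lists_length_eq) simp
qed

lemma h_in: "\<omega> \<in> X \<Longrightarrow> h \<omega> \<in> \<Lambda>"
  using conjugacy unfolding topological_conjugacy_def homeomorphism_def by blast

lemma \<Lambda>_coded:
  assumes "x \<in> \<Lambda>"
  obtains \<omega> where "\<omega> \<in> X" "x = h \<omega>"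
  using conjugacy assms unfolding topological_conjugacy_def homeomorphism_def by blast

lemma iterate_h:
  assumes "\<omega> \<in> X"
  shows "(f ^^ n) (h \<omega>) = h ((shift ^^ n) \<omega>)"
proof (induction n)
  case (Suc n)
  have "f (h ((shift ^^ n) \<omega>)) = h (shift ((shift ^^ n) \<omega>))"
    using conjugacy SFT_shift[OF assms] unfolding topological_conjugacy_def by metis
  then show ?case using Suc by simp
qed simp

lemma iterate_in_\<Lambda>: "x \<in> \<Lambda> \<Longrightarrow> (f ^^ n) x \<in> \<Lambda>"
  by (induction n) (use \<Lambda>_invariant in auto)

lemma branch_in:
  assumes "letters w" "y \<in> I"
  shows "branch w y \<in> I"
  using assms(1)
proof (induction w)
  case (Cons i w)
  then have "g i (branch w y) \<in> J i" using g_image[of i] by (intro subsetD[OF g_image]) auto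
  then show ?case using Cons J_subset[of i] by auto
qed (use assms in simp)

lemma branch_h:
  assumes "\<omega> \<in> X"
  shows "branch (initial \<omega> n) (h ((shift ^^ n) \<omega>)) = h \<omega>"
proof (induction n)
  case (Suc n)
  have "prepend (\<omega> n) ((shift ^^ Suc n) \<omega>) = (shift ^^ n) \<omega>"
    by (rule ext) (simp add: prepend_def funpow_shift split: nat.split del: funpow.simps)
  then have "g (\<omega> n) (h ((shift ^^ Suc n) \<omega>)) = h ((shift ^^ n) \<omega>)"
    using g_h[OF SFT_shift[OF assms, of "Suc n"], of "\<omega> n"] SFT_shift[OF assms, of n] by simp
  then show ?case using Suc by (simp add: initial_Suc del: funpow.simps)
qed simp

lemma iterate_branch_append:
  assumes "letters u" "letters v" "y \<in> I"
  shows "(f ^^ length u) (branch (u @ v) y) = branch v y"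
  using assms(1)
proof (induction u)
  case (Cons i u)
  then have "branch (u @ v) y \<in> I" using branch_in[of "u @ v"] assms by simp
  then show ?case using Cons f_g[of i "branch (u @ v) y"] by (simp add: funpow_swap1)
qed simp

lemma iterate_branch: "letters w \<Longrightarrow> y \<in> I \<Longrightarrow> (f ^^ length w) (branch w y) = y"
  using iterate_branch_append[of w "[]" y] by simp

lemma iterate_branch_drop:
  assumes "letters w" "y \<in> I" "k \<le> length w"
  shows "(f ^^ k) (branch w y) = branch (drop k w) y"
proof -
  have "letters (take k w)" "letters (drop k w)"
    using assms(1) set_take_subset set_drop_subset by (metis subset_trans)+
  from iterate_branch_append[OF this assms(2)] assms(3) show ?thesis
    by (simp only: append_take_drop_id length_take min_absorb2)
qed

lemma branch_inj: "letters w \<Longrightarrow> inj_on (branch w) I"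
  by (rule inj_on_inverseI[of _ "f ^^ length w"]) (rule iterate_branch)

lemma branch_continuous: "letters w \<Longrightarrow> continuous_on I (branch w)"
proof (induction w)
  case (Cons i w)
  have "continuous_on I (g i \<circ> branch w)"
    by (rule continuous_on_compose, use Cons in simp, rule continuous_on_subset[OF g_continuous[of i]])
      (use Cons branch_in in auto)
  then show ?case by simp
qed (simp add: id_def)

lemma branch_segment:
  assumes "letters w" "y \<in> I" "y' \<in> I"
  shows "branch w ` closed_segment y y' = closed_segment (branch w y) (branch w y')"
    and "closed_segment y y' \<subseteq> I"
proof -
  show *: "closed_segment y y' \<subseteq> I"
    using I_interval assms by (simp add: closed_segment_subset is_interval_convex)
  show "branch w ` closed_segment y y' = closed_segment (branch w y) (branch w y')"
    by (rule continuous_injective_image_segment_1)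
      (use branch_continuous[OF assms(1)] branch_inj[OF assms(1)] * in
        \<open>auto intro: continuous_on_subset inj_on_subset\<close>)
qed

section \<open>Cylinders\<close>

lemma cyl_Cons: "us \<noteq> [] \<Longrightarrow> cyl (i # us) = g i ` cyl us"
  by (simp add: cylinder_def)

lemma cyl_single: "cyl [i] = J i"
  by (simp add: cylinder_def)

lemma cyl_subset_J: "letters w \<Longrightarrow> w \<noteq> [] \<Longrightarrow> cyl w \<subseteq> J (hd w)"
proof (induction w)
  case (Cons i w)
  show ?case
  proof (cases "w = []")
    case False
    then have "cyl w \<subseteq> I" using Cons J_subset[of "hd w"] by (cases w) auto
    then show ?thesis using False Cons.prems g_image[of i] by (auto simp: cyl_Cons)
  qed (simp add: cyl_single)
qed simp

lemma cyl_subset_I: "letters w \<Longrightarrow> w \<noteq> [] \<Longrightarrow> cyl w \<subseteq> I"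
  by (rule subset_trans[OF cyl_subset_J J_subset]) (auto simp: neq_Nil_conv)

lemma branch_image_cyl: "letters w \<Longrightarrow> w \<noteq> [] \<Longrightarrow> branch w ` I \<subseteq> cyl w"
proof (induction w)
  case (Cons i w)
  then show ?case using g_image[of i] by (cases "w = []") (auto simp: cyl_single cyl_Cons)
qed simp

lemma cyl_append:
  assumes "v \<noteq> []"
  shows "cyl (u @ v) = branch u ` cyl v"
  by (induction u) (auto simp: cyl_Cons assms image_image)

lemma cyl_append_subset:
  assumes "letters (u @ v)" "u \<noteq> []" 
  shows "cyl (u @ v) \<subseteq> cyl u"
proof (cases "v = []")
  case False
  have "cyl v \<subseteq> I" using cyl_subset_I[of v] assms False by simp
  then show ?thesis using branch_image_cyl[of u] assms False by (auto simp: cyl_append)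
qed simp

lemma J_overlap:
  assumes "i \<in> {1..p}" "j \<in> {1..p}" "i \<noteq> j" "x \<in> J i" "x \<in> J j" "y \<in> J i" "y \<in> J j"
  shows "x = y"
proof (rule ccontr)
  assume "x \<noteq> y"
  have *: False if "x < y" "x \<in> J i" "x \<in> J j" "y \<in> J i" "y \<in> J j" for x y
  proof -
    have sub: "{x<..<y} \<subseteq> interior S" if "is_interval S" "x \<in> S" "y \<in> S" for S
    proof (rule interior_maximal)
      show "{x<..<y} \<subseteq> S"
      proof
        fix z assume "z \<in> {x<..<y}"
        then show "z \<in> S" by (intro mem_is_interval_1_I[OF that]) auto
      qed
    qed simp
    have "{x<..<y} \<subseteq> interior (J i)" "{x<..<y} \<subseteq> interior (J j)"
      by (intro sub J_interval assms(1,2) that)+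
    moreover have "(x + y) / 2 \<in> {x<..<y}" using that by simp
    moreover have "interior (J i) \<inter> interior (J j) = {}"
      using J_disjoint assms unfolding disjoint_family_on_def by blast
    ultimately show False by blast
  qed
  consider "x < y" | "y < x" using \<open>x \<noteq> y\<close> by linarith
  then show False by cases (rule *[of x y], (rule assms | assumption)+, rule *[of y x], (rule assms | assumption)+)
qed

text \<open>The branch along the common prefix is injective, so two cylinders overlap no more than the
  intervals \<open>J\<close> of the first letters that differ.\<close>

lemma cyl_overlap:
  assumes "letters u" "letters v" "k < length u" "k < length v" "u ! k \<noteq> v ! k"
    and "x \<in> cyl u \<inter> cyl v" "y \<in> cyl u \<inter> cyl v"
  shows "x = y"
  using assms
proof (induction u arbitrary: v k x y)
  case (Cons i us)
  obtain j vs where v: "v = j # vs" using Cons.prems(4) by (cases v) auto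
  have ij: "i \<in> {1..p}" "j \<in> {1..p}" using Cons.prems v by auto
  have xy: "x \<in> J i" "x \<in> J j" "y \<in> J i" "y \<in> J j"
    using cyl_subset_J[OF Cons.prems(1)] cyl_subset_J[OF Cons.prems(2)] Cons.prems(6,7) v by auto
  show ?case
  proof (cases "i = j")
    case False
    then show ?thesis using J_overlap[OF ij] xy by blast
  next
    case True
    then obtain k' where k': "k = Suc k'" using Cons.prems v by (cases k) auto
    then have ne: "us \<noteq> []" "vs \<noteq> []" using Cons.prems v by auto
    have sub: "cyl us \<subseteq> I" "cyl vs \<subseteq> I"
      using cyl_subset_I[of us] cyl_subset_I[of vs] ne Cons.prems v by auto
    have inverse: "f z \<in> C \<and> z = g i (f z)" if "z \<in> g i ` C" "C \<subseteq> I" for z C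
      using that f_g[OF ij(1)] by auto
    have "x \<in> g i ` cyl us" "x \<in> g i ` cyl vs" "y \<in> g i ` cyl us" "y \<in> g i ` cyl vs"
      using Cons.prems(6,7) ne True unfolding v by (auto simp: cyl_Cons)
    then have "f x \<in> cyl us \<inter> cyl vs" "f y \<in> cyl us \<inter> cyl vs" "x = g i (f x)" "y = g i (f y)"
      using inverse sub by blast+
    moreover have "f x = f y"
      by (rule Cons.IH[of vs k']) (use Cons.prems v k' calculation in auto)
    ultimately show ?thesis by metis
  qed
qed simp

lemma admissible_words_meeting:
  assumes "\<omega> \<in> X" "n \<ge> 1"
  shows "initial \<omega> n \<in> words_meeting p g J \<Lambda> n" "h \<omega> \<in> cyl (initial \<omega> n)"
proof -
  have ne: "initial \<omega> n \<noteq> []" using assms by (simp flip: length_greater_0_conv)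
  have "h ((shift ^^ n) \<omega>) \<in> I" using h_in[OF SFT_shift[OF assms(1)]] \<Lambda>_subset by blast
  then show "h \<omega> \<in> cyl (initial \<omega> n)"
    using branch_image_cyl[OF letters_initial[OF assms(1)] ne] branch_h[OF assms(1), of n] by force
  then show "initial \<omega> n \<in> words_meeting p g J \<Lambda> n"
    unfolding words_meeting_def using letters_initial[OF assms(1)] h_in[OF assms(1)] by auto
qed

section \<open>Derivatives along branches\<close>

text \<open>At all other points of \<open>I\<close> the derivative within the partition element is a two-sided one.\<close>

definition break_points :: "real set" where
  "break_points = (\<Union>P\<in>\<P>. P - interior P)"

lemma finite_break_points: "finite break_points"
  unfolding break_points_def using pieces finite_interval_minus_interior
  by (auto simp: piecewise_monotone_C1_def)

lemma f_derivative:
  assumes "x \<in> I - break_points"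
  shows "(f has_real_derivative piece_deriv \<P> f x) (at x)"
proof -
  have part: "partition_on I \<P>" and diff: "\<And>P. P \<in> \<P> \<Longrightarrow> f differentiable_on P"
    using pieces by (auto simp: piecewise_monotone_C1_def)
  obtain P where P: "P \<in> \<P>" "x \<in> P" "x \<in> interior P"
  proof -
    obtain P where "P \<in> \<P>" "x \<in> P" using assms partition_onD1[OF part] by blast
    moreover then have "x \<in> interior P" using assms unfolding break_points_def by blast
    ultimately show thesis by (rule that)
  qed
  have at_eq: "at x within P = at x" by (rule at_within_interior[OF P(3)])
  obtain D where D: "(f has_real_derivative D) (at x)"
  proof -
    have "f differentiable (at x within P)"
      using diff[OF P(1), unfolded differentiable_on_def, rule_format, OF P(2)] .
    then have "f differentiable (at x)" unfolding at_eq .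
    then show thesis unfolding real_differentiable_def using that by (elim exE)
  qed
  have "piece_deriv \<P> f x = D"
    unfolding piece_deriv_def
  proof (rule the_equality)
    show "\<exists>P\<in>\<P>. x \<in> P \<and> (f has_real_derivative D) (at x within P)"
      by (rule bexI[OF _ P(1)], rule conjI[OF P(2)], subst at_eq, rule D)
  next
    fix D' assume "\<exists>P\<in>\<P>. x \<in> P \<and> (f has_real_derivative D') (at x within P)"
    then obtain P' where P': "P' \<in> \<P>" "x \<in> P'" "(f has_real_derivative D') (at x within P')" by blast
    then have "P' = P" using partition_onD2[OF part] P unfolding disjoint_def by blast
    then have "(f has_real_derivative D') (at x)" using P'(3) by (simp only: at_eq)
    then show "D' = D" using D by (rule DERIV_unique)
  qed
  then show ?thesis using D by simp
qed

lemma iterate_derivative: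
  assumes "\<And>k. k < n \<Longrightarrow> (f ^^ k) x \<in> I - break_points"
  shows "((f ^^ n) has_real_derivative Df n x) (at x)"
  using assms
proof (induction n)
  case (Suc n)
  have "((\<lambda>x. f ((f ^^ n) x)) has_real_derivative piece_deriv \<P> f ((f ^^ n) x) * Df n x) (at x)"
    by (rule DERIV_chain2[OF f_derivative]) (use Suc in auto)
  then show ?case by (simp add: iter_deriv_def mult.commute comp_def)
qed (simp add: iter_deriv_def id_def)

text \<open>The parameters of points on a branch whose orbit visits \<open>break_points\<close> before time
  \<open>length w\<close>. By injectivity of the branches there are finitely many.\<close>

definition bad_points :: "nat list \<Rightarrow> real set" where
  "bad_points w = (\<Union>k<length w. branch (drop k w) -` break_points \<inter> I)"

lemma letters_drop: "letters w \<Longrightarrow> letters (drop k w)"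
  using set_drop_subset by fastforce

lemma finite_bad_points: "letters w \<Longrightarrow> finite (bad_points w)"
  unfolding bad_points_def
  by (intro finite_UN_I finite_vimage_IntI finite_break_points branch_inj letters_drop) auto

lemma iterate_derivative_branch:
  assumes "letters w" "z \<in> I - bad_points w"
  shows "((f ^^ length w) has_real_derivative Df (length w) (branch w z)) (at (branch w z))"
proof (rule iterate_derivative)
  fix k assume "k < length w"
  then show "(f ^^ k) (branch w z) \<in> I - break_points"
    using assms iterate_branch_drop[of w z k] branch_in[OF letters_drop, of w z k]
    by (auto simp: bad_points_def)
qed

text \<open>The mean value inequality for \<open>f ^^ length w\<close> on the segment between the two points of the
  branch, where it inverts the branch and is therefore continuous.\<close>

lemma distance_expansion_le:
  assumes "letters w" "y \<in> I" "y' \<in> I" "0 \<le> B"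
    and "\<And>z. z \<in> I \<Longrightarrow> \<bar>Df (length w) (branch w z)\<bar> \<le> B"
  shows "\<bar>y - y'\<bar> \<le> B * \<bar>branch w y - branch w y'\<bar>"
proof -
  let ?n = "length w"
  note seg = branch_segment[OF assms(1-3)]
  have "\<bar>(f ^^ ?n) (branch w y') - (f ^^ ?n) (branch w y)\<bar> \<le> B * \<bar>branch w y' - branch w y\<bar>"
  proof (rule derivative_bound_off_finite[where F' = "Df ?n" and S = "branch w ` bad_points w"])
    show "finite (branch w ` bad_points w)" using finite_bad_points[OF assms(1)] by simp
    show "continuous_on (closed_segment (branch w y) (branch w y')) (f ^^ ?n)"
      unfolding seg(1)[symmetric]
      by (rule continuous_on_inv)
        (use branch_continuous[OF assms(1)] seg(2) iterate_branch[OF assms(1)]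
          in \<open>auto intro: continuous_on_subset\<close>)
  next
    fix x assume x: "x \<in> open_segment (branch w y) (branch w y') - branch w ` bad_points w"
    then have "x \<in> branch w ` closed_segment y y'" unfolding seg(1) by (simp add: open_segment_def)
    then obtain z where z: "x = branch w z" "z \<in> I - bad_points w" using x seg(2) by blast
    then show "((f ^^ ?n) has_real_derivative Df ?n x) (at x)" "\<bar>Df ?n x\<bar> \<le> B"
      using iterate_derivative_branch[OF assms(1)] assms(5) by auto
  qed (rule assms(4))
  then show ?thesis using iterate_branch[OF assms(1)] assms(2,3) by (simp add: abs_minus_commute)
qed

text \<open>Here the mean value inequality is applied to the branch itself, as the inverse function of
  \<open>f ^^ length w\<close>.\<close>

lemma distance_contraction_le:
  assumes "letters w" "y \<in> I" "y' \<in> I" "0 < B"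
    and "\<And>z. z \<in> I \<Longrightarrow> B \<le> \<bar>Df (length w) (branch w z)\<bar>"
  shows "\<bar>branch w y - branch w y'\<bar> \<le> \<bar>y - y'\<bar> / B"
proof -
  let ?n = "length w"
  note seg = branch_segment[OF assms(1-3)]
  have "\<bar>branch w y' - branch w y\<bar> \<le> (1 / B) * \<bar>y' - y\<bar>"
  proof (rule derivative_bound_off_finite[where F' = "\<lambda>z. inverse (Df ?n (branch w z))"
        and S = "bad_points w"])
    show "finite (bad_points w)" by (rule finite_bad_points[OF assms(1)])
    show "continuous_on (closed_segment y y') (branch w)"
      using branch_continuous[OF assms(1)] seg(2) by (rule continuous_on_subset)
  next
    fix z assume z: "z \<in> open_segment y y' - bad_points w"
    then have zI: "z \<in> I - bad_points w" using seg(2) by (auto simp: open_segment_def)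
    have sub: "open_segment y y' \<subseteq> I" using seg(2) by (auto simp: open_segment_def)
    have nz: "Df ?n (branch w z) \<noteq> 0" using assms(4) assms(5)[of z] zI by force
    have cont: "isCont (branch w) z"
      by (rule continuous_on_interior[OF continuous_on_subset[OF branch_continuous[OF assms(1)] sub]])
        (use z in \<open>simp add: interior_open open_segment_eq_real_ivl\<close>)
    show "(branch w has_real_derivative inverse (Df ?n (branch w z))) (at z)"
      by (rule DERIV_inverse_function[where f = "f ^^ ?n" and g = "branch w" and x = z and a = "min y y'" and b = "max y y'",
            OF iterate_derivative_branch[OF assms(1) zI] nz])
        (use cont z sub iterate_branch[OF assms(1)] in
          \<open>auto simp: open_segment_eq_real_ivl min_def max_def split: if_splits\<close>)
    show "\<bar>inverse (Df ?n (branch w z))\<bar> \<le> 1 / B"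
      using assms(4) assms(5)[of z] zI by (simp add: abs_inverse inverse_eq_divide frac_le)
  qed (use assms(4) in simp)
  then show ?thesis by (simp add: abs_minus_commute)
qed

section \<open>The logarithmic size of cylinders\<close>

lemma I_nonempty: "I \<noteq> {}"
  using \<Lambda>_nonempty \<Lambda>_subset by blast

lemma X_nonempty: "X \<noteq> {}"
  using \<Lambda>_nonempty \<Lambda>_coded by blast

text \<open>The summand \<open>\<rho> 0\<close> makes this constant also a bound for \<open>\<beta> w / length w\<close>, where \<open>\<beta>\<close> is defined
  below.\<close>

definition growth :: real where
  "growth = (SUP x\<in>\<Lambda>. \<bar>ln \<bar>piece_deriv \<P> f x\<bar>\<bar>) + \<rho> 0"

lemma log_deriv_bound:
  assumes "x \<in> \<Lambda>"
  shows "\<bar>ln \<bar>piece_deriv \<P> f x\<bar>\<bar> \<le> growth - \<rho> 0"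
proof -
  have "compact ((\<lambda>x. \<bar>ln \<bar>piece_deriv \<P> f x\<bar>\<bar>) ` \<Lambda>)"
    by (rule compact_continuous_image[OF _ \<Lambda>_compact]) (intro continuous_intros log_deriv_continuous)
  then have "bdd_above ((\<lambda>x. \<bar>ln \<bar>piece_deriv \<P> f x\<bar>\<bar>) ` \<Lambda>)"
    by (intro bounded_imp_bdd_above compact_imp_bounded)
  then show ?thesis unfolding growth_def using assms by (auto intro: cSUP_upper2)
qed

lemma growth_nonneg: "0 \<le> growth"
proof -
  obtain x where "x \<in> \<Lambda>" using \<Lambda>_nonempty by blast
  from log_deriv_bound[OF this] \<rho>_pos[of 0] show ?thesis by linarith
qed

lemma Df_nonzero_\<Lambda>: "x \<in> \<Lambda> \<Longrightarrow> Df n x \<noteq> 0"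
  unfolding iter_deriv_def using deriv_nonzero iterate_in_\<Lambda> by simp

lemma ln_Df_sum:
  assumes "x \<in> \<Lambda>"
  shows "ln \<bar>Df n x\<bar> = (\<Sum>k<n. ln \<bar>piece_deriv \<P> f ((f ^^ k) x)\<bar>)"
  unfolding iter_deriv_def abs_prod
  by (rule ln_prod) (use deriv_nonzero[OF iterate_in_\<Lambda>[OF assms]] in auto)

lemma ln_Df_bound:
  assumes "x \<in> \<Lambda>"
  shows "\<bar>ln \<bar>Df n x\<bar>\<bar> \<le> real n * (growth - \<rho> 0)"
proof -
  have "\<bar>ln \<bar>Df n x\<bar>\<bar> \<le> (\<Sum>k<n. \<bar>ln \<bar>piece_deriv \<P> f ((f ^^ k) x)\<bar>\<bar>)"
    unfolding ln_Df_sum[OF assms] by (rule sum_abs)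
  also have "\<dots> \<le> (\<Sum>k<n. growth - \<rho> 0)"
    by (intro sum_mono log_deriv_bound iterate_in_\<Lambda> assms)
  finally show ?thesis by simp
qed

lemma ln_Df_bound_growth:
  assumes "x \<in> \<Lambda>"
  shows "\<bar>ln \<bar>Df n x\<bar>\<bar> \<le> real n * growth"
  using ln_Df_bound[OF assms, of n] \<rho>_pos[of 0]
  by (smt (verit) mult_left_mono of_nat_0_le_iff)

lemma branch_distortion:
  assumes "admissible w" "y \<in> I" "z \<in> I"
  shows "\<bar>Df (length w) (branch w y)\<bar> \<le> exp (real (length w) * \<rho> (length w)) * \<bar>Df (length w) (branch w z)\<bar>"
proof (cases "w = []")
  case False
  obtain \<omega> where \<omega>: "\<omega> \<in> X" "w = initial \<omega> (length w)"
    using assms(1) unfolding admissible_def by blast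
  have n: "length w \<ge> 1" using False by (cases w) auto
  have "w \<in> words_meeting p g J \<Lambda> (length w)"
    using admissible_words_meeting(1)[OF \<omega>(1) n] \<omega>(2) by simp
  moreover have "branch w y \<in> cyl w" "branch w z \<in> cyl w"
    using branch_image_cyl[OF admissible_letters[OF assms(1)] False] assms by auto
  ultimately show ?thesis by (intro distortion n)
qed (simp add: iter_deriv_def)

lemma Df_branch_nonzero:
  assumes "admissible w" "y \<in> I"
  shows "Df (length w) (branch w y) \<noteq> 0"
proof
  assume zero: "Df (length w) (branch w y) = 0"
  obtain \<omega> where \<omega>: "\<omega> \<in> X" "w = initial \<omega> (length w)"
    using assms(1) unfolding admissible_def by blast
  define z where "z = h ((shift ^^ length w) \<omega>)"
  have z: "z \<in> I" "branch w z = h \<omega>"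
    unfolding z_def using h_in[OF SFT_shift[OF \<omega>(1)]] \<Lambda>_subset branch_h[OF \<omega>(1), of "length w"] \<omega>(2)
    by auto
  show False
    using branch_distortion[OF assms(1) z(1) assms(2)] zero Df_nonzero_\<Lambda>[OF h_in[OF \<omega>(1)]] z(2)
    by simp
qed

lemma ln_branch_distortion:
  assumes "admissible w" "y \<in> I" "z \<in> I"
  shows "ln \<bar>Df (length w) (branch w y)\<bar>
    \<le> ln \<bar>Df (length w) (branch w z)\<bar> + real (length w) * \<rho> (length w)"
proof -
  let ?n = "length w"
  have nz: "Df ?n (branch w y) \<noteq> 0" "Df ?n (branch w z) \<noteq> 0"
    using Df_branch_nonzero assms by auto
  have "ln \<bar>Df ?n (branch w y)\<bar> \<le> ln (exp (real ?n * \<rho> ?n) * \<bar>Df ?n (branch w z)\<bar>)"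
    using branch_distortion[OF assms] nz by (subst ln_le_cancel_iff) auto
  also have "\<dots> = real ?n * \<rho> ?n + ln \<bar>Df ?n (branch w z)\<bar>"
    using nz by (subst ln_mult) auto
  finally show ?thesis by simp
qed

text \<open>The logarithmic size of the cylinder of \<open>w\<close>, up to sign. Being a supremum it is subadditive
  under concatenation without any error term, however many words are concatenated; tempered
  distortion keeps it within \<open>n \<rho>\<^sub>n\<close> of the logarithmic derivative at any point of the branch.\<close>

definition \<beta> :: "nat list \<Rightarrow> real" where
  "\<beta> w = (SUP y\<in>I. ln \<bar>Df (length w) (branch w y)\<bar>)"

lemma \<beta>_upper:
  assumes "admissible w" "y \<in> I"
  shows "ln \<bar>Df (length w) (branch w y)\<bar> \<le> \<beta> w"
  unfolding \<beta>_def using assms ln_branch_distortion[OF assms(1) _ assms(2)]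
  by (intro cSUP_upper bdd_aboveI2) auto

lemma \<beta>_lower:
  assumes "admissible w" "y \<in> I"
  shows "\<beta> w \<le> ln \<bar>Df (length w) (branch w y)\<bar> + real (length w) * \<rho> (length w)"
  unfolding \<beta>_def using I_nonempty assms
  by (intro cSUP_least ln_branch_distortion) auto

lemma \<beta>_initial:
  assumes "\<omega> \<in> X"
  shows "ln \<bar>Df n (h \<omega>)\<bar> \<le> \<beta> (initial \<omega> n)"
    and "\<beta> (initial \<omega> n) \<le> ln \<bar>Df n (h \<omega>)\<bar> + real n * \<rho> n"
proof -
  have I: "h ((shift ^^ n) \<omega>) \<in> I" using h_in[OF SFT_shift[OF assms]] \<Lambda>_subset by blast
  show "ln \<bar>Df n (h \<omega>)\<bar> \<le> \<beta> (initial \<omega> n)"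
    using \<beta>_upper[OF admissible_initial[OF assms, of n] I] branch_h[OF assms, of n] by simp
  show "\<beta> (initial \<omega> n) \<le> ln \<bar>Df n (h \<omega>)\<bar> + real n * \<rho> n"
    using \<beta>_lower[OF admissible_initial[OF assms, of n] I] branch_h[OF assms, of n] by simp
qed

lemma \<beta>_append:
  assumes "admissible (u @ v)"
  shows "\<beta> (u @ v) \<le> \<beta> u + \<beta> v"
  unfolding \<beta>_def[of "u @ v"]
proof (rule cSUP_least[OF I_nonempty])
  fix y assume y: "y \<in> I"
  note adm = admissible_append[OF assms]
  have vy: "branch v y \<in> I" by (rule branch_in[OF admissible_letters[OF adm(2)] y])
  have it: "(f ^^ length u) (branch u (branch v y)) = branch v y"
    by (rule iterate_branch[OF admissible_letters[OF adm(1)] vy])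
  have "ln \<bar>Df (length (u @ v)) (branch (u @ v) y)\<bar>
      = ln (\<bar>Df (length u) (branch u (branch v y))\<bar> * \<bar>Df (length v) (branch v y)\<bar>)"
    by (simp add: iter_deriv_add it abs_mult)
  also have "\<dots> = ln \<bar>Df (length u) (branch u (branch v y))\<bar> + ln \<bar>Df (length v) (branch v y)\<bar>"
    using Df_branch_nonzero[OF adm(1) vy] Df_branch_nonzero[OF adm(2) y] by (subst ln_mult) auto
  also have "\<dots> \<le> \<beta> u + \<beta> v" using \<beta>_upper[OF adm(1) vy] \<beta>_upper[OF adm(2) y] by simp
  finally show "ln \<bar>Df (length (u @ v)) (branch (u @ v) y)\<bar> \<le> \<beta> u + \<beta> v" .
qed

lemma \<rho>_le: "\<rho> n \<le> \<rho> 0"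
  using \<rho>_decseq by (simp add: decseq_def)

lemma \<beta>_le_length:
  assumes "admissible w"
  shows "\<beta> w \<le> growth * real (length w)"
proof -
  obtain \<omega> where \<omega>: "\<omega> \<in> X" "w = initial \<omega> (length w)"
    using assms unfolding admissible_def by blast
  have "\<beta> w \<le> ln \<bar>Df (length w) (h \<omega>)\<bar> + real (length w) * \<rho> (length w)"
    using \<beta>_initial(2)[OF \<omega>(1), of "length w"] \<omega>(2) by simp
  also have "\<dots> \<le> real (length w) * (growth - \<rho> 0) + real (length w) * \<rho> 0"
    using ln_Df_bound[OF h_in[OF \<omega>(1)], of "length w"]
    by (intro add_mono mult_left_mono \<rho>_le) auto
  finally show ?thesis by (simp add: algebra_simps)
qed

lemma \<beta>_Nil [simp]: "\<beta> [] = 0"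
  unfolding \<beta>_def using I_nonempty by (simp add: iter_deriv_def)

lemma distance_expansion:
  assumes "admissible w" "y \<in> I" "y' \<in> I"
  shows "\<bar>y - y'\<bar> \<le> exp (\<beta> w) * \<bar>branch w y - branch w y'\<bar>"
proof (rule distance_expansion_le[OF admissible_letters[OF assms(1)] assms(2,3)])
  fix z assume "z \<in> I"
  then have "ln \<bar>Df (length w) (branch w z)\<bar> \<le> \<beta> w" "Df (length w) (branch w z) \<noteq> 0"
    using \<beta>_upper Df_branch_nonzero assms(1) by auto
  then show "\<bar>Df (length w) (branch w z)\<bar> \<le> exp (\<beta> w)"
    by (metis exp_le_cancel_iff exp_ln zero_less_abs_iff)
qed simp

lemma distance_contraction:
  assumes "admissible w" "y \<in> I" "y' \<in> I"
  shows "\<bar>branch w y - branch w y'\<bar> \<le> exp (real (length w) * \<rho> (length w) - \<beta> w) * \<bar>y - y'\<bar>"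
proof -
  have "\<bar>branch w y - branch w y'\<bar> \<le> \<bar>y - y'\<bar> / exp (\<beta> w - real (length w) * \<rho> (length w))"
  proof (rule distance_contraction_le[OF admissible_letters[OF assms(1)] assms(2,3)])
    fix z assume "z \<in> I"
    then have "\<beta> w - real (length w) * \<rho> (length w) \<le> ln \<bar>Df (length w) (branch w z)\<bar>"
      "Df (length w) (branch w z) \<noteq> 0"
      using \<beta>_lower[of w z] Df_branch_nonzero assms(1) by auto
    then show "exp (\<beta> w - real (length w) * \<rho> (length w)) \<le> \<bar>Df (length w) (branch w z)\<bar>"
      by (metis exp_le_cancel_iff exp_ln zero_less_abs_iff)
  qed simp
  then show ?thesis by (simp add: exp_diff field_simps)
qed

lemma ex_base_interval: "\<exists>a b. a < b \<and> {a..b} \<subseteq> I \<and> \<Lambda> \<subseteq> {a..b}"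
proof -
  have part: "partition_on I \<P>" and int: "\<And>P. P \<in> \<P> \<Longrightarrow> interior P \<noteq> {}"
    using pieces by (auto simp: piecewise_monotone_C1_def)
  obtain P where P: "P \<in> \<P>" using I_nonempty partition_onD1[OF part] by blast
  obtain x where "x \<in> interior P" using int[OF P] by blast
  then obtain e where e: "e > 0" "ball x e \<subseteq> P" unfolding mem_interior by blast
  have "P \<subseteq> I" using P partition_onD1[OF part] by blast
  then have xI: "x \<in> I" "x + e / 2 \<in> I" using e by (auto simp: subset_iff dist_real_def)
  obtain a where a: "a \<in> \<Lambda>" "\<And>y. y \<in> \<Lambda> \<Longrightarrow> a \<le> y"
    using compact_attains_inf[OF \<Lambda>_compact \<Lambda>_nonempty] by blast
  obtain b where b: "b \<in> \<Lambda>" "\<And>y. y \<in> \<Lambda> \<Longrightarrow> y \<le> b"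
    using compact_attains_sup[OF \<Lambda>_compact \<Lambda>_nonempty] by blast
  have ends: "min a x \<in> I" "max b (x + e / 2) \<in> I"
    using a(1) b(1) \<Lambda>_subset xI by (auto simp: min_def max_def)
  have "{min a x..max b (x + e / 2)} \<subseteq> I"
  proof
    fix z assume "z \<in> {min a x..max b (x + e / 2)}"
    then show "z \<in> I" by (intro mem_is_interval_1_I[OF I_interval ends]) auto
  qed
  moreover have "min a x < max b (x + e / 2)" using e(1) by linarith
  moreover have "\<Lambda> \<subseteq> {min a x..max b (x + e / 2)}" using a(2) b(2) by fastforce
  ultimately show ?thesis by blast
qed

text \<open>A nondegenerate compact interval containing \<open>\<Lambda>\<close>, even if \<open>\<Lambda>\<close> is a single point. Its images
  under branches are the intervals that get packed.\<close>

definition base :: "real \<times> real" where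
  "base = (SOME ab. fst ab < snd ab \<and> {fst ab..snd ab} \<subseteq> I \<and> \<Lambda> \<subseteq> {fst ab..snd ab})"

definition width :: real where "width = snd base - fst base"

lemma base_interval: "fst base < snd base" "{fst base..snd base} \<subseteq> I" "\<Lambda> \<subseteq> {fst base..snd base}"
proof -
  have "\<exists>ab. fst ab < snd ab \<and> {fst ab..snd ab} \<subseteq> I \<and> \<Lambda> \<subseteq> {fst ab..snd ab}"
    using ex_base_interval by auto
  from someI_ex[OF this, folded base_def]
  show "fst base < snd base" "{fst base..snd base} \<subseteq> I" "\<Lambda> \<subseteq> {fst base..snd base}" by auto
qed

lemma width_pos: "width > 0"
  unfolding width_def using base_interval(1) by simp

lemma base_ends: "fst base \<in> I" "snd base \<in> I"
  using base_interval by auto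

lemma J_bounded: "\<exists>R>0. \<forall>i\<in>{1..p}. J i \<subseteq> {-R..R}"
proof -
  have "bounded (\<Union>i\<in>{1..p}. J i)"
    using J_compact by (intro bounded_UN) (auto intro: compact_imp_bounded)
  then obtain R where R: "R > 0" "\<And>x. x \<in> (\<Union>i\<in>{1..p}. J i) \<Longrightarrow> \<bar>x\<bar> \<le> R"
    unfolding bounded_pos by auto
  have "J i \<subseteq> {-R..R}" if "i \<in> {1..p}" for i
  proof
    fix x assume "x \<in> J i"
    then have "\<bar>x\<bar> \<le> R" using R(2) that by blast
    then show "x \<in> {-R..R}" by auto
  qed
  then show ?thesis using R(1) by blast
qed

lemma branch_bounded:
  "\<exists>R>0. \<forall>w y. letters w \<longrightarrow> w \<noteq> [] \<longrightarrow> y \<in> I \<longrightarrow> branch w y \<in> {-R..R}"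
proof -
  obtain R where R: "R > 0" "\<And>i. i \<in> {1..p} \<Longrightarrow> J i \<subseteq> {-R..R}" using J_bounded by blast
  have "branch w y \<in> {-R..R}" if "letters w" "w \<noteq> []" "y \<in> I" for w y
  proof -
    have "branch w y \<in> J (hd w)"
      using branch_image_cyl[OF that(1,2)] cyl_subset_J[OF that(1,2)] that(3) by blast
    moreover have "hd w \<in> {1..p}" using that by (cases w) auto
    ultimately show ?thesis using R(2) by blast
  qed
  then show ?thesis using R(1) by blast
qed

text \<open>The cylinder of \<open>w\<close> has length at least \<open>width * exp (- \<beta> w)\<close> and is contained in one of finitely
  many bounded intervals.\<close>

lemma \<beta>_bounded_below: "\<exists>C\<ge>0. \<forall>w. admissible w \<longrightarrow> - C \<le> \<beta> w"
proof -
  obtain R where R: "R > 0" "\<And>w y. letters w \<Longrightarrow> w \<noteq> [] \<Longrightarrow> y \<in> I \<Longrightarrow> branch w y \<in> {-R..R}"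
    using branch_bounded by blast
  have "- max 0 (ln (2 * R / width)) \<le> \<beta> w" if w: "admissible w" for w
  proof (cases "w = []")
    case False
    have "width \<le> exp (\<beta> w) * \<bar>branch w (fst base) - branch w (snd base)\<bar>"
      using distance_expansion[OF w base_ends] base_interval(1) unfolding width_def by simp
    also have "\<dots> \<le> exp (\<beta> w) * (2 * R)"
      using R(2)[OF admissible_letters[OF w] False base_ends(1)]
        R(2)[OF admissible_letters[OF w] False base_ends(2)]
      by (intro mult_left_mono) auto
    finally have "width / (2 * R) \<le> exp (\<beta> w)" using R(1) by (simp add: field_simps)
    then have "ln (width / (2 * R)) \<le> ln (exp (\<beta> w))"
      using width_pos R(1) by (subst ln_le_cancel_iff) auto
    then show ?thesis using width_pos R(1) by (simp add: ln_div)
  qed simp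
  then show ?thesis by (intro exI[of _ "max 0 (ln (2 * R / width))"]) auto
qed

section \<open>Packing of cylinders\<close>

lemma branch_base_segment:
  assumes "letters w"
  shows "branch w ` {fst base..snd base}
    = {min (branch w (fst base)) (branch w (snd base))..max (branch w (fst base)) (branch w (snd base))}"
  using branch_segment(1)[OF assms base_ends] base_interval(1)
  by (auto simp: closed_segment_eq_real_ivl min_def max_def split: if_splits)

text \<open>Words that disagree at some position have essentially disjoint cylinders. Words of different
  lengths are allowed because the stopping argument at the end compares cylinders by size, not by level.\<close>

lemma words_packing:
  assumes "finite F" "0 < r" "0 \<le> D"
    and adm: "\<And>w. w \<in> F \<Longrightarrow> admissible w"
    and len: "\<And>w. w \<in> F \<Longrightarrow> r \<le> width * exp (- \<beta> w)"
    and differ: "\<And>u v. u \<in> F \<Longrightarrow> v \<in> F \<Longrightarrow> u \<noteq> v \<Longrightarrow>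
      \<exists>k<min (length u) (length v). u ! k \<noteq> v ! k"
    and meet: "\<And>w. w \<in> F \<Longrightarrow> branch w ` {fst base..snd base} \<inter> {c..c + D} \<noteq> {}"
  shows "real (card F) * r \<le> D + 2 * r"
proof (rule interval_packing[OF assms(1-3)])
  let ?a = "\<lambda>w. min (branch w (fst base)) (branch w (snd base))"
  let ?b = "\<lambda>w. max (branch w (fst base)) (branch w (snd base))"
  fix u assume u: "u \<in> F"
  note lu = admissible_letters[OF adm[OF u]]
  have "width \<le> exp (\<beta> u) * \<bar>branch u (fst base) - branch u (snd base)\<bar>"
    using distance_expansion[OF adm[OF u] base_ends] base_interval(1) unfolding width_def by simp
  also have "\<bar>branch u (fst base) - branch u (snd base)\<bar> = ?b u - ?a u" by auto
  finally have "width * exp (- \<beta> u) \<le> ?b u - ?a u" by (simp add: exp_minus field_simps)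
  then show "r \<le> ?b u - ?a u" using len[OF u] by simp
  show "{?a u..?b u} \<inter> {c..c + D} \<noteq> {}"
    using meet[OF u] branch_base_segment[OF lu] by simp
  fix v assume v: "v \<in> F" and uv: "u \<noteq> v"
  note lv = admissible_letters[OF adm[OF v]]
  obtain k where k: "k < length u" "k < length v" "u ! k \<noteq> v ! k" using differ[OF u v uv] by auto
  then have ne: "u \<noteq> []" "v \<noteq> []" by auto
  have sub: "{?a w<..<?b w} \<subseteq> cyl w" if "letters w" "w \<noteq> []" for w
  proof -
    have "{?a w<..<?b w} \<subseteq> branch w ` {fst base..snd base}"
      unfolding branch_base_segment[OF that(1)] by auto
    also have "\<dots> \<subseteq> branch w ` I" using base_interval(2) by blast
    also have "\<dots> \<subseteq> cyl w" by (rule branch_image_cyl[OF that])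
    finally show ?thesis .
  qed
  show "{?a u<..<?b u} \<inter> {?a v<..<?b v} = {}"
  proof (rule ccontr)
    assume ne': "\<not> ?thesis"
    define lo where "lo = max (?a u) (?a v)"
    define hi where "hi = min (?b u) (?b v)"
    have inter: "{?a u<..<?b u} \<inter> {?a v<..<?b v} = {lo<..<hi}"
      by (simp only: lo_def hi_def greaterThanLessThan_def) auto
    then have "lo < hi" using ne' by auto
    define x where "x = (2 * lo + hi) / 3"
    define y where "y = (lo + 2 * hi) / 3"
    have "x \<in> {lo<..<hi}" "y \<in> {lo<..<hi}" "x \<noteq> y" using \<open>lo < hi\<close> by (auto simp: x_def y_def)
    then have "x \<in> cyl u \<inter> cyl v" "y \<in> cyl u \<inter> cyl v"
      using sub[OF lu ne(1)] sub[OF lv ne(2)] unfolding inter[symmetric] by blast+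
    from cyl_overlap[OF lu lv k this] \<open>x \<noteq> y\<close> show False by simp
  qed
qed

section \<open>The pressure function\<close>

definition log_weight :: "real \<Rightarrow> nat \<Rightarrow> nat list \<Rightarrow> real" where
  "log_weight d n w = (SUP x\<in>cyl w \<inter> \<Lambda>. - d * ln \<bar>Df n x\<bar>)"

definition partition_sum :: "real \<Rightarrow> nat \<Rightarrow> real" where
  "partition_sum d n = (\<Sum>w\<in>words_meeting p g J \<Lambda> n. exp (log_weight d n w))"

definition geom_pressure :: "real \<Rightarrow> real" where
  "geom_pressure d = pressure p g J f \<Lambda> (\<lambda>x. - d * ln \<bar>piece_deriv \<P> f x\<bar>)"

lemma finite_words_meeting: "finite (words_meeting p g J \<Lambda> n)"
proof (rule finite_subset)
  show "words_meeting p g J \<Lambda> n \<subseteq> {w. set w \<subseteq> {1..p} \<and> length w = n}"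
    by (auto simp: words_meeting_def)
qed (rule finite_lists_length_eq, simp)

lemma log_weight_term_bound: "x \<in> \<Lambda> \<Longrightarrow> \<bar>- d * ln \<bar>Df n x\<bar>\<bar> \<le> \<bar>d\<bar> * growth * real n"
  using mult_left_mono[OF ln_Df_bound_growth, of x "\<bar>d\<bar>" n] by (simp add: abs_mult algebra_simps)

lemma log_weight_upper:
  assumes "x \<in> cyl w" "x \<in> \<Lambda>"
  shows "- d * ln \<bar>Df n x\<bar> \<le> log_weight d n w"
  unfolding log_weight_def
proof (rule cSUP_upper)
  show "bdd_above ((\<lambda>x. - d * ln \<bar>Df n x\<bar>) ` (cyl w \<inter> \<Lambda>))"
    by (rule bdd_aboveI2[of _ _ "\<bar>d\<bar> * growth * real n"]) (use log_weight_term_bound abs_le_D1 in blast)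
qed (use assms in simp)

lemma log_weight_least:
  assumes "w \<in> words_meeting p g J \<Lambda> n"
    and "\<And>x. x \<in> cyl w \<Longrightarrow> x \<in> \<Lambda> \<Longrightarrow> - d * ln \<bar>Df n x\<bar> \<le> B"
  shows "log_weight d n w \<le> B"
  unfolding log_weight_def by (rule cSUP_least) (use assms in \<open>auto simp: words_meeting_def\<close>)

lemma partition_sum_ge_orbit:
  assumes "\<omega> \<in> X" "n \<ge> 1"
  shows "exp (- d * ln \<bar>Df n (h \<omega>)\<bar>) \<le> partition_sum d n"
proof -
  note w = admissible_words_meeting[OF assms]
  have "exp (- d * ln \<bar>Df n (h \<omega>)\<bar>) \<le> exp (log_weight d n (initial \<omega> n))"
    using log_weight_upper[OF w(2) h_in[OF assms(1)]] by simp
  also have "\<dots> \<le> partition_sum d n"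
    unfolding partition_sum_def by (rule member_le_sum[OF w(1)]) (auto simp: finite_words_meeting)
  finally show ?thesis .
qed

lemma partition_sum_pos: "n \<ge> 1 \<Longrightarrow> partition_sum d n > 0"
  using partition_sum_ge_orbit X_nonempty by (meson all_not_in_conv exp_gt_zero less_le_trans)

lemma ln_partition_sum_ge: 
  assumes "n \<ge> 1"
  shows "- (\<bar>d\<bar> * growth) * real n \<le> ln (partition_sum d n)"
proof -
  obtain \<omega> where \<omega>: "\<omega> \<in> X" using X_nonempty by blast
  have "- (\<bar>d\<bar> * growth) * real n \<le> - d * ln \<bar>Df n (h \<omega>)\<bar>"
    using abs_le_D2[OF log_weight_term_bound[OF h_in[OF \<omega>], of d n]] by simp
  also have "\<dots> \<le> ln (partition_sum d n)"
    using partition_sum_ge_orbit[OF \<omega> assms, of d] partition_sum_pos[OF assms, of d] by (simp add: ln_ge_iff)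
  finally show ?thesis .
qed

text \<open>Cylinders are nested and the Birkhoff sum of a concatenation splits at time \<open>m\<close>; both are
  used for submultiplicativity of the partition sums.\<close>

lemma words_meeting_append:
  assumes "u @ v \<in> words_meeting p g J \<Lambda> (m + n)" "length u = m" "m \<ge> 1" "n \<ge> 1"
  shows "u \<in> words_meeting p g J \<Lambda> m" "v \<in> words_meeting p g J \<Lambda> n"
    and "log_weight d (m + n) (u @ v) \<le> log_weight d m u + log_weight d n v"
proof -
  have len: "length v = n" and let1: "letters (u @ v)" and letu: "letters u" and letv: "letters v"
    using assms by (auto simp: words_meeting_def)
  have ne: "u \<noteq> []" "v \<noteq> []" using assms len by auto
  have uv: "cyl (u @ v) = branch u ` cyl v" by (rule cyl_append[OF ne(2)])
  have vI: "cyl v \<subseteq> I" by (rule cyl_subset_I[OF letv ne(2)])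
  have *: "x \<in> cyl u" "(f ^^ m) x \<in> cyl v" if "x \<in> cyl (u @ v)" for x
  proof -
    show "x \<in> cyl u" using cyl_append_subset[OF let1 ne(1)] that by blast
    obtain y where y: "y \<in> cyl v" "x = branch u y" using \<open>x \<in> cyl (u @ v)\<close> unfolding uv by blast
    then show "(f ^^ m) x \<in> cyl v" using iterate_branch[OF letu, of y] vI assms(2) by auto
  qed
  obtain x0 where x0: "x0 \<in> cyl (u @ v)" "x0 \<in> \<Lambda>" using assms(1) by (auto simp: words_meeting_def)
  show "u \<in> words_meeting p g J \<Lambda> m" "v \<in> words_meeting p g J \<Lambda> n"
    using *[OF x0(1)] x0(2) iterate_in_\<Lambda>[OF x0(2), of m] letu letv len assms(2)
    by (auto simp: words_meeting_def)
  show "log_weight d (m + n) (u @ v) \<le> log_weight d m u + log_weight d n v"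
  proof (rule log_weight_least[OF assms(1)])
    fix x assume x: "x \<in> cyl (u @ v)" "x \<in> \<Lambda>"
    note fx = iterate_in_\<Lambda>[OF x(2), of m]
    have "ln \<bar>Df (m + n) x\<bar> = ln \<bar>Df m x\<bar> + ln \<bar>Df n ((f ^^ m) x)\<bar>"
      using Df_nonzero_\<Lambda>[OF x(2)] Df_nonzero_\<Lambda>[OF fx] by (simp add: iter_deriv_add abs_mult ln_mult)
    then have "- d * ln \<bar>Df (m + n) x\<bar> = - d * ln \<bar>Df m x\<bar> + - d * ln \<bar>Df n ((f ^^ m) x)\<bar>"
      by (simp add: algebra_simps)
    also have "\<dots> \<le> log_weight d m u + log_weight d n v"
      by (intro add_mono log_weight_upper) (use *[OF x(1)] x fx in auto)
    finally show "- d * ln \<bar>Df (m + n) x\<bar> \<le> log_weight d m u + log_weight d n v" .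
  qed
qed

lemma partition_sum_submultiplicative:
  assumes "m \<ge> 1" "n \<ge> 1"
  shows "partition_sum d (m + n) \<le> partition_sum d m * partition_sum d n"
proof -
  let ?W = "words_meeting p g J \<Lambda>"
  let ?s = "\<lambda>w. (take m w, drop m w)"
  have split: "take m w @ drop m w = w" "length (take m w) = m" if "w \<in> ?W (m + n)" for w
    using that by (auto simp: words_meeting_def)
  have "partition_sum d (m + n) \<le> (\<Sum>w\<in>?W (m + n). exp (log_weight d m (take m w)) * exp (log_weight d n (drop m w)))"
    unfolding partition_sum_def
  proof (rule sum_mono)
    fix w assume w: "w \<in> ?W (m + n)"
    have "log_weight d (m + n) w \<le> log_weight d m (take m w) + log_weight d n (drop m w)"
      using words_meeting_append(3)[of "take m w" "drop m w" m n d] split[OF w] w assms by simp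
    then show "exp (log_weight d (m + n) w) \<le> exp (log_weight d m (take m w)) * exp (log_weight d n (drop m w))"
      by (simp flip: exp_add)
  qed
  also have "\<dots> = (\<Sum>uv\<in>?s ` ?W (m + n). exp (log_weight d m (fst uv)) * exp (log_weight d n (snd uv)))"
  proof (subst sum.reindex)
    show "inj_on ?s (?W (m + n))"
      by (rule inj_onI) (metis append_take_drop_id prod.inject)
  qed (simp add: comp_def)
  also have "\<dots> \<le> (\<Sum>uv\<in>?W m \<times> ?W n. exp (log_weight d m (fst uv)) * exp (log_weight d n (snd uv)))"
  proof (rule sum_mono2)
    show "?s ` ?W (m + n) \<subseteq> ?W m \<times> ?W n"
    proof (rule image_subsetI)
      fix w assume w: "w \<in> ?W (m + n)"
      show "?s w \<in> ?W m \<times> ?W n"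
        using words_meeting_append(1,2)[of "take m w" "drop m w" m n] split[OF w] w assms by simp
    qed
  qed (auto simp: finite_words_meeting)
  also have "\<dots> = partition_sum d m * partition_sum d n"
    unfolding partition_sum_def sum_product sum.cartesian_product by (simp add: case_prod_unfold)
  finally show ?thesis .
qed

lemma pressure_eq_lim: "geom_pressure d = lim (\<lambda>n. ln (partition_sum d n) / real n)"
proof -
  have "(\<Sum>k<n. - d * ln \<bar>piece_deriv \<P> f ((f ^^ k) x)\<bar>) = - d * ln \<bar>Df n x\<bar>" if "x \<in> \<Lambda>" for n x
    unfolding ln_Df_sum[OF that] by (simp add: sum_distrib_left)
  then have "(SUP x\<in>cyl w \<inter> \<Lambda>. \<Sum>k<n. - d * ln \<bar>piece_deriv \<P> f ((f ^^ k) x)\<bar>) = log_weight d n w" for w n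
    unfolding log_weight_def by (intro SUP_cong) auto
  then show ?thesis unfolding geom_pressure_def pressure_def partition_sum_def by simp
qed

lemma pressure_limit: "(\<lambda>n. ln (partition_sum d n) / real n) \<longlonglongrightarrow> geom_pressure d"
proof -
  have "convergent (\<lambda>n. ln (partition_sum d n) / real n)"
  proof (rule subadditive_average_convergent)
    fix m n :: nat assume mn: "m \<ge> 1" "n \<ge> 1"
    have "ln (partition_sum d (m + n)) \<le> ln (partition_sum d m * partition_sum d n)"
      using partition_sum_submultiplicative[OF mn] partition_sum_pos mn by (subst ln_le_cancel_iff) auto
    then show "ln (partition_sum d (m + n)) \<le> ln (partition_sum d m) + ln (partition_sum d n)"
      using partition_sum_pos[OF mn(1), of d] partition_sum_pos[OF mn(2), of d] by (simp add: ln_mult)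
  next
    fix n :: nat assume "n \<ge> 1"
    from ln_partition_sum_ge[OF this] show "- (\<bar>d\<bar> * growth) * real n \<le> ln (partition_sum d n)" .
  qed
  then show ?thesis unfolding pressure_eq_lim by (simp add: convergent_LIMSEQ_iff)
qed

abbreviation L0 :: "real set" where "L0 \<equiv> zero_level_set \<P> f \<Lambda>"

text \<open>The orbit of a point of the level set alone contributes \<open>exp (o(n))\<close> to the partition sum.\<close>

lemma pressure_nonneg:
  assumes "x \<in> L0"
  shows "0 \<le> geom_pressure d"
proof -
  have x: "x \<in> \<Lambda>" "(\<lambda>n. ln \<bar>Df n x\<bar> / real n) \<longlonglongrightarrow> 0"
    using assms by (auto simp: zero_level_set_def)
  obtain \<omega> where \<omega>: "\<omega> \<in> X" "x = h \<omega>" using x(1) \<Lambda>_coded by blast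
  have lim: "(\<lambda>n. - d * (ln \<bar>Df n x\<bar> / real n)) \<longlonglongrightarrow> - d * 0"
    by (intro tendsto_intros x)
  have "- d * 0 \<le> geom_pressure d"
  proof (rule LIMSEQ_le[OF lim pressure_limit], intro exI allI impI)
    fix n :: nat assume n: "1 \<le> n"
    have "- d * ln \<bar>Df n x\<bar> \<le> ln (partition_sum d n)"
      using partition_sum_ge_orbit[OF \<omega>(1) n, of d] partition_sum_pos[OF n, of d] \<omega>(2) by (simp add: ln_ge_iff)
    then have "- d * ln \<bar>Df n x\<bar> / real n \<le> ln (partition_sum d n) / real n" by (rule divide_right_mono) simp
    then show "- d * (ln \<bar>Df n x\<bar> / real n) \<le> ln (partition_sum d n) / real n" by simp
  qed
  then show ?thesis by simp
qed

text \<open>The partition sum over admissible words only, with \<open>\<beta>\<close> in place of the Birkhoff sums. It agrees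
  with \<open>partition_sum\<close> up to factors \<open>exp (o(n))\<close>.\<close>

definition adm_sum :: "real \<Rightarrow> nat \<Rightarrow> real" where
  "adm_sum d n = (\<Sum>w\<in>{w. admissible w \<and> length w = n}. exp (- d * \<beta> w))"

lemma adm_sum_le_partition_sum:
  assumes "n \<ge> 1"
  shows "adm_sum d n \<le> exp (\<bar>d\<bar> * (real n * \<rho> n)) * partition_sum d n"
proof -
  let ?A = "{w. admissible w \<and> length w = n}"
  have "adm_sum d n \<le> (\<Sum>w\<in>?A. exp (\<bar>d\<bar> * (real n * \<rho> n)) * exp (log_weight d n w))"
    unfolding adm_sum_def
  proof (rule sum_mono)
    fix w assume "w \<in> ?A"
    then obtain \<omega> where \<omega>: "\<omega> \<in> X" "w = initial \<omega> n" unfolding admissible_def by auto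
    have "\<bar>\<beta> w - ln \<bar>Df n (h \<omega>)\<bar>\<bar> \<le> real n * \<rho> n"
      using \<beta>_initial[OF \<omega>(1), of n] \<omega>(2) by simp
    then have "\<bar>d\<bar> * \<bar>\<beta> w - ln \<bar>Df n (h \<omega>)\<bar>\<bar> \<le> \<bar>d\<bar> * (real n * \<rho> n)" by (rule mult_left_mono) simp
    then have "- d * \<beta> w - - d * ln \<bar>Df n (h \<omega>)\<bar> \<le> \<bar>d\<bar> * (real n * \<rho> n)"
      unfolding abs_mult[symmetric] by (simp add: algebra_simps abs_le_iff)
    moreover have "- d * ln \<bar>Df n (h \<omega>)\<bar> \<le> log_weight d n w"
      using log_weight_upper[OF admissible_words_meeting(2)[OF \<omega>(1) assms] h_in[OF \<omega>(1)]] \<omega>(2) by simp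
    ultimately show "exp (- d * \<beta> w) \<le> exp (\<bar>d\<bar> * (real n * \<rho> n)) * exp (log_weight d n w)"
      by (simp flip: exp_add)
  qed
  also have "\<dots> = exp (\<bar>d\<bar> * (real n * \<rho> n)) * (\<Sum>w\<in>?A. exp (log_weight d n w))"
    by (simp add: sum_distrib_left)
  also have "(\<Sum>w\<in>?A. exp (log_weight d n w)) \<le> partition_sum d n"
    unfolding partition_sum_def
  proof (rule sum_mono2[OF finite_words_meeting])
    show "?A \<subseteq> words_meeting p g J \<Lambda> n"
    proof
      fix w assume "w \<in> ?A"
      then obtain \<omega> where "\<omega> \<in> X" "w = initial \<omega> n" unfolding admissible_def by auto
      then show "w \<in> words_meeting p g J \<Lambda> n" using admissible_words_meeting(1)[OF _ assms] by simp
    qed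
  qed simp
  finally show ?thesis by simp
qed

lemma cyl_Icc:
  assumes "letters w" "w \<noteq> []"
  shows "\<exists>a b. a < b \<and> cyl w = {a..b}"
proof -
  obtain u i where w: "w = u @ [i]" using assms(2) by (metis append_butlast_last_id)
  have lu: "letters u" and i: "i \<in> {1..p}" using assms(1) w by auto
  have eq: "cyl w = branch u ` J i" unfolding w by (simp add: cyl_append cyl_single)
  have cont: "continuous_on (J i) (branch u)"
    using branch_continuous[OF lu] J_subset[OF i] by (rule continuous_on_subset)
  have "compact (cyl w)" "connected (cyl w)"
    unfolding eq using cont J_compact[OF i] J_interval[OF i]
    by (auto intro: compact_continuous_image connected_continuous_image simp: is_interval_connected_1)
  then obtain a b where ab: "cyl w = {a..b}" using connected_compact_interval_1 by blast
  have "branch w (fst base) \<in> cyl w" "branch w (snd base) \<in> cyl w"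
    using branch_image_cyl[OF assms] base_ends by auto
  moreover have "branch w (fst base) \<noteq> branch w (snd base)"
    using inj_onD[OF branch_inj[OF assms(1)] _ base_ends] base_interval(1) by auto
  ultimately have "a < b" unfolding ab by auto
  then show ?thesis using ab by blast
qed

text \<open>Apply the packing lemma with a window of width 0.\<close>

lemma cyl_point_multiplicity:
  assumes "n \<ge> 1"
  shows "card {w. letters w \<and> length w = n \<and> x \<in> cyl w} \<le> 2"
proof -
  let ?F = "{w. letters w \<and> length w = n \<and> x \<in> cyl w}"
  have fin: "finite ?F"
    by (rule finite_subset[of _ "{w. set w \<subseteq> {1..p} \<and> length w = n}"])
      (auto intro: finite_lists_length_eq)
  have "\<exists>ab. \<forall>w\<in>?F. fst (ab w) < snd (ab w) \<and> cyl w = {fst (ab w)..snd (ab w)}"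
  proof (rule bchoice, rule ballI)
    fix w assume "w \<in> ?F"
    then have "letters w" "w \<noteq> []" using assms by auto
    from cyl_Icc[OF this] obtain a b where "a < b" "cyl w = {a..b}" by blast
    then show "\<exists>ab. fst ab < snd ab \<and> cyl w = {fst ab..snd ab}" by (intro exI[of _ "(a, b)"]) simp
  qed
  then obtain ab where ab: "\<And>w. w \<in> ?F \<Longrightarrow> fst (ab w) < snd (ab w)"
    "\<And>w. w \<in> ?F \<Longrightarrow> cyl w = {fst (ab w)..snd (ab w)}" by blast
  define r where "r = Min (insert 1 ((\<lambda>w. snd (ab w) - fst (ab w)) ` ?F))"
  have r: "r > 0" unfolding r_def using fin ab(1) by (subst Min_gr_iff) auto
  have "real (card ?F) * r \<le> 0 + 2 * r"
  proof (rule interval_packing[where a = "\<lambda>w. fst (ab w)" and b = "\<lambda>w. snd (ab w)" and c = x])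
    fix u assume u: "u \<in> ?F"
    show "r \<le> snd (ab u) - fst (ab u)" unfolding r_def using fin u by (intro Min_le) auto
    show "{fst (ab u)..snd (ab u)} \<inter> {x..x + 0} \<noteq> {}" using ab(2)[OF u] u by auto
    fix v assume v: "v \<in> ?F" "u \<noteq> v"
    obtain k where k: "k < length u" "k < length v" "u ! k \<noteq> v ! k"
      using differ_index[of u v] u v by auto
    show "{fst (ab u)<..<snd (ab u)} \<inter> {fst (ab v)<..<snd (ab v)} = {}"
    proof (rule ccontr)
      assume "\<not> ?thesis"
      then obtain z where "z \<in> {fst (ab u)<..<snd (ab u)}" "z \<in> {fst (ab v)<..<snd (ab v)}" by blast
      then have z: "fst (ab u) < z" "z < snd (ab u)" "fst (ab v) < z" "z < snd (ab v)" by simp_all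
      define z' where "z' = (z + min (snd (ab u)) (snd (ab v))) / 2"
      have z': "z < z'" "z' < snd (ab u)" "z' < snd (ab v)" using z by (auto simp: z'_def min_def)
      have "z \<in> cyl u \<inter> cyl v" "z' \<in> cyl u \<inter> cyl v"
        unfolding ab(2)[OF u] ab(2)[OF v(1)] using z z' by auto
      then have "z = z'" using cyl_overlap[of u v k z z'] k u v by blast
      then show False using z' by simp
    qed
  qed (use fin r in auto)
  then show ?thesis using r by simp
qed

text \<open>A cylinder can meet \<open>\<Lambda>\<close> without its word being admissible, namely in an endpoint that it
  shares with an admissible cylinder. So it matters how many cylinders touch a given one: any other such
  cylinder contains one of its two endpoints.\<close>

lemma cyl_neighbours:
  assumes "letters u" "length u = n" "n \<ge> 1"
  shows "card {w. letters w \<and> length w = n \<and> cyl w \<inter> cyl u \<noteq> {}} \<le> 5"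
proof -
  have "u \<noteq> []" using assms by auto
  then obtain a b where ab: "a < b" "cyl u = {a..b}" using cyl_Icc[OF assms(1)] by blast
  let ?E = "\<lambda>x. {w. letters w \<and> length w = n \<and> x \<in> cyl w}"
  have fin: "finite (?E x)" for x
    by (rule finite_subset[of _ "{w. set w \<subseteq> {1..p} \<and> length w = n}"])
      (auto intro: finite_lists_length_eq)
  have "{w. letters w \<and> length w = n \<and> cyl w \<inter> cyl u \<noteq> {}} \<subseteq> {u} \<union> ?E a \<union> ?E b"
  proof
    fix w assume w: "w \<in> {w. letters w \<and> length w = n \<and> cyl w \<inter> cyl u \<noteq> {}}"
    show "w \<in> {u} \<union> ?E a \<union> ?E b"
    proof (rule ccontr)
      assume "\<not> ?thesis"
      then have wu: "w \<noteq> u" and ends: "a \<notin> cyl w" "b \<notin> cyl w" using w by auto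
      have "w \<noteq> []" using w assms by auto
      then obtain c d where cd: "c < d" "cyl w = {c..d}" using cyl_Icc[of w] w by blast
      obtain x where "x \<in> cyl w" "x \<in> cyl u" using w by blast
      then have "a < c" "d < b" using ends unfolding cd ab by auto
      then have "c \<in> cyl u \<inter> cyl w" "d \<in> cyl u \<inter> cyl w" unfolding cd ab using cd(1) by auto
      moreover obtain k where "k < length u" "k < length w" "u ! k \<noteq> w ! k"
        using differ_index[of u w] wu w assms by auto
      ultimately have "c = d" using cyl_overlap[of u w k c d] w assms by blast
      then show False using cd by simp
    qed
  qed
  then have "card {w. letters w \<and> length w = n \<and> cyl w \<inter> cyl u \<noteq> {}} \<le> card ({u} \<union> ?E a \<union> ?E b)"
    by (rule card_mono[rotated]) (use fin in auto)
  also have "\<dots> \<le> card {u} + card (?E a) + card (?E b)"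
    using card_Un_le[of "{u} \<union> ?E a" "?E b"] card_Un_le[of "{u}" "?E a"] by linarith
  also have "\<dots> \<le> 1 + 2 + 2"
    by (intro add_mono cyl_point_multiplicity assms) simp
  finally show ?thesis by simp
qed

text \<open>Every word meeting \<open>\<Lambda>\<close> is charged to the code of a point of \<open>\<Lambda>\<close> in its cylinder. An admissible
  word is charged at most five times, and distortion compares the two weights through that point.\<close>

lemma partition_sum_le_adm_sum:
  assumes "n \<ge> 1" "t \<ge> 0"
  shows "partition_sum t n \<le> 5 * exp (2 * t * (real n * \<rho> n)) * adm_sum t n"
proof -
  let ?W = "words_meeting p g J \<Lambda> n"
  let ?A = "{w. admissible w \<and> length w = n}"
  let ?c = "exp (2 * t * (real n * \<rho> n))"
  have "\<exists>c. \<forall>w\<in>?W. c w \<in> X \<and> h (c w) \<in> cyl w"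
  proof (rule bchoice, rule ballI)
    fix w assume "w \<in> ?W"
    then obtain x where x: "x \<in> cyl w" "x \<in> \<Lambda>" by (auto simp: words_meeting_def)
    from x(2) obtain \<omega> where "\<omega> \<in> X" "x = h \<omega>" by (rule \<Lambda>_coded)
    then show "\<exists>\<omega>. \<omega> \<in> X \<and> h \<omega> \<in> cyl w" using x(1) by blast
  qed
  then obtain c where c: "\<And>w. w \<in> ?W \<Longrightarrow> c w \<in> X" "\<And>w. w \<in> ?W \<Longrightarrow> h (c w) \<in> cyl w" by blast
  define u where "u w = initial (c w) n" for w
  have uA: "u w \<in> ?A" if "w \<in> ?W" for w
    unfolding u_def using admissible_initial[OF c(1)[OF that]] by simp
  have "partition_sum t n \<le> (\<Sum>w\<in>?W. ?c * exp (- t * \<beta> (u w)))"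
    unfolding partition_sum_def
  proof (rule sum_mono)
    fix w assume w: "w \<in> ?W"
    have "log_weight t n w \<le> 2 * t * (real n * \<rho> n) + - t * \<beta> (u w)"
    proof (rule log_weight_least[OF w])
      fix x assume x: "x \<in> cyl w" "x \<in> \<Lambda>"
      have "\<bar>Df n (h (c w))\<bar> \<le> exp (real n * \<rho> n) * \<bar>Df n x\<bar>"
        by (rule distortion[OF assms(1) w c(2)[OF w] x(1)])
      then have "ln \<bar>Df n (h (c w))\<bar> \<le> ln (exp (real n * \<rho> n) * \<bar>Df n x\<bar>)"
        using Df_nonzero_\<Lambda>[OF x(2)] Df_nonzero_\<Lambda>[OF h_in[OF c(1)[OF w]]]
        by (subst ln_le_cancel_iff) auto
      also have "\<dots> = real n * \<rho> n + ln \<bar>Df n x\<bar>"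
        using Df_nonzero_\<Lambda>[OF x(2)] by (subst ln_mult) auto
      finally have "\<beta> (u w) \<le> 2 * (real n * \<rho> n) + ln \<bar>Df n x\<bar>"
        using \<beta>_initial(2)[OF c(1)[OF w], of n] unfolding u_def by linarith
      then have "t * \<beta> (u w) \<le> t * (2 * (real n * \<rho> n) + ln \<bar>Df n x\<bar>)"
        using assms(2) by (rule mult_left_mono)
      then show "- t * ln \<bar>Df n x\<bar> \<le> 2 * t * (real n * \<rho> n) + - t * \<beta> (u w)"
        by (simp add: algebra_simps)
    qed
    then show "exp (log_weight t n w) \<le> ?c * exp (- t * \<beta> (u w))" by (simp flip: exp_add)
  qed
  also have "\<dots> = ?c * (\<Sum>w\<in>?W. exp (- t * \<beta> (u w)))" by (simp add: sum_distrib_left)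
  also have "(\<Sum>w\<in>?W. exp (- t * \<beta> (u w))) = (\<Sum>v\<in>?A. \<Sum>w\<in>{w\<in>?W. u w = v}. exp (- t * \<beta> (u w)))"
    by (rule sum.group[symmetric]) (use finite_words_meeting finite_admissible uA in auto)
  also have "\<dots> = (\<Sum>v\<in>?A. real (card {w\<in>?W. u w = v}) * exp (- t * \<beta> v))"
    by (intro sum.cong refl) simp
  also have "\<dots> \<le> (\<Sum>v\<in>?A. 5 * exp (- t * \<beta> v))"
  proof (intro sum_mono mult_right_mono)
    fix v assume v: "v \<in> ?A"
    let ?N = "{w. letters w \<and> length w = n \<and> cyl w \<inter> cyl v \<noteq> {}}"
    have sub: "{w\<in>?W. u w = v} \<subseteq> ?N"
    proof
      fix w assume w: "w \<in> {w\<in>?W. u w = v}"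
      then have "h (c w) \<in> cyl v"
        using admissible_words_meeting(2)[OF c(1) assms(1), of w] unfolding u_def by simp
      then show "w \<in> ?N" using w c(2)[of w] by (auto simp: words_meeting_def)
    qed
    have "finite ?N"
      by (rule finite_subset[of _ "{w. set w \<subseteq> {1..p} \<and> length w = n}"])
        (auto intro: finite_lists_length_eq)
    from card_mono[OF this sub] have "card {w\<in>?W. u w = v} \<le> 5"
      using cyl_neighbours[of v n] v admissible_letters assms(1) by simp
    then show "real (card {w\<in>?W. u w = v}) \<le> 5" by simp
  qed simp
  also have "\<dots> = 5 * adm_sum t n" by (simp add: adm_sum_def sum_distrib_left)
  finally show ?thesis by (simp add: algebra_simps)
qed

section \<open>The function F near zero\<close>

lemma F_fun_le:
  assumes "\<alpha> > 0"
  shows "F_fun p g J \<P> f \<Lambda> \<alpha> \<le> ereal (geom_pressure d / \<alpha> + d)"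
proof -
  have "F_fun p g J \<P> f \<Lambda> \<alpha> \<le> ereal (1 / \<alpha>) * ereal (geom_pressure d + \<alpha> * d)"
    unfolding F_fun_def geom_pressure_def by (rule ereal_mult_left_mono[OF INF_lower]) (use assms in auto)
  also have "\<dots> = ereal (geom_pressure d / \<alpha> + d)" using assms by (simp add: field_simps)
  finally show ?thesis .
qed

lemma F_fun_less:
  assumes "\<alpha> > 0" "F_fun p g J \<P> f \<Lambda> \<alpha> < ereal t"
  shows "\<exists>d. geom_pressure d < \<alpha> * (t - d)"
proof (rule ccontr)
  assume "\<not> ?thesis"
  then have "\<alpha> * (t - d) \<le> geom_pressure d" for d by (meson not_less)
  then have *: "\<alpha> * t \<le> geom_pressure d + \<alpha> * d" for d by (simp add: right_diff_distrib diff_le_eq)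
  have "ereal t = ereal (1 / \<alpha>) * ereal (\<alpha> * t)" using assms(1) by simp
  also have "\<dots> \<le> F_fun p g J \<P> f \<Lambda> \<alpha>"
    unfolding F_fun_def using * unfolding geom_pressure_def
    by (intro ereal_mult_left_mono INF_greatest) (use assms in auto)
  finally show False using assms(2) by simp
qed

text \<open>Since the pressure is nonnegative, \<open>geom_pressure d / \<alpha> + d\<close> does not increase in \<open>\<alpha>\<close> for every \<open>d\<close>.\<close>

lemma F_fun_antimono:
  assumes "L0 \<noteq> {}" "0 < \<alpha>" "\<alpha> \<le> \<alpha>'"
  shows "F_fun p g J \<P> f \<Lambda> \<alpha>' \<le> F_fun p g J \<P> f \<Lambda> \<alpha>"
proof (rule ccontr)
  assume "\<not> ?thesis"
  then obtain t where t: "F_fun p g J \<P> f \<Lambda> \<alpha> < ereal t" "ereal t < F_fun p g J \<P> f \<Lambda> \<alpha>'"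
    using ereal_dense2 by (metis not_le)
  obtain d where d: "geom_pressure d < \<alpha> * (t - d)" using F_fun_less[OF assms(2) t(1)] by blast
  have "0 \<le> geom_pressure d" using pressure_nonneg assms(1) by blast
  then have "0 < \<alpha> * (t - d)" using d by linarith
  then have "0 < t - d" using assms(2) by (simp add: zero_less_mult_iff)
  then have "\<alpha> * (t - d) \<le> \<alpha>' * (t - d)" using assms(3) by (intro mult_right_mono) auto
  then have "geom_pressure d < \<alpha>' * (t - d)" using d by linarith
  then have "geom_pressure d / \<alpha>' + d < t" using assms by (simp add: field_simps)
  then show False using F_fun_le[of \<alpha>' d] t(2) assms by (auto dest: less_le_trans)
qed

lemma F_zero_eq_SUP:
  assumes "L0 \<noteq> {}"
  shows "F_zero p g J \<P> f \<Lambda> = (SUP \<alpha>\<in>{0<..}. F_fun p g J \<P> f \<Lambda> \<alpha>)"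
proof -
  let ?F = "F_fun p g J \<P> f \<Lambda>"
  have "(?F \<longlongrightarrow> (SUP \<alpha>\<in>{0<..}. ?F \<alpha>)) (at_right 0)"
  proof (rule order_tendstoI)
    fix y assume "y < (SUP \<alpha>\<in>{0<..}. ?F \<alpha>)"
    then obtain \<alpha> where \<alpha>: "\<alpha> > 0" "y < ?F \<alpha>" unfolding less_SUP_iff by auto
    show "\<forall>\<^sub>F x in at_right 0. y < ?F x"
      unfolding eventually_at_right_field
      using \<alpha> F_fun_antimono[OF assms] by (intro exI[of _ \<alpha>]) (auto intro: less_le_trans)
  next
    fix y assume y: "(SUP \<alpha>\<in>{0<..}. ?F \<alpha>) < y"
    show "\<forall>\<^sub>F x in at_right 0. ?F x < y"
      using eventually_at_right_less[of 0]
    proof eventually_elim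
      case (elim x)
      then have "?F x \<le> (SUP \<alpha>\<in>{0<..}. ?F \<alpha>)" by (intro SUP_upper) simp
      then show ?case using y by simp
    qed
  qed
  then show ?thesis unfolding F_zero_def by (intro tendsto_Lim) simp_all
qed

text \<open>Take \<open>d = t\<close> in the infimum defining \<open>F\<close>.\<close>

lemma pressure_pos_below_F_zero:
  assumes "L0 \<noteq> {}" "ereal t < F_zero p g J \<P> f \<Lambda>"
  shows "0 < geom_pressure t"
proof -
  obtain \<alpha> where \<alpha>: "\<alpha> > 0" "ereal t < F_fun p g J \<P> f \<Lambda> \<alpha>"
    using assms(2) unfolding F_zero_eq_SUP[OF assms(1)] less_SUP_iff by auto
  have "ereal t < ereal (geom_pressure t / \<alpha> + t)" by (rule less_le_trans[OF \<alpha>(2) F_fun_le[OF \<alpha>(1)]])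
  then show ?thesis using \<alpha>(1) by (simp add: zero_less_divide_iff)
qed

lemma pressure_small_above_F_zero:
  assumes "L0 \<noteq> {}" "F_zero p g J \<P> f \<Lambda> < ereal t" "\<alpha> > 0"
  obtains d where "d < t" "geom_pressure d < \<alpha> * (t - d)"
proof -
  have "F_fun p g J \<P> f \<Lambda> \<alpha> \<le> F_zero p g J \<P> f \<Lambda>"
    unfolding F_zero_eq_SUP[OF assms(1)] using assms(3) by (intro SUP_upper) simp
  then have "F_fun p g J \<P> f \<Lambda> \<alpha> < ereal t" using assms(2) by simp
  then obtain d where d: "geom_pressure d < \<alpha> * (t - d)" using F_fun_less[OF assms(3)] by blast
  have "0 \<le> geom_pressure d" using pressure_nonneg assms(1) by blast
  then have "0 < \<alpha> * (t - d)" using d by linarith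
  then have "d < t" using assms(3) by (simp add: zero_less_mult_iff)
  then show thesis using d by (rule that)
qed

section \<open>Points outside the level set\<close>

lemma ln_Df_ge: "\<exists>C. \<forall>x\<in>\<Lambda>. \<forall>n. - C - real n * \<rho> n \<le> ln \<bar>Df n x\<bar>"
proof -
  obtain C where C: "\<And>w. admissible w \<Longrightarrow> - C \<le> \<beta> w" using \<beta>_bounded_below by blast
  have "- C - real n * \<rho> n \<le> ln \<bar>Df n x\<bar>" if x: "x \<in> \<Lambda>" for n x
  proof -
    obtain \<omega> where \<omega>: "\<omega> \<in> X" "x = h \<omega>" by (rule \<Lambda>_coded[OF x])
    show ?thesis
      using C[OF admissible_initial[OF \<omega>(1), of n]] \<beta>_initial(2)[OF \<omega>(1), of n] \<omega>(2) by simp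
  qed
  then show ?thesis by blast
qed

text \<open>Only an upper bound has to be checked, since cylinders have bounded length and so exponents are
  never negative.\<close>

lemma L0_iff:
  assumes "x \<in> \<Lambda>"
  shows "x \<in> L0 \<longleftrightarrow> (\<forall>\<epsilon>>0. \<forall>\<^sub>F n in sequentially. ln \<bar>Df n x\<bar> \<le> \<epsilon> * real n)"
proof
  assume "x \<in> L0"
  then have lim: "(\<lambda>n. ln \<bar>Df n x\<bar> / real n) \<longlonglongrightarrow> 0" by (simp add: zero_level_set_def)
  show "\<forall>\<epsilon>>0. \<forall>\<^sub>F n in sequentially. ln \<bar>Df n x\<bar> \<le> \<epsilon> * real n"
  proof (intro allI impI)
    fix \<epsilon> :: real assume "\<epsilon> > 0"
    from order_tendstoD(2)[OF lim this] eventually_gt_at_top[of 0]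
    show "\<forall>\<^sub>F n in sequentially. ln \<bar>Df n x\<bar> \<le> \<epsilon> * real n"
      by eventually_elim (simp add: divide_less_eq)
  qed
next
  assume up: "\<forall>\<epsilon>>0. \<forall>\<^sub>F n in sequentially. ln \<bar>Df n x\<bar> \<le> \<epsilon> * real n"
  obtain C where C: "\<And>n. - C - real n * \<rho> n \<le> ln \<bar>Df n x\<bar>" using ln_Df_ge assms by blast
  have "(\<lambda>n. ln \<bar>Df n x\<bar> / real n) \<longlonglongrightarrow> 0"
  proof (rule order_tendstoI)
    fix y :: real assume "y < 0"
    have "(\<lambda>n. - C / real n - \<rho> n) \<longlonglongrightarrow> 0 - 0"
      by (intro tendsto_diff lim_const_over_n \<rho>_limit)
    then have "\<forall>\<^sub>F n in sequentially. y < - C / real n - \<rho> n"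
      using \<open>y < 0\<close> by (intro order_tendstoD) auto
    then show "\<forall>\<^sub>F n in sequentially. y < ln \<bar>Df n x\<bar> / real n"
      using eventually_gt_at_top[of 0]
    proof eventually_elim
      case (elim n)
      have "- C / real n - \<rho> n = (- C - real n * \<rho> n) / real n" using elim by (simp add: field_simps)
      also have "\<dots> \<le> ln \<bar>Df n x\<bar> / real n" by (rule divide_right_mono[OF C]) simp
      finally show ?case using elim by simp
    qed
  next
    fix y :: real assume y: "0 < y"
    have "\<forall>\<^sub>F n in sequentially. ln \<bar>Df n x\<bar> \<le> (y / 2) * real n" by (rule up[rule_format]) (use y in simp)
    then show "\<forall>\<^sub>F n in sequentially. ln \<bar>Df n x\<bar> / real n < y"
      using eventually_gt_at_top[of 0]
    proof eventually_elim
      case (elim n)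
      have "ln \<bar>Df n x\<bar> / real n \<le> y / 2" using elim by (simp add: divide_le_eq)
      then show ?case using y by linarith
    qed
  qed
  then show "x \<in> L0" using assms by (simp add: zero_level_set_def)
qed

lemma eventually_distortion_le:
  assumes "0 < c"
  shows "\<forall>\<^sub>F n in sequentially. C * \<rho> n \<le> c"
proof -
  have "(\<lambda>n. C * \<rho> n) \<longlonglongrightarrow> C * 0" by (intro tendsto_intros \<rho>_limit)
  then have "\<forall>\<^sub>F n in sequentially. C * \<rho> n < c" using assms by (intro order_tendstoD) auto
  then show ?thesis by eventually_elim simp
qed

text \<open>The cover consists of the images of \<open>\<Lambda>\<close> under the branches of all words of length at least \<open>N\<close>
  with \<open>\<beta> w \<ge> \<alpha> (length w)\<close>. For these \<open>exp (- t \<beta> w) \<le> exp (- (t - d) \<alpha> n) exp (- d \<beta> w)\<close> at level \<open>n\<close>, so the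
  hypothesis on the pressure makes the level sums decay exponentially.\<close>

lemma expanding_points_null:
  assumes "0 < t" "0 < \<alpha>" "d < t" "geom_pressure d < \<alpha> * (t - d)"
  shows "hausdorff_measure t {x\<in>\<Lambda>. \<exists>\<^sub>F n in sequentially. \<alpha> * real n < ln \<bar>Df n x\<bar>} = 0"
    (is "hausdorff_measure t ?B = 0")
proof (rule hausdorff_null_countable_cover[where 'b = "nat list"])
  fix \<delta> e :: real assume de: "\<delta> > 0" "e > 0"
  \<comment> \<open>One half of the gap absorbs the limit defining the pressure, a further part the distortion.\<close>
  define \<eta> where "\<eta> = (\<alpha> * (t - d) - geom_pressure d) / 2"
  have \<eta>: "\<eta> > 0" "geom_pressure d < \<alpha> * (t - d) - \<eta>" using assms by (auto simp: \<eta>_def field_simps)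
  define Q where "Q = exp (- \<eta> / 2)"
  have Q: "0 < Q" "Q < 1" using \<eta> by (auto simp: Q_def)
  define C where "C = (1 + diameter \<Lambda>) powr t"
  have diam: "0 \<le> diameter \<Lambda>" by (rule diameter_ge_0) (rule compact_imp_bounded[OF \<Lambda>_compact])
  have "C \<ge> 0" by (simp add: C_def)
  have "\<forall>\<^sub>F n in sequentially. ln (partition_sum d n) / real n < \<alpha> * (t - d) - \<eta>"
    by (rule order_tendstoD(2)[OF pressure_limit \<eta>(2)])
  moreover have "\<forall>\<^sub>F n in sequentially. (t + \<bar>d\<bar>) * \<rho> n \<le> \<eta> / 2"
    by (rule eventually_distortion_le) (use \<eta> in simp)
  moreover have "\<forall>\<^sub>F n in sequentially. 1 * \<rho> n \<le> \<alpha> / 2" by (rule eventually_distortion_le) (use assms in simp)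
  moreover have "\<forall>\<^sub>F n in sequentially. (exp (- (\<alpha> / 2))) ^ n * diameter \<Lambda> < \<delta>"
  proof -
    have "(\<lambda>n. (exp (- (\<alpha> / 2))) ^ n * diameter \<Lambda>) \<longlonglongrightarrow> 0 * diameter \<Lambda>"
      by (intro tendsto_intros LIMSEQ_realpow_zero) (use assms in auto)
    then show ?thesis using de by (intro order_tendstoD) auto
  qed
  moreover have "\<forall>\<^sub>F n in sequentially. C * Q ^ n / (1 - Q) < e"
  proof -
    have "(\<lambda>n. C * Q ^ n / (1 - Q)) \<longlonglongrightarrow> C * 0 / (1 - Q)"
      by (intro tendsto_intros LIMSEQ_realpow_zero) (use Q in auto)
    then show ?thesis using de by (intro order_tendstoD) auto
  qed
  moreover have "\<forall>\<^sub>F n :: nat in sequentially. 1 \<le> n" by (rule eventually_ge_at_top)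
  ultimately have "\<forall>\<^sub>F n in sequentially. ln (partition_sum d n) / real n < \<alpha> * (t - d) - \<eta> \<and>
      (t + \<bar>d\<bar>) * \<rho> n \<le> \<eta> / 2 \<and> \<rho> n \<le> \<alpha> / 2 \<and> (exp (- (\<alpha> / 2))) ^ n * diameter \<Lambda> < \<delta> \<and>
      C * Q ^ n / (1 - Q) < e \<and> 1 \<le> n"
    by eventually_elim simp
  then obtain N where N: "\<And>n. n \<ge> N \<Longrightarrow> ln (partition_sum d n) / real n < \<alpha> * (t - d) - \<eta>"
    "\<And>n. n \<ge> N \<Longrightarrow> (t + \<bar>d\<bar>) * \<rho> n \<le> \<eta> / 2" "\<And>n. n \<ge> N \<Longrightarrow> \<rho> n \<le> \<alpha> / 2"
    "\<And>n. n \<ge> N \<Longrightarrow> (exp (- (\<alpha> / 2))) ^ n * diameter \<Lambda> < \<delta>"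
    "\<And>n. n \<ge> N \<Longrightarrow> C * Q ^ n / (1 - Q) < e" "\<And>n. n \<ge> N \<Longrightarrow> 1 \<le> n"
    unfolding eventually_sequentially by blast
  define G where "G = {w. admissible w \<and> N \<le> length w \<and> \<alpha> * real (length w) \<le> \<beta> w}"
  define U where "U w = (if w \<in> G then branch w ` \<Lambda> else {})" for w
  have diam_U: "diameter (U w) \<le> exp (real (length w) * \<rho> (length w) - \<beta> w) * diameter \<Lambda>"
    and bdd_U: "bounded (U w)" if w: "w \<in> G" for w
  proof -
    let ?c = "exp (real (length w) * \<rho> (length w) - \<beta> w)"
    have adm: "admissible w" using w by (simp add: G_def)
    have dist: "dist (branch w x) (branch w y) \<le> ?c * diameter \<Lambda>" if "x \<in> \<Lambda>" "y \<in> \<Lambda>" for x y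
    proof -
      have "dist (branch w x) (branch w y) \<le> ?c * dist x y"
        using distance_contraction[OF adm, of x y] that \<Lambda>_subset by (auto simp: dist_real_def)
      also have "\<dots> \<le> ?c * diameter \<Lambda>"
        using that by (intro mult_left_mono diameter_bounded_bound compact_imp_bounded \<Lambda>_compact) auto
      finally show ?thesis .
    qed
    show "diameter (U w) \<le> ?c * diameter \<Lambda>"
      unfolding U_def using w \<Lambda>_nonempty dist by (auto intro!: diameter_le simp: dist_norm)
    have "compact (branch w ` \<Lambda>)"
      by (intro compact_continuous_image \<Lambda>_compact
          continuous_on_subset[OF branch_continuous[OF admissible_letters[OF adm]] \<Lambda>_subset])
    then show "bounded (U w)" unfolding U_def using w compact_imp_bounded by auto
  qed
  have cover: "?B \<subseteq> (\<Union>w. U w)"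
  proof
    fix x assume x: "x \<in> ?B"
    then obtain n where n: "n \<ge> N" "\<alpha> * real n < ln \<bar>Df n x\<bar>"
      by (auto simp: frequently_sequentially)
    obtain \<omega> where \<omega>: "\<omega> \<in> X" "x = h \<omega>" using x \<Lambda>_coded by blast
    have "initial \<omega> n \<in> G"
      unfolding G_def using n \<beta>_initial(1)[OF \<omega>(1), of n] \<omega>(2) admissible_initial[OF \<omega>(1)] by simp
    moreover have "x \<in> branch (initial \<omega> n) ` \<Lambda>"
      using branch_h[OF \<omega>(1), of n] h_in[OF SFT_shift[OF \<omega>(1), of n]] \<omega>(2) by force
    ultimately show "x \<in> (\<Union>w. U w)" unfolding U_def by (intro UN_I[of "initial \<omega> n"]) auto
  qed
  have small: "diameter (U w) \<le> \<delta>" if w: "w \<in> G" for w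
  proof -
    let ?n = "length w"
    have nN: "N \<le> ?n" using w by (simp add: G_def)
    have "real ?n * \<rho> ?n - \<beta> w \<le> real ?n * (\<alpha> / 2) - \<alpha> * real ?n"
    proof (rule diff_mono)
      show "real ?n * \<rho> ?n \<le> real ?n * (\<alpha> / 2)" by (rule mult_left_mono[OF N(3)[OF nN]]) simp
      show "\<alpha> * real ?n \<le> \<beta> w" using w by (simp add: G_def)
    qed
    then have "exp (real ?n * \<rho> ?n - \<beta> w) \<le> exp (real ?n * (- (\<alpha> / 2)))" by (simp add: algebra_simps)
    also have "\<dots> = exp (- (\<alpha> / 2)) ^ ?n" by (rule exp_of_nat_mult)
    finally have "exp (real ?n * \<rho> ?n - \<beta> w) * diameter \<Lambda> \<le> exp (- (\<alpha> / 2)) ^ ?n * diameter \<Lambda>"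
      using diam by (rule mult_right_mono)
    then show ?thesis using diam_U[OF w] N(4)[OF nN] by linarith
  qed
  have weight: "hausdorff_weight t (U w) \<le>
      ennreal (C * exp (t * (real (length w) * \<rho> (length w))) * exp (- t * \<beta> w))"
    if w: "w \<in> G" for w
  proof -
    let ?s = "real (length w) * \<rho> (length w)"
    have "diameter (U w) powr t \<le> (exp (?s - \<beta> w) * diameter \<Lambda>) powr t"
      by (rule powr_mono2) (use diam_U[OF w] diameter_ge_0[OF bdd_U[OF w]] assms in auto)
    also have "\<dots> \<le> (exp (?s - \<beta> w) * (1 + diameter \<Lambda>)) powr t"
      by (rule powr_mono2) (use diam assms in auto)
    also have "\<dots> = exp (t * (?s - \<beta> w)) * C"
      unfolding C_def using diam by (simp add: powr_mult exp_powr_real mult.commute)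
    also have "exp (t * (?s - \<beta> w)) = exp (t * ?s) * exp (- t * \<beta> w)"
      by (simp add: algebra_simps flip: exp_add)
    finally have "diameter (U w) powr t \<le> C * exp (t * ?s) * exp (- t * \<beta> w)"
      by (simp add: algebra_simps)
    then show ?thesis using assms(1) by (simp add: hausdorff_weight_def ennreal_leI)
  qed
  have level: "(\<Sum>w\<in>{w\<in>F. length w = n}. C * exp (t * (real (length w) * \<rho> (length w))) * exp (- t * \<beta> w))
      \<le> C * Q ^ n" if F: "finite F" "F \<subseteq> G" and n: "N \<le> n" for F n
  proof -
    let ?s = "real n * \<rho> n"
    let ?A = "{w. admissible w \<and> length w = n}"
    have "(\<Sum>w\<in>{w\<in>F. length w = n}. C * exp (t * (real (length w) * \<rho> (length w))) * exp (- t * \<beta> w))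
        = C * exp (t * ?s) * (\<Sum>w\<in>{w\<in>F. length w = n}. exp (- t * \<beta> w))"
      by (simp add: sum_distrib_left)
    also have "(\<Sum>w\<in>{w\<in>F. length w = n}. exp (- t * \<beta> w))
        \<le> (\<Sum>w\<in>{w\<in>F. length w = n}. exp (- (t - d) * (\<alpha> * real n)) * exp (- d * \<beta> w))"
    proof (rule sum_mono)
      fix w assume "w \<in> {w\<in>F. length w = n}"
      then have "\<alpha> * real n \<le> \<beta> w" using F by (auto simp: G_def)
      then have "(t - d) * (\<alpha> * real n) \<le> (t - d) * \<beta> w" using assms(3) by (intro mult_left_mono) auto
      then show "exp (- t * \<beta> w) \<le> exp (- (t - d) * (\<alpha> * real n)) * exp (- d * \<beta> w)"
        by (simp add: algebra_simps flip: exp_add)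
    qed
    also have "\<dots> = exp (- (t - d) * (\<alpha> * real n)) * (\<Sum>w\<in>{w\<in>F. length w = n}. exp (- d * \<beta> w))"
      by (simp add: sum_distrib_left)
    also have "(\<Sum>w\<in>{w\<in>F. length w = n}. exp (- d * \<beta> w)) \<le> adm_sum d n"
      unfolding adm_sum_def by (rule sum_mono2) (use finite_admissible F in \<open>auto simp: G_def\<close>)
    also have "adm_sum d n \<le> exp (\<bar>d\<bar> * ?s) * partition_sum d n" by (rule adm_sum_le_partition_sum[OF N(6)[OF n]])
    also have "partition_sum d n \<le> exp (real n * (\<alpha> * (t - d) - \<eta>))"
    proof -
      have "ln (partition_sum d n) \<le> real n * (\<alpha> * (t - d) - \<eta>)"
        using N(1)[OF n] N(6)[OF n] by (simp add: divide_less_eq mult.commute)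
      then show ?thesis using partition_sum_pos[OF N(6)[OF n], of d] by (metis exp_le_cancel_iff exp_ln)
    qed
    finally have "(\<Sum>w\<in>{w\<in>F. length w = n}. C * exp (t * (real (length w) * \<rho> (length w))) * exp (- t * \<beta> w))
        \<le> C * exp (t * ?s) * (exp (- (t - d) * (\<alpha> * real n)) *
          (exp (\<bar>d\<bar> * ?s) * exp (real n * (\<alpha> * (t - d) - \<eta>))))"
      using \<open>C \<ge> 0\<close> by (simp add: mult_left_mono)
    also have "\<dots> = C * exp (real n * ((t + \<bar>d\<bar>) * \<rho> n - \<eta>))"
      by (simp add: algebra_simps flip: exp_add)
    also have "\<dots> \<le> C * exp (real n * (- \<eta> / 2))"
    proof -
      have "(t + \<bar>d\<bar>) * \<rho> n - \<eta> \<le> - \<eta> / 2" using N(2)[OF n] by linarith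
      then have "real n * ((t + \<bar>d\<bar>) * \<rho> n - \<eta>) \<le> real n * (- \<eta> / 2)"
        by (rule mult_left_mono) simp
      then show ?thesis using \<open>C \<ge> 0\<close> by (intro mult_left_mono) simp_all
    qed
    also have "\<dots> = C * Q ^ n" unfolding Q_def by (simp only: exp_of_nat_mult)
    finally show ?thesis .
  qed
  have total: "(\<Sum>w\<in>F. hausdorff_weight t (U w)) \<le> ennreal e" if "finite F" for F
  proof -
    let ?a = "\<lambda>w. C * exp (t * (real (length w) * \<rho> (length w))) * exp (- t * \<beta> w)"
    have "(\<Sum>w\<in>F. hausdorff_weight t (U w)) = (\<Sum>w\<in>F \<inter> G. hausdorff_weight t (U w))"
      by (rule sum.mono_neutral_right) (use that in \<open>auto simp: U_def hausdorff_weight_def\<close>)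
    also have "\<dots> \<le> (\<Sum>w\<in>F \<inter> G. ennreal (?a w))" by (rule sum_mono) (use weight in auto)
    also have "\<dots> = ennreal (\<Sum>w\<in>F \<inter> G. ?a w)" using \<open>C \<ge> 0\<close> by (intro sum_ennreal) simp
    also have "(\<Sum>w\<in>F \<inter> G. ?a w) \<le> C * Q ^ N / (1 - Q)"
    proof (rule sum_by_length_le)
      fix n assume "N \<le> n"
      then show "(\<Sum>w\<in>{w\<in>F \<inter> G. length w = n}. ?a w) \<le> C * Q ^ n"
        by (intro level) (use that in auto)
    qed (use that Q \<open>C \<ge> 0\<close> in \<open>auto simp: G_def\<close>)
    also have "\<dots> \<le> e" using N(5)[of N] by simp
    finally show ?thesis by (simp add: ennreal_leI)
  qed
  have "bounded (U w) \<and> diameter (U w) \<le> \<delta>" for w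
    using bdd_U small de by (cases "w \<in> G") (auto simp: U_def)
  then show "\<exists>U :: nat list \<Rightarrow> _. ?B \<subseteq> (\<Union>i. U i) \<and> (\<forall>i. bounded (U i) \<and> diameter (U i) \<le> \<delta>)
      \<and> (\<forall>F. finite F \<longrightarrow> (\<Sum>i\<in>F. hausdorff_weight t (U i)) \<le> ennreal e)"
    using cover total by (intro exI[of _ U]) blast
qed

lemma complement_level_set_null:
  assumes "L0 \<noteq> {}" "F_zero p g J \<P> f \<Lambda> < ereal t" "0 < t"
  shows "hausdorff_measure t (\<Lambda> - L0) = 0"
proof (rule hausdorff_null_subset)
  let ?B = "\<lambda>m::nat. {x\<in>\<Lambda>. \<exists>\<^sub>F n in sequentially. (1 / real (Suc m)) * real n < ln \<bar>Df n x\<bar>}"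
  show "hausdorff_measure t (\<Union>m. ?B m) = 0"
  proof (rule hausdorff_null_UN)
    fix m :: nat
    have pos: "1 / real (Suc m) > 0" by simp
    obtain d where "d < t" "geom_pressure d < (1 / real (Suc m)) * (t - d)"
      by (rule pressure_small_above_F_zero[OF assms(1,2) pos])
    then show "hausdorff_measure t (?B m) = 0" by (rule expanding_points_null[OF assms(3) pos])
  qed
  show "\<Lambda> - L0 \<subseteq> (\<Union>m. ?B m)"
  proof
    fix x assume x: "x \<in> \<Lambda> - L0"
    then obtain \<epsilon> where \<epsilon>: "\<epsilon> > 0" "\<exists>\<^sub>F n in sequentially. \<epsilon> * real n < ln \<bar>Df n x\<bar>"
      using L0_iff[of x] by (auto simp: not_eventually not_le)
    obtain m where m: "1 / real (Suc m) < \<epsilon>"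
      using \<epsilon>(1) reals_Archimedean[of \<epsilon>] by (auto simp: inverse_eq_divide)
    have "\<exists>\<^sub>F n in sequentially. (1 / real (Suc m)) * real n < ln \<bar>Df n x\<bar>"
    proof (rule frequently_elim1[OF \<epsilon>(2)])
      fix n assume "\<epsilon> * real n < ln \<bar>Df n x\<bar>"
      moreover have "(1 / real (Suc m)) * real n \<le> \<epsilon> * real n" using m by (intro mult_right_mono) auto
      ultimately show "(1 / real (Suc m)) * real n < ln \<bar>Df n x\<bar>" by linarith
    qed
    then show "x \<in> (\<Union>m. ?B m)" using x by blast
  qed
qed

section \<open>Entropy of the level set\<close>

text \<open>Uniform continuity of the coding, by compactness of \<open>\<Lambda>\<close> and continuity of the inverse of
  \<open>h\<close>.\<close>

lemma code_uniform:
  assumes "\<epsilon> > 0"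
  shows "\<exists>m. \<forall>\<omega>\<in>X. \<forall>\<omega>'\<in>X. initial \<omega> m = initial \<omega>' m \<longrightarrow> dist (h \<omega>) (h \<omega>') < \<epsilon>"
proof (rule ccontr)
  assume "\<not> ?thesis"
  then have far: "\<exists>\<omega>\<in>X. \<exists>\<omega>'\<in>X. initial \<omega> m = initial \<omega>' m \<and> \<epsilon> \<le> dist (h \<omega>) (h \<omega>')" for m
    by (meson not_le)
  have "\<exists>q. fst q \<in> X \<and> snd q \<in> X \<and> initial (fst q) m = initial (snd q) m \<and>
      \<epsilon> \<le> dist (h (fst q)) (h (snd q))" for m
  proof -
    from far[of m] obtain \<omega> \<omega>' where "\<omega> \<in> X" "\<omega>' \<in> X" "initial \<omega> m = initial \<omega>' m"
      "\<epsilon> \<le> dist (h \<omega>) (h \<omega>')" by (elim bexE conjE)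
    then show ?thesis by (intro exI[of _ "(\<omega>, \<omega>')"]) simp
  qed
  then have "\<exists>q. \<forall>m. fst (q m) \<in> X \<and> snd (q m) \<in> X \<and> initial (fst (q m)) m = initial (snd (q m)) m \<and>
      \<epsilon> \<le> dist (h (fst (q m))) (h (snd (q m)))"
    by (intro choice allI)
  then obtain q where q': "\<forall>m. fst (q m) \<in> X \<and> snd (q m) \<in> X \<and>
      initial (fst (q m)) m = initial (snd (q m)) m \<and> \<epsilon> \<le> dist (h (fst (q m))) (h (snd (q m)))" ..
  then have q: "\<And>m. fst (q m) \<in> X" "\<And>m. snd (q m) \<in> X"
    "\<And>m. initial (fst (q m)) m = initial (snd (q m)) m"
    "\<And>m. \<epsilon> \<le> dist (h (fst (q m))) (h (snd (q m)))" by simp_all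
  obtain k where k: "homeomorphism X \<Lambda> h k"
    using conjugacy unfolding topological_conjugacy_def by blast
  then have kcont: "continuous_on \<Lambda> k" and kh: "\<And>\<omega>. \<omega> \<in> X \<Longrightarrow> k (h \<omega>) = \<omega>"
    and k_in: "\<And>x. x \<in> \<Lambda> \<Longrightarrow> k x \<in> X" and hk: "\<And>x. x \<in> \<Lambda> \<Longrightarrow> h (k x) = x"
    unfolding homeomorphism_def by auto
  let ?y = "\<lambda>m. (h (fst (q m)), h (snd (q m)))"
  have "compact (\<Lambda> \<times> \<Lambda>)" by (intro compact_Times \<Lambda>_compact)
  moreover have "\<forall>m. ?y m \<in> \<Lambda> \<times> \<Lambda>" using q h_in by simp
  ultimately obtain l r where l: "l \<in> \<Lambda> \<times> \<Lambda>" "strict_mono r" "(?y \<circ> r) \<longlonglongrightarrow> l"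
    unfolding compact_def by meson
  have l1: "(\<lambda>n. h (fst (q (r n)))) \<longlonglongrightarrow> fst l" and l2: "(\<lambda>n. h (snd (q (r n)))) \<longlonglongrightarrow> snd l"
    using tendsto_fst[OF l(3)] tendsto_snd[OF l(3)] by (simp_all add: comp_def)
  have L: "fst l \<in> \<Lambda>" "snd l \<in> \<Lambda>" using l(1) by auto
  have "(\<lambda>n. k (h (fst (q (r n))))) \<longlonglongrightarrow> k (fst l)"
    by (rule continuous_on_tendsto_compose[OF kcont l1 L(1)]) (use q h_in in auto)
  then have k1: "(\<lambda>n. fst (q (r n))) \<longlonglongrightarrow> k (fst l)" using kh q by simp
  have "(\<lambda>n. k (h (snd (q (r n))))) \<longlonglongrightarrow> k (snd l)"
    by (rule continuous_on_tendsto_compose[OF kcont l2 L(2)]) (use q h_in in auto)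
  then have k2: "(\<lambda>n. snd (q (r n))) \<longlonglongrightarrow> k (snd l)" using kh q by simp
  \<comment> \<open>The codes of the two limit points agree in every coordinate, so these points coincide.\<close>
  have "k (fst l) i = k (snd l) i" for i
  proof -
    have coord: "continuous_on UNIV (\<lambda>\<omega> :: nat \<Rightarrow> nat. \<omega> i)"
      by (rule continuous_on_product_coordinates)
    have lim: "(\<lambda>n. fst (q (r n)) i) \<longlonglongrightarrow> k (fst l) i" "(\<lambda>n. snd (q (r n)) i) \<longlonglongrightarrow> k (snd l) i"
      using continuous_on_tendsto_compose[OF coord k1] continuous_on_tendsto_compose[OF coord k2] by auto
    have "\<forall>\<^sub>F n in sequentially. fst (q (r n)) i = snd (q (r n)) i"
      using eventually_gt_at_top[of i]
    proof eventually_elim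
      case (elim n)
      then have "i < r n" using seq_suble[OF l(2), of n] by linarith
      then show ?case using arg_cong[OF q(3)[of "r n"], of "\<lambda>w. w ! i"] by simp
    qed
    then have "(\<lambda>n. fst (q (r n)) i) \<longlonglongrightarrow> k (snd l) i"
      by (rule iffD2[OF tendsto_cong lim(2)])
    with lim(1) show ?thesis by (rule LIMSEQ_unique)
  qed
  then have "k (fst l) = k (snd l)" by (rule ext)
  then have "h (k (fst l)) = h (k (snd l))" by (rule arg_cong)
  then have "fst l = snd l" by (simp only: hk L)
  moreover have "\<epsilon> \<le> dist (fst l) (snd l)"
    by (rule LIMSEQ_le_const[OF tendsto_dist[OF l1 l2]]) (use q in auto)
  ultimately show False using assms by simp
qed

definition slow_words :: "real \<Rightarrow> nat \<Rightarrow> nat list set" where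
  "slow_words \<kappa> n = {w. admissible w \<and> length w = n \<and> \<beta> w \<le> \<kappa> * real n}"

text \<open>The cylinder of such a word is not shorter than \<open>width * exp (- \<kappa> n)\<close>, and all cylinders lie in a
  fixed bounded interval.\<close>

lemma card_slow_words: "\<exists>C\<ge>0. \<forall>\<kappa>\<ge>0. \<forall>n\<ge>1. real (card (slow_words \<kappa> n)) \<le> C * exp (\<kappa> * real n)"
proof -
  obtain R where R: "R > 0" "\<And>w y. letters w \<Longrightarrow> w \<noteq> [] \<Longrightarrow> y \<in> I \<Longrightarrow> branch w y \<in> {-R..R}"
    using branch_bounded by blast
  have "real (card (slow_words \<kappa> n)) \<le> (2 * R / width + 2) * exp (\<kappa> * real n)"
    if "\<kappa> \<ge> 0" "n \<ge> 1" for \<kappa> n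
  proof -
    let ?r = "width * exp (- (\<kappa> * real n))"
    have r: "?r > 0" using width_pos by simp
    have "real (card (slow_words \<kappa> n)) * ?r \<le> 2 * R + 2 * ?r"
    proof (rule words_packing[where c = "-R"])
      show "finite (slow_words \<kappa> n)"
        by (rule finite_subset[OF _ finite_admissible[of n]]) (auto simp: slow_words_def)
    next
      fix u v assume "u \<in> slow_words \<kappa> n" "v \<in> slow_words \<kappa> n" "u \<noteq> v"
      then show "\<exists>k<min (length u) (length v). u ! k \<noteq> v ! k"
        using differ_index[of u v] by (auto simp: slow_words_def)
    next
      fix w assume w: "w \<in> slow_words \<kappa> n"
      then show "admissible w" "?r \<le> width * exp (- \<beta> w)"
        using width_pos by (auto simp: slow_words_def)
      have "w \<noteq> []" using w that by (auto simp: slow_words_def)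
      then have "branch w (fst base) \<in> {-R..R}"
        using w R(2)[OF admissible_letters _ base_ends(1)] by (auto simp: slow_words_def)
      then show "branch w ` {fst base..snd base} \<inter> {- R..- R + 2 * R} \<noteq> {}"
        using base_interval(1) by (intro ex_in_conv[THEN iffD1] exI[of _ "branch w (fst base)"]) auto
    qed (use R r in auto)
    then have "real (card (slow_words \<kappa> n)) \<le> (2 * R + 2 * ?r) / ?r"
      by (rule iffD2[OF pos_le_divide_eq[OF r]])
    also have "\<dots> = 2 * R / ?r + 2" using width_pos by (simp add: add_divide_distrib)
    finally have "real (card (slow_words \<kappa> n)) \<le> 2 * R / ?r + 2" .
    also have "2 * R / ?r = 2 * R / width * exp (\<kappa> * real n)" by (simp add: exp_minus field_simps)
    also have "\<dots> + 2 \<le> (2 * R / width + 2) * exp (\<kappa> * real n)"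
      using that by (simp add: distrib_right)
    finally show ?thesis .
  qed
  then show ?thesis using R(1) width_pos
    by (intro exI[of _ "2 * R / width + 2"]) auto
qed

text \<open>The codes of a point of the level set belong to \<open>slow_words (s / 2)\<close> from some level on. If \<open>m\<close>
  common letters force a distance below \<open>\<epsilon>\<close>, the cylinder of a word of length \<open>n\<close> is contained in a Bowen
  ball of length \<open>n - m\<close>. So at level \<open>n\<close> there are about \<open>exp (n s / 2)\<close> balls of weight
  \<open>exp (- s (n - m))\<close>.\<close>

lemma bowen_M_level_set_le:
  assumes "0 < s" "0 < \<epsilon>"
  shows "\<exists>C\<ge>0. \<forall>N\<ge>1. bowen_M f \<Lambda> L0 s \<epsilon> N \<le> ennreal (C * exp (- s / 2) ^ N)"
proof -
  obtain m where m: "\<And>\<omega> \<omega>'. \<omega> \<in> X \<Longrightarrow> \<omega>' \<in> X \<Longrightarrow> initial \<omega> m = initial \<omega>' m \<Longrightarrow> dist (h \<omega>) (h \<omega>') < \<epsilon>"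
    using code_uniform[OF assms(2)] by blast
  define \<kappa> where "\<kappa> = s / 2"
  have \<kappa>: "\<kappa> > 0" "\<kappa> \<ge> 0" using assms by (auto simp: \<kappa>_def)
  obtain C where C: "C \<ge> 0" "\<And>n. n \<ge> 1 \<Longrightarrow> real (card (slow_words \<kappa> n)) \<le> C * exp (\<kappa> * real n)"
    using card_slow_words \<kappa>(2) by blast
  define q where "q = exp (- s / 2)"
  have q: "0 < q" "q < 1" using assms by (auto simp: q_def)
  define code where "code w = (SOME \<omega>. \<omega> \<in> X \<and> w = initial \<omega> (length w))" for w
  have code: "code w \<in> X" "initial (code w) (length w) = w" if "admissible w" for w
  proof -
    have "\<exists>\<omega>. \<omega> \<in> X \<and> w = initial \<omega> (length w)" using that unfolding admissible_def by blast
    from someI_ex[OF this] show "code w \<in> X" "initial (code w) (length w) = w"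
      unfolding code_def by auto
  qed
  define C' where "C' = C * exp (s * real m) / (1 - q)"
  have "bowen_M f \<Lambda> L0 s \<epsilon> N \<le> ennreal (C' * q ^ N)" if N: "N \<ge> 1" for N
  proof -
    define G where "G = {w. N + m \<le> length w \<and> w \<in> slow_words \<kappa> (length w)}"
    define \<psi> where "\<psi> w = (h (code w), length w - m)" for w
    have G_adm: "admissible w" if "w \<in> G" for w using that by (simp add: G_def slow_words_def)
    have cover: "L0 \<subseteq> (\<Union>(x, n)\<in>\<psi> ` G. bowen_ball f \<Lambda> \<epsilon> n x)"
    proof
      fix x assume x: "x \<in> L0"
      then have x\<Lambda>: "x \<in> \<Lambda>" by (simp add: zero_level_set_def)
      obtain \<omega> where \<omega>: "\<omega> \<in> X" "x = h \<omega>" by (rule \<Lambda>_coded[OF x\<Lambda>])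
      have "\<forall>\<^sub>F n in sequentially. ln \<bar>Df n x\<bar> \<le> \<kappa> / 2 * real n"
        using x L0_iff[OF x\<Lambda>] \<kappa>(1) by (metis half_gt_zero)
      moreover have "\<forall>\<^sub>F n in sequentially. 1 * \<rho> n \<le> \<kappa> / 2" by (rule eventually_distortion_le) (use \<kappa> in simp)
      moreover have "\<forall>\<^sub>F n in sequentially. N + m \<le> n" by (rule eventually_ge_at_top)
      ultimately have "\<forall>\<^sub>F n in sequentially. initial \<omega> n \<in> G"
      proof eventually_elim
        case (elim n)
        have "\<beta> (initial \<omega> n) \<le> \<kappa> / 2 * real n + real n * \<rho> n"
          using \<beta>_initial(2)[OF \<omega>(1), of n] \<omega>(2) elim by simp
        also have "real n * \<rho> n \<le> real n * (\<kappa> / 2)" using elim by (intro mult_left_mono) auto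
        finally have "\<beta> (initial \<omega> n) \<le> \<kappa> * real n" by (simp add: algebra_simps)
        then show ?case using elim admissible_initial[OF \<omega>(1)] by (simp add: G_def slow_words_def)
      qed
      then obtain n where n: "initial \<omega> n \<in> G" unfolding eventually_sequentially by blast
      define w where "w = initial \<omega> n"
      have w: "w \<in> G" "length w = n" using n by (auto simp: w_def)
      have "x \<in> bowen_ball f \<Lambda> \<epsilon> (n - m) (h (code w))"
        unfolding bowen_ball_def
      proof (intro CollectI conjI allI impI x\<Lambda>)
        fix k assume k: "k < n - m"
        have "initial ((shift ^^ k) \<omega>) m = initial ((shift ^^ k) (code w)) m"
        proof (rule initial_cong)
          fix j assume "j < m"
          then have "k + j < n" using k by linarith
          then show "(shift ^^ k) \<omega> j = (shift ^^ k) (code w) j"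
            using code(2)[OF G_adm[OF w(1)]] w(2) unfolding funpow_shift
            by (metis nth_initial w_def)
        qed
        then have "dist (h ((shift ^^ k) \<omega>)) (h ((shift ^^ k) (code w))) < \<epsilon>"
          by (intro m SFT_shift \<omega>(1) code(1) G_adm w(1))
        then show "dist ((f ^^ k) x) ((f ^^ k) (h (code w))) < \<epsilon>"
          using iterate_h[OF \<omega>(1)] iterate_h[OF code(1)[OF G_adm[OF w(1)]]] \<omega>(2) by simp
      qed
      then show "x \<in> (\<Union>(x, n)\<in>\<psi> ` G. bowen_ball f \<Lambda> \<epsilon> n x)"
        using w by (auto simp: \<psi>_def intro!: bexI[of _ w])
    qed
    have family: "countable (\<psi> ` G)" "\<psi> ` G \<subseteq> \<Lambda> \<times> {N..}"
      using h_in code G_adm by (auto simp: \<psi>_def G_def)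
    have "(\<Sum>\<^sub>\<infinity>(x, n)\<in>\<psi> ` G. ennreal (exp (- s * real n))) \<le> ennreal (C' * q ^ N)"
    proof (rule infsum_le_finite_sums)
      show "(\<lambda>(x, n). ennreal (exp (- s * real n))) summable_on \<psi> ` G"
        by (rule nonneg_summable_on_complete) auto
      fix F assume F: "finite F" "F \<subseteq> \<psi> ` G"
      then obtain W where W: "W \<subseteq> G" "finite W" "F = \<psi> ` W" by (metis finite_subset_image)
      have "(\<Sum>(x, n)\<in>F. ennreal (exp (- s * real n)))
          \<le> (\<Sum>w\<in>W. (case \<psi> w of (x, n) \<Rightarrow> ennreal (exp (- s * real n))))"
        unfolding W(3) by (rule sum_image_le[unfolded comp_def]) (use W in auto)
      also have "\<dots> = ennreal (\<Sum>w\<in>W. exp (- s * real (length w - m)))"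
        unfolding \<psi>_def by (simp add: sum_ennreal)
      also have "(\<Sum>w\<in>W. exp (- s * real (length w - m))) \<le> (C * exp (s * real m)) * q ^ N / (1 - q)"
      proof (rule sum_by_length_le)
        fix n assume n: "N \<le> n"
        have "(\<Sum>w\<in>{w\<in>W. length w = n}. exp (- s * real (length w - m)))
            \<le> (\<Sum>w\<in>{w\<in>W. length w = n}. exp (s * real m) * exp (- s * real n))"
        proof (rule sum_mono)
          fix w assume w: "w \<in> {w\<in>W. length w = n}"
          then have "m \<le> n" using W(1) by (auto simp: G_def)
          then show "exp (- s * real (length w - m)) \<le> exp (s * real m) * exp (- s * real n)"
            using w by (simp add: algebra_simps of_nat_diff flip: exp_add)
        qed
        also have "\<dots> = real (card {w\<in>W. length w = n}) * (exp (s * real m) * exp (- s * real n))" by simp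
        also have "\<dots> \<le> (C * exp (\<kappa> * real n)) * (exp (s * real m) * exp (- s * real n))"
        proof (rule mult_right_mono)
          have "card {w\<in>W. length w = n} \<le> card (slow_words \<kappa> n)"
          proof (rule card_mono)
            show "finite (slow_words \<kappa> n)"
              by (rule finite_subset[OF _ finite_admissible[of n]]) (auto simp: slow_words_def)
          qed (use W in \<open>auto simp: G_def\<close>)
          then show "real (card {w\<in>W. length w = n}) \<le> C * exp (\<kappa> * real n)"
            using C(2)[of n] n N by linarith
        qed simp
        also have "\<dots> = C * exp (s * real m) * exp (real n * (- s / 2))"
          by (simp add: \<kappa>_def algebra_simps flip: exp_add)
        also have "\<dots> = C * exp (s * real m) * q ^ n" unfolding q_def by (simp only: exp_of_nat_mult)
        finally show "(\<Sum>w\<in>{w\<in>W. length w = n}. exp (- s * real (length w - m)))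
            \<le> C * exp (s * real m) * q ^ n" .
      qed (use W q C in \<open>auto simp: G_def\<close>)
      finally show "(\<Sum>(x, n)\<in>F. ennreal (exp (- s * real n))) \<le> ennreal (C' * q ^ N)"
        by (simp add: C'_def ennreal_leI)
    qed
    then show ?thesis unfolding bowen_M_def using cover family by (intro INF_lower2[of "\<psi> ` G"]) auto
  qed
  moreover have "C' \<ge> 0" using C q by (simp add: C'_def)
  ultimately show ?thesis unfolding q_def by blast
qed

lemma bowen_M_level_set_tendsto:
  assumes "0 < s" "0 < \<epsilon>"
  shows "bowen_M f \<Lambda> L0 s \<epsilon> \<longlonglongrightarrow> 0"
proof -
  obtain C where C: "C \<ge> 0" "\<And>N. N \<ge> 1 \<Longrightarrow> bowen_M f \<Lambda> L0 s \<epsilon> N \<le> ennreal (C * exp (- s / 2) ^ N)"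
    using bowen_M_level_set_le[OF assms] by blast
  have "(\<lambda>N. C * exp (- s / 2) ^ N) \<longlonglongrightarrow> C * 0"
    by (intro tendsto_intros LIMSEQ_realpow_zero) (use assms in auto)
  then have lim: "(\<lambda>N. ennreal (C * exp (- s / 2) ^ N)) \<longlonglongrightarrow> 0"
    using tendsto_ennrealI by fastforce
  show ?thesis
    by (rule tendsto_sandwich[OF _ _ tendsto_const lim])
      (use C(2) in \<open>auto intro: eventually_sequentiallyI[of 1]\<close>)
qed

lemma bowen_M_ge_one:
  assumes "x \<in> B" "s \<le> 0"
  shows "1 \<le> bowen_M f \<Lambda> B s \<epsilon> N"
  unfolding bowen_M_def
proof (rule INF_greatest)
  fix C assume "C \<in> {C. countable C \<and> C \<subseteq> \<Lambda> \<times> {N..} \<and> B \<subseteq> (\<Union>(x, n)\<in>C. bowen_ball f \<Lambda> \<epsilon> n x)}"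
  then obtain y n where yn: "(y, n) \<in> C" using assms(1) by blast
  have "1 \<le> ennreal (exp (- s * real n))"
    using assms(2) by (simp flip: ennreal_1 add: mult_nonpos_nonneg ennreal_leI)
  also have "\<dots> = (\<Sum>\<^sub>\<infinity>(x, n)\<in>{(y, n)}. ennreal (exp (- s * real n)))" by simp
  also have "\<dots> \<le> (\<Sum>\<^sub>\<infinity>(x, n)\<in>C. ennreal (exp (- s * real n)))"
    by (rule infsum_mono_neutral) (use yn in \<open>auto intro: nonneg_summable_on_complete\<close>)
  finally show "1 \<le> (\<Sum>\<^sub>\<infinity>(x, n)\<in>C. ennreal (exp (- s * real n)))" .
qed

lemma entropy_level_set:
  assumes "L0 \<noteq> {}"
  shows "bowen_entropy f \<Lambda> L0 = 0"
proof -
  obtain x where x: "x \<in> L0" using assms by blast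
  have "(INF s\<in>{s::real. bowen_M f \<Lambda> L0 s \<epsilon> \<longlonglongrightarrow> 0}. ereal s) = 0" if "\<epsilon> > 0" for \<epsilon>
  proof (rule antisym)
    show "(INF s\<in>{s::real. bowen_M f \<Lambda> L0 s \<epsilon> \<longlonglongrightarrow> 0}. ereal s) \<le> 0"
    proof (rule ereal_le_epsilon2)
      fix e :: real assume "0 < e"
      then show "(INF s\<in>{s::real. bowen_M f \<Lambda> L0 s \<epsilon> \<longlonglongrightarrow> 0}. ereal s) \<le> 0 + ereal e"
        using bowen_M_level_set_tendsto[OF _ that] by (auto intro: INF_lower)
    qed
    show "0 \<le> (INF s\<in>{s::real. bowen_M f \<Lambda> L0 s \<epsilon> \<longlonglongrightarrow> 0}. ereal s)"
    proof (rule INF_greatest)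
      fix s assume "s \<in> {s::real. bowen_M f \<Lambda> L0 s \<epsilon> \<longlonglongrightarrow> 0}"
      then have lim: "bowen_M f \<Lambda> L0 s \<epsilon> \<longlonglongrightarrow> 0" by simp
      have "\<not> s \<le> 0"
      proof
        assume "s \<le> 0"
        have "1 \<le> (0::ennreal)"
          by (rule LIMSEQ_le_const[OF lim]) (use bowen_M_ge_one[OF x \<open>s \<le> 0\<close>] in auto)
        then show False by simp
      qed
      then show "0 \<le> ereal s" by simp
    qed
  qed
  then have "((\<lambda>\<epsilon>. INF s\<in>{s::real. bowen_M f \<Lambda> L0 s \<epsilon> \<longlonglongrightarrow> 0}. ereal s) \<longlongrightarrow> 0) (at_right 0)"
    by (intro tendsto_eventually eventually_at_right_less[THEN eventually_mono]) simp
  then show ?thesis unfolding bowen_entropy_def by (intro tendsto_Lim) simp_all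
qed

section \<open>Connecting words\<close>

text \<open>By mixing, any two symbols are joined by paths of all large lengths. As there are finitely many
  symbols, one length serves for all pairs.\<close>

lemma exists_bridge_length:
  "\<exists>M\<ge>1. \<forall>\<omega>\<in>X. \<forall>\<omega>'\<in>X. \<exists>\<upsilon>\<in>X. \<upsilon> 0 = \<omega> 0 \<and> \<upsilon> M = \<omega>' 0"
proof -
  let ?S = "(\<lambda>\<omega>. \<omega> 0) ` X"
  have fin: "finite ?S" by (rule finite_subset[of _ "{1..p}"]) (use X_letter in auto)
  have opn: "openin (top_of_set X) {\<omega>\<in>X. \<omega> 0 = s}" for s
  proof -
    have "open ((\<lambda>\<omega> :: nat \<Rightarrow> nat. \<omega> 0) -` {s})"
      by (rule open_vimage[OF open_discrete continuous_on_product_coordinates])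
    then have "openin (top_of_set X) (X \<inter> (\<lambda>\<omega> :: nat \<Rightarrow> nat. \<omega> 0) -` {s})" by (rule openin_open_Int)
    moreover have "X \<inter> (\<lambda>\<omega> :: nat \<Rightarrow> nat. \<omega> 0) -` {s} = {\<omega>\<in>X. \<omega> 0 = s}" by auto
    ultimately show ?thesis by simp
  qed
  have ex: "\<exists>N. \<forall>n\<ge>N. \<exists>\<upsilon>\<in>X. \<upsilon> 0 = fst ss \<and> \<upsilon> n = snd ss" if ss: "ss \<in> ?S \<times> ?S" for ss
  proof -
    have "{\<omega>\<in>X. \<omega> 0 = fst ss} \<noteq> {}" "{\<omega>\<in>X. \<omega> 0 = snd ss} \<noteq> {}" using ss by auto
    then obtain N where N: "\<And>n. n \<ge> N \<Longrightarrow>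
        (shift ^^ n) ` {\<omega>\<in>X. \<omega> 0 = fst ss} \<inter> {\<omega>\<in>X. \<omega> 0 = snd ss} \<noteq> {}"
      using mixing opn unfolding topologically_mixing_on_def by meson
    have "\<exists>\<upsilon>\<in>X. \<upsilon> 0 = fst ss \<and> \<upsilon> n = snd ss" if n: "n \<ge> N" for n
    proof -
      obtain \<upsilon> where "\<upsilon> \<in> X" "\<upsilon> 0 = fst ss" "(shift ^^ n) \<upsilon> 0 = snd ss" using N[OF n] by auto
      then show ?thesis unfolding funpow_shift by auto
    qed
    then show ?thesis by blast
  qed
  have "\<exists>N. \<forall>ss\<in>?S \<times> ?S. \<forall>n\<ge>N ss. \<exists>\<upsilon>\<in>X. \<upsilon> 0 = fst ss \<and> \<upsilon> n = snd ss"
    by (intro bchoice ballI ex)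
  then obtain N where N: "\<forall>ss\<in>?S \<times> ?S. \<forall>n\<ge>N ss. \<exists>\<upsilon>\<in>X. \<upsilon> 0 = fst ss \<and> \<upsilon> n = snd ss" ..
  define M where "M = Max (insert 1 (N ` (?S \<times> ?S)))"
  have "M \<ge> 1" unfolding M_def using fin by (intro Max_ge) auto
  moreover have "\<exists>\<upsilon>\<in>X. \<upsilon> 0 = \<omega> 0 \<and> \<upsilon> M = \<omega>' 0" if "\<omega> \<in> X" "\<omega>' \<in> X" for \<omega> \<omega>'
  proof -
    have ss: "(\<omega> 0, \<omega>' 0) \<in> ?S \<times> ?S" using that by auto
    have "N (\<omega> 0, \<omega>' 0) \<le> M" unfolding M_def using fin ss by (intro Max_ge) auto
    then show ?thesis using bspec[OF N ss] by auto
  qed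
  ultimately show ?thesis by blast
qed

definition bridge_length :: nat where
  "bridge_length = (SOME M. M \<ge> 1 \<and> (\<forall>\<omega>\<in>X. \<forall>\<omega>'\<in>X. \<exists>\<upsilon>\<in>X. \<upsilon> 0 = \<omega> 0 \<and> \<upsilon> M = \<omega>' 0))"

lemma bridge_length_ge_1: "bridge_length \<ge> 1"
  by (rule conjunct1[OF someI_ex[OF exists_bridge_length, folded bridge_length_def]])

lemma bridge_length_connects:
  assumes "\<omega> \<in> X" "\<omega>' \<in> X"
  shows "\<exists>\<upsilon>\<in>X. \<upsilon> 0 = \<omega> 0 \<and> \<upsilon> bridge_length = \<omega>' 0"
  by (rule conjunct2[OF someI_ex[OF exists_bridge_length, folded bridge_length_def], THEN bspec, OF assms(1),
        THEN bspec, OF assms(2)])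

definition bridge :: "nat \<Rightarrow> nat \<Rightarrow> nat list" where
  "bridge s s' = initial (SOME \<upsilon>. \<upsilon> \<in> X \<and> \<upsilon> 0 = s \<and> \<upsilon> bridge_length = s') bridge_length"

text \<open>The symbol at which all words to be concatenated start.\<close>

definition base_symbol :: nat where "base_symbol = (SOME s. \<exists>\<omega>\<in>X. s = \<omega> 0)"

lemma base_symbol: "\<exists>\<omega>\<in>X. base_symbol = \<omega> 0"
  unfolding base_symbol_def by (rule someI_ex) (use X_nonempty in blast)

lemma length_bridge [simp]: "length (bridge s s') = bridge_length"
  by (simp add: bridge_def)

lemma bridge_path:
  assumes "\<omega> \<in> X" "\<omega>' \<in> X"
  obtains \<upsilon> where "\<upsilon> \<in> X" "\<upsilon> 0 = \<omega> 0" "\<upsilon> bridge_length = \<omega>' 0" "bridge (\<omega> 0) (\<omega>' 0) = initial \<upsilon> bridge_length"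
proof -
  define \<upsilon> where "\<upsilon> = (SOME \<upsilon>. \<upsilon> \<in> X \<and> \<upsilon> 0 = \<omega> 0 \<and> \<upsilon> bridge_length = \<omega>' 0)"
  have "\<exists>\<upsilon>. \<upsilon> \<in> X \<and> \<upsilon> 0 = \<omega> 0 \<and> \<upsilon> bridge_length = \<omega>' 0" using bridge_length_connects[OF assms] by blast
  from someI_ex[OF this, folded \<upsilon>_def] have "\<upsilon> \<in> X" "\<upsilon> 0 = \<omega> 0" "\<upsilon> bridge_length = \<omega>' 0" by blast+
  then show thesis by (rule that) (simp only: bridge_def \<upsilon>_def)
qed

text \<open>A path from \<open>base_symbol\<close> through \<open>w\<close> to a symbol that may be followed by \<open>base_symbol\<close>. The
  first letter of the closing bridge is the last letter of \<open>w\<close> and is dropped. As all bridges have the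
  same length, \<open>w\<close> can be recovered from \<open>wrap w\<close> if its length is known.\<close>

definition wrap :: "nat list \<Rightarrow> nat list" where
  "wrap w = bridge base_symbol (hd w) @ w @ tl (bridge (last w) base_symbol)"

text \<open>Closed paths at \<open>base_symbol\<close>, written without their final symbol. In contrast to admissible
  words they can be concatenated freely.\<close>

definition loop :: "nat list \<Rightarrow> bool" where
  "loop w \<longleftrightarrow> letters w \<and> successively A (w @ [base_symbol]) \<and> hd (w @ [base_symbol]) = base_symbol"

lemma successively_initial:
  assumes "\<omega> \<in> X"
  shows "successively A (initial \<omega> n)"
  using assms unfolding successively_conv_nth by (auto simp: SFT_def)

lemma loop_Nil: "loop []"
  by (simp add: loop_def)

lemma loop_append:
  assumes "loop u" "loop v"
  shows "loop (u @ v)"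
proof -
  obtain v' where v': "v @ [base_symbol] = base_symbol # v'" using assms(2) unfolding loop_def
    by (metis append_is_Nil_conv list.collapse not_Cons_self2)
  have "successively A (u @ (v @ [base_symbol]))"
    unfolding v' by (rule successively_glue) (use assms v' in \<open>auto simp: loop_def\<close>)
  moreover have "hd (u @ v @ [base_symbol]) = base_symbol" using assms by (cases u) (auto simp: loop_def)
  ultimately show ?thesis using assms by (simp add: loop_def)
qed

text \<open>The three parts of \<open>wrap w\<close> overlap in the first and in the last letter of \<open>w\<close>, where the paths
  are glued.\<close>

lemma loop_wrap:
  assumes "admissible w" "w \<noteq> []"
  shows "loop (wrap w)"
proof -
  obtain \<omega> where \<omega>: "\<omega> \<in> X" "w = initial \<omega> (length w)"
    using assms(1) unfolding admissible_def by blast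
  define n where "n = length w"
  have n: "n \<ge> 1" using assms(2) by (cases w) (auto simp: n_def)
  have w: "w = initial \<omega> n" using \<omega> by (simp add: n_def)
  have first: "hd w = \<omega> 0" using n unfolding w initial_def by (simp add: hd_map)
  have final: "last w = ((shift ^^ (n - 1)) \<omega>) 0"
    using n unfolding w initial_def funpow_shift by (simp add: last_map)
  obtain \<sigma> where \<sigma>: "\<sigma> \<in> X" "base_symbol = \<sigma> 0" using base_symbol by blast
  obtain a where a: "a \<in> X" "a 0 = base_symbol" "a bridge_length = \<omega> 0" "bridge base_symbol (hd w) = initial a bridge_length"
    using bridge_path[OF \<sigma>(1) \<omega>(1)] \<sigma>(2) first by metis
  obtain b where b: "b \<in> X" "b 0 = last w" "b bridge_length = base_symbol" "bridge (last w) base_symbol = initial b bridge_length"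
    using bridge_path[OF SFT_shift[OF \<omega>(1)] \<sigma>(1)] \<sigma>(2) final by metis
  have w_split: "w = butlast w @ [last w]" "w = hd w # tl w" using assms(2) by auto
  have b_split: "bridge (last w) base_symbol = last w # tl (bridge (last w) base_symbol)"
  proof -
    have "hd (initial b bridge_length) = b 0" using bridge_length_ge_1 unfolding initial_def by (simp add: hd_map)
    moreover have "initial b bridge_length \<noteq> []" using bridge_length_ge_1 by (simp flip: length_greater_0_conv)
    ultimately show ?thesis using b(2,4) by (metis list.collapse)
  qed
  have "successively A (bridge (last w) base_symbol @ [base_symbol])"
    using successively_initial[OF b(1), of "Suc bridge_length"] b(3,4) by (simp add: initial_Suc)
  then have tail: "successively A (last w # (tl (bridge (last w) base_symbol) @ [base_symbol]))"
    by (subst (asm) b_split) simp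
  have "successively A (butlast w @ last w # (tl (bridge (last w) base_symbol) @ [base_symbol]))"
    by (rule successively_glue[OF _ tail])
      (use successively_initial[OF \<omega>(1), of n] w_split(1) w in simp)
  then have "successively A (w @ tl (bridge (last w) base_symbol) @ [base_symbol])"
    by (subst w_split(1)) simp
  then have rest: "successively A (hd w # (tl w @ tl (bridge (last w) base_symbol) @ [base_symbol]))"
    by (subst (asm) w_split(2)) simp
  have "successively A (bridge base_symbol (hd w) @ [hd w])"
    using successively_initial[OF a(1), of "Suc bridge_length"] a(3,4) first by (simp add: initial_Suc)
  from successively_glue[OF this rest]
  have "successively A (bridge base_symbol (hd w) @ w @ tl (bridge (last w) base_symbol) @ [base_symbol])"
    by (subst (2) w_split(2)) simp
  moreover have "hd (wrap w @ [base_symbol]) = base_symbol"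
  proof -
    have "hd (bridge base_symbol (hd w)) = base_symbol" "bridge base_symbol (hd w) \<noteq> []"
      using bridge_length_ge_1 a(2,4) by (auto simp: initial_def hd_map simp flip: length_greater_0_conv)
    then show ?thesis by (simp add: wrap_def)
  qed
  moreover have "letters (wrap w)"
  proof -
    have "letters (bridge base_symbol (hd w))" "letters (bridge (last w) base_symbol)"
      unfolding a(4) b(4) by (rule letters_initial[OF a(1)], rule letters_initial[OF b(1)])
    moreover have "set (tl (bridge (last w) base_symbol)) \<subseteq> set (bridge (last w) base_symbol)"
      by (cases "bridge (last w) base_symbol") auto
    ultimately show ?thesis
      unfolding wrap_def set_append using admissible_letters[OF assms(1)] by blast
  qed
  ultimately show ?thesis by (simp add: loop_def wrap_def)
qed

lemma length_wrap: "length (wrap w) = 2 * bridge_length + length w - 1"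
  using bridge_length_ge_1 by (simp add: wrap_def)

lemma wrap_inj:
  assumes "wrap u = wrap v" "length u = length v"
  shows "u = v"
proof -
  have "take (length w) (drop bridge_length (wrap w)) = w" for w by (simp add: wrap_def)
  then show ?thesis using assms by metis
qed

section \<open>Infinite concatenations of loops\<close>

lemma loop_pre:
  assumes "\<And>i. loop (v i)"
  shows "loop (pre v k)"
  by (induction k) (simp_all add: pre_Suc loop_Nil loop_append assms)

lemma flatten_in_X:
  assumes "\<And>i. v i \<noteq> []" "\<And>i. loop (v i)"
  shows "flatten v \<in> X"
  unfolding SFT_def
proof (intro CollectI allI conjI)
  fix n
  let ?c = "pre v (Suc (Suc n))"
  have len: "Suc n < length ?c" using length_pre_ge[of v "Suc (Suc n)", OF assms(1)] by linarith
  have eq: "flatten v n = ?c ! n" "flatten v (Suc n) = ?c ! Suc n"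
    using flatten_nth[of v _ "Suc (Suc n)", OF assms(1)] len by auto
  have loop: "letters ?c" "successively A (?c @ [base_symbol])"
    using loop_pre[of v "Suc (Suc n)", OF assms(2)] by (auto simp: loop_def)
  show "flatten v n \<in> {1..p}" unfolding eq(1)
    by (rule subsetD[OF loop(1) nth_mem]) (use len in linarith)
  have "successively A ?c" using loop(2) by (simp add: successively_append_iff)
  then show "A (flatten v n) (flatten v (Suc n))"
    using len eq unfolding successively_conv_nth by simp
qed

lemma loop_admissible:
  assumes "loop w"
  shows "admissible w"
proof (cases "w = []")
  case True
  obtain \<omega> where "\<omega> \<in> X" using X_nonempty by blast
  then show ?thesis using True admissible_initial[of \<omega> 0] by simp
next
  case False
  have "flatten (\<lambda>_. w) \<in> X" using flatten_in_X[of "\<lambda>_. w"] False assms by simp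
  moreover have "initial (flatten (\<lambda>_. w)) (length w) = w"
    using initial_flatten[of "\<lambda>_. w" "length w" 1] False by (simp add: pre_def)
  ultimately show ?thesis using admissible_initial by metis
qed

lemma admissible_wrap: "admissible w \<Longrightarrow> w \<noteq> [] \<Longrightarrow> admissible (wrap w)"
  by (rule loop_admissible[OF loop_wrap])

lemma admissible_wrap_parts:
  assumes "admissible w" "w \<noteq> []"
  shows "admissible (bridge base_symbol (hd w))" "admissible (tl (bridge (last w) base_symbol))"
    "admissible (w @ tl (bridge (last w) base_symbol))"
  using admissible_wrap[OF assms] unfolding wrap_def by (blast dest: admissible_append)+

lemma \<beta>_wrap:
  assumes "admissible w" "w \<noteq> []"
  shows "\<beta> (wrap w) \<le> \<beta> w + 2 * growth * real bridge_length"
proof -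
  note parts = admissible_wrap_parts[OF assms]
  have "\<beta> (wrap w) \<le> \<beta> (bridge base_symbol (hd w)) + \<beta> (w @ tl (bridge (last w) base_symbol))"
    using \<beta>_append admissible_wrap[OF assms] unfolding wrap_def by blast
  also have "\<beta> (w @ tl (bridge (last w) base_symbol)) \<le> \<beta> w + \<beta> (tl (bridge (last w) base_symbol))"
    by (rule \<beta>_append[OF parts(3)])
  also have "\<beta> (bridge base_symbol (hd w)) \<le> growth * real bridge_length" using \<beta>_le_length[OF parts(1)] by simp
  also have "\<beta> (tl (bridge (last w) base_symbol)) \<le> growth * real bridge_length"
  proof -
    have "\<beta> (tl (bridge (last w) base_symbol)) \<le> growth * real (bridge_length - 1)" using \<beta>_le_length[OF parts(2)] by simp
    also have "\<dots> \<le> growth * real bridge_length" by (rule mult_left_mono) (use growth_nonneg in auto)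
    finally show ?thesis .
  qed
  finally show ?thesis by (simp add: mult_ac)
qed

section \<open>Slow growth along concatenations\<close>

text \<open>Growth at rate \<open>\<epsilon>\<close> at all intermediate times, up to a constant. Requiring this for all prefixes
  makes the notion stable under concatenation, at the cost of adding the constants.\<close>

definition slow :: "real \<Rightarrow> real \<Rightarrow> nat list \<Rightarrow> bool" where
  "slow \<epsilon> C v \<longleftrightarrow> (\<forall>k\<le>length v. \<beta> (take k v) \<le> C + \<epsilon> * real k)"

lemma slow_append:
  assumes "admissible (u @ v)" "slow \<epsilon> C u" "slow \<epsilon> D v" "0 \<le> D"
  shows "slow \<epsilon> (C + D) (u @ v)"
  unfolding slow_def
proof (intro allI impI)
  fix k assume k: "k \<le> length (u @ v)"
  show "\<beta> (take k (u @ v)) \<le> C + D + \<epsilon> * real k"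
  proof (cases "k \<le> length u")
    case True
    then have "\<beta> (take k u) \<le> C + \<epsilon> * real k" using assms(2) by (simp add: slow_def)
    then show ?thesis using True assms(4) by simp
  next
    case False
    define j where "j = k - length u"
    have kj: "k = length u + j" "j \<le> length v" using False k by (auto simp: j_def)
    have "admissible (u @ take j v)"
      using admissible_append(1)[of "u @ take j v" "drop j v"] assms(1) by simp
    then have "\<beta> (take k (u @ v)) \<le> \<beta> u + \<beta> (take j v)" using \<beta>_append kj by simp
    also have "\<beta> u \<le> C + \<epsilon> * real (length u)"
      using assms(2) unfolding slow_def by (metis order_refl take_all_iff)
    also have "\<beta> (take j v) \<le> D + \<epsilon> * real j" using assms(3) kj by (simp add: slow_def)
    finally show ?thesis using kj by (simp add: algebra_simps)
  qed
qed

lemma slow_short: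
  assumes "admissible v" "length v \<le> m" "0 \<le> \<epsilon>"
  shows "slow \<epsilon> (growth * real m) v"
  unfolding slow_def
proof (intro allI impI)
  fix k assume k: "k \<le> length v"
  have "admissible (take k v)" using admissible_append(1)[of "take k v" "drop k v"] assms by simp
  then have "\<beta> (take k v) \<le> growth * real k" using \<beta>_le_length k by (metis length_take min_absorb2)
  also have "\<dots> \<le> growth * real m" using k assms growth_nonneg by (intro mult_left_mono) auto
  also have "\<dots> \<le> growth * real m + \<epsilon> * real k" using assms by simp
  finally show "\<beta> (take k v) \<le> growth * real m + \<epsilon> * real k" .
qed

lemma slow_mono: "slow \<epsilon> C v \<Longrightarrow> C \<le> D \<Longrightarrow> slow \<epsilon> D v"
  unfolding slow_def by force

lemma slow_wrap:
  assumes "admissible w" "w \<noteq> []" "slow \<epsilon> C w" "0 \<le> C" "0 \<le> \<epsilon>"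
  shows "slow \<epsilon> (2 * growth * real bridge_length + C) (wrap w)"
proof -
  note parts = admissible_wrap_parts[OF assms(1,2)]
  have "slow \<epsilon> (growth * real bridge_length) (tl (bridge (last w) base_symbol))" by (rule slow_short) (use parts assms in auto)
  then have "slow \<epsilon> (C + growth * real bridge_length) (w @ tl (bridge (last w) base_symbol))"
    using growth_nonneg assms parts by (intro slow_append) auto
  moreover have "slow \<epsilon> (growth * real bridge_length) (bridge base_symbol (hd w))" by (rule slow_short) (use parts assms in auto)
  ultimately have "slow \<epsilon> (growth * real bridge_length + (C + growth * real bridge_length)) (wrap w)"
    unfolding wrap_def using growth_nonneg assms(4) admissible_wrap[OF assms(1,2), unfolded wrap_def]
    by (intro slow_append[of "bridge base_symbol (hd w)"]) simp_all
  then show ?thesis by (rule slow_mono) simp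
qed

lemma slow_pre:
  assumes "\<And>i. loop (v i)" "\<And>i. slow \<epsilon> C (v i)" "0 \<le> C"
  shows "slow \<epsilon> (C * real k) (pre v k)"
proof (induction k)
  case (Suc k)
  have "admissible (pre v k @ v k)"
    using loop_admissible[OF loop_pre[of v "Suc k", OF assms(1)]] by (simp add: pre_Suc)
  from slow_append[OF this Suc assms(2,3)] show ?case by (simp add: pre_Suc algebra_simps)
qed (simp add: slow_def)

text \<open>The initial words of the code of a point of the level set are slow at every rate with a constant
  that does not depend on their length.\<close>

lemma slow_generic:
  assumes "\<xi> \<in> X" "h \<xi> \<in> L0" "0 < \<epsilon>"
  shows "\<exists>C\<ge>0. \<forall>L. slow \<epsilon> C (initial \<xi> L)"
proof -
  have "\<forall>\<^sub>F n in sequentially. ln \<bar>Df n (h \<xi>)\<bar> \<le> \<epsilon> / 2 * real n"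
    using assms(2) L0_iff[OF h_in[OF assms(1)]] assms(3) by (metis half_gt_zero)
  moreover have "\<forall>\<^sub>F n in sequentially. 1 * \<rho> n \<le> \<epsilon> / 2" by (rule eventually_distortion_le) (use assms in simp)
  ultimately have "\<forall>\<^sub>F n in sequentially. \<beta> (initial \<xi> n) \<le> \<epsilon> * real n"
  proof eventually_elim
    case (elim n)
    have "real n * \<rho> n \<le> real n * (\<epsilon> / 2)" using elim by (intro mult_left_mono) auto
    then show ?case using \<beta>_initial(2)[OF assms(1), of n] elim by (simp add: algebra_simps)
  qed
  then obtain n0 where n0: "\<And>n. n \<ge> n0 \<Longrightarrow> \<beta> (initial \<xi> n) \<le> \<epsilon> * real n"
    unfolding eventually_sequentially by blast
  have "\<beta> (initial \<xi> n) \<le> growth * real n0 + \<epsilon> * real n" for n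
  proof (cases "n \<ge> n0")
    case True
    then show ?thesis using n0[OF True] growth_nonneg by (simp add: add_increasing)
  next
    case False
    have "\<beta> (initial \<xi> n) \<le> growth * real n" using \<beta>_le_length[OF admissible_initial[OF assms(1), of n]] by simp
    also have "\<dots> \<le> growth * real n0" using False growth_nonneg by (intro mult_left_mono) auto
    finally show ?thesis using assms(3) by (simp add: add_increasing2)
  qed
  moreover have "take k (initial \<xi> L) = initial \<xi> k" if "k \<le> L" for k L
    using that by (auto simp: initial_def take_map)
  ultimately have "slow \<epsilon> (growth * real n0) (initial \<xi> L)" for L unfolding slow_def by simp
  then show ?thesis using growth_nonneg by (intro exI[of _ "growth * real n0"]) auto
qed

end

section \<open>A Cantor set of orbits with exponent zero\<close>

text \<open>The data of the lower bound at exponent \<open>t\<close>. An orbit is described by a sequence of freely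
  chosen words of length \<open>N\<close>; after the \<open>i\<close>-th of them the first \<open>Ls i\<close> letters of \<open>\<xi>\<close>, the code of a
  point of the level set, are inserted. The numbers \<open>b w\<close> and \<open>loss i\<close> bound the shrinking caused by the
  two kinds of blocks, \<open>exp \<eta> > 1\<close> is the branching gain per step, and \<open>budget\<close> says that the gain pays
  for all inserted blocks. The assumption \<open>sparse\<close> says that the chosen words take up a vanishing
  proportion of the time. That \<open>b\<close> is at least 1 makes the guaranteed lengths of cylinders tend to 0.\<close>

locale branching_scheme = coded_interval_map +
  fixes t \<eta> :: real and N :: nat and \<xi> :: "nat \<Rightarrow> nat"
    and b :: "nat list \<Rightarrow> real" and loss :: "nat \<Rightarrow> real" and Ls :: "nat \<Rightarrow> nat"
  assumes t_pos: "0 < t" and \<eta>_pos: "0 < \<eta>" and N_pos: "1 \<le> N"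
    and \<xi>: "\<xi> \<in> X" "h \<xi> \<in> L0"
    and \<beta>_wrap_le_b: "\<And>w. admissible w \<Longrightarrow> length w = N \<Longrightarrow> \<beta> (wrap w) \<le> b w"
    and b_ge_1: "\<And>w. admissible w \<Longrightarrow> length w = N \<Longrightarrow> 1 \<le> b w"
    and sum_b: "(\<Sum>w\<in>{w. admissible w \<and> length w = N}. exp (- t * b w)) = exp \<eta>"
    and loss_nonneg: "\<And>i. 0 \<le> loss i"
    and \<beta>_fill_le_loss: "\<And>i. Ls i \<noteq> 0 \<Longrightarrow> \<beta> (wrap (initial \<xi> (Ls i))) \<le> loss i"
    and budget: "\<And>k. t * (\<Sum>i\<le>k. loss i) \<le> \<eta> * real (Suc k)"
    and sparse: "filterlim (\<lambda>k. real (\<Sum>i<k. Ls i) / real (Suc k)) at_top sequentially"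
begin

definition W :: "nat list set" where "W = {w. admissible w \<and> length w = N}"

text \<open>Most indices carry no insertion; then the block has to be empty, since even a bridge would
  cost a fixed amount at every step.\<close>

definition fill :: "nat \<Rightarrow> nat list" where
  "fill i = (if Ls i = 0 then [] else wrap (initial \<xi> (Ls i)))"

definition blk :: "(nat \<Rightarrow> nat list) \<Rightarrow> nat \<Rightarrow> nat list" where
  "blk \<omega> i = wrap (\<omega> i) @ fill i"

definition paths :: "(nat \<Rightarrow> nat list) set" where
  "paths = {\<omega>. \<forall>i. \<omega> i \<in> W}"

definition point :: "(nat \<Rightarrow> nat list) \<Rightarrow> real" where
  "point \<omega> = h (flatten (blk \<omega>))"

definition cost :: "(nat \<Rightarrow> nat list) \<Rightarrow> nat \<Rightarrow> real" where
  "cost \<omega> k = (\<Sum>i<k. b (\<omega> i) + loss i)"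

lemma finite_W: "finite W"
  unfolding W_def by (rule finite_admissible)

lemma W_word: "w \<in> W \<Longrightarrow> admissible w" "w \<in> W \<Longrightarrow> w \<noteq> []" "w \<in> W \<Longrightarrow> length w = N"
  using N_pos by (auto simp: W_def)

lemma initial_\<xi>_nonempty: "L \<noteq> 0 \<Longrightarrow> initial \<xi> L \<noteq> []"
  by (simp flip: length_greater_0_conv)

lemma loop_fill: "loop (fill i)"
  using loop_wrap[OF admissible_initial[OF \<xi>(1)] initial_\<xi>_nonempty, of "Ls i"] loop_Nil
  by (simp add: fill_def)

lemma loop_blk:
  assumes "\<omega> \<in> paths"
  shows "loop (blk \<omega> i)"
  unfolding blk_def using assms W_word
  by (intro loop_append loop_fill loop_wrap) (auto simp: paths_def)

lemma blk_nonempty: "blk \<omega> i \<noteq> []"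
proof -
  have "bridge base_symbol (hd (\<omega> i)) \<noteq> []" using bridge_length_ge_1 by (simp flip: length_greater_0_conv)
  then show ?thesis by (simp add: blk_def wrap_def)
qed

lemma code_point: "\<omega> \<in> paths \<Longrightarrow> flatten (blk \<omega>) \<in> X"
  by (rule flatten_in_X[OF blk_nonempty loop_blk])

lemma initial_point: "initial (flatten (blk \<omega>)) (length (pre (blk \<omega>) k)) = pre (blk \<omega>) k"
  using initial_flatten[of "blk \<omega>" _ k, OF blk_nonempty order_refl] by simp

lemma admissible_pre: "\<omega> \<in> paths \<Longrightarrow> admissible (pre (blk \<omega>) k)"
  by (rule loop_admissible[OF loop_pre[OF loop_blk]])

lemma \<beta>_pre_le_cost:
  assumes "\<omega> \<in> paths"
  shows "\<beta> (pre (blk \<omega>) k) \<le> cost \<omega> k"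
proof (induction k)
  case (Suc k)
  have w: "\<omega> k \<in> W" using assms by (simp add: paths_def)
  have adm: "admissible (pre (blk \<omega>) k @ blk \<omega> k)"
    using admissible_pre[OF assms, of "Suc k"] by (simp add: pre_Suc)
  have "\<beta> (pre (blk \<omega>) (Suc k)) \<le> \<beta> (pre (blk \<omega>) k) + \<beta> (blk \<omega> k)"
    unfolding pre_Suc by (rule \<beta>_append[OF adm])
  also have "\<beta> (blk \<omega> k) \<le> \<beta> (wrap (\<omega> k)) + \<beta> (fill k)"
    unfolding blk_def by (rule \<beta>_append) (use admissible_append(2)[OF adm] in \<open>simp add: blk_def\<close>)
  also have "\<beta> (wrap (\<omega> k)) \<le> b (\<omega> k)" using w by (intro \<beta>_wrap_le_b W_word)
  also have "\<beta> (fill k) \<le> loss k"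
    using \<beta>_fill_le_loss[of k] loss_nonneg[of k] by (simp add: fill_def)
  finally show ?case using Suc by (simp add: cost_def)
qed (simp add: cost_def)

lemma cost_ge:
  assumes "\<omega> \<in> paths"
  shows "real k \<le> cost \<omega> k"
proof -
  have "1 \<le> b (\<omega> i) + loss i" for i
    using assms b_ge_1[OF W_word(1,3)] loss_nonneg[of i] by (simp add: paths_def add_increasing2)
  then have "(\<Sum>i<k. 1) \<le> cost \<omega> k" unfolding cost_def by (intro sum_mono)
  then show ?thesis by simp
qed

lemma length_pre_ge_sum: "(\<Sum>i<k. Ls i) \<le> length (pre (blk \<omega>) k)"
proof (induction k)
  case (Suc k)
  have "Ls k \<le> length (blk \<omega> k)" using bridge_length_ge_1 by (auto simp: blk_def fill_def length_wrap)
  then show ?case using Suc by (simp add: pre_Suc)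
qed simp

text \<open>A chosen word has bounded length, and an inserted block is slow by \<open>slow_generic\<close>. The constant is
  the same for all blocks.\<close>

lemma slow_blk:
  assumes "0 < \<epsilon>"
  shows "\<exists>D\<ge>0. \<forall>\<omega>\<in>paths. \<forall>i. slow \<epsilon> D (blk \<omega> i)"
proof -
  obtain C where C: "0 \<le> C" "\<And>L. slow \<epsilon> C (initial \<xi> L)" using slow_generic[OF \<xi> assms] by blast
  define D where "D = growth * real (2 * bridge_length + N) + (2 * growth * real bridge_length + C)"
  have nonneg: "0 \<le> 2 * growth * real bridge_length + C" using growth_nonneg C by simp
  have "slow \<epsilon> D (blk \<omega> i)" if "\<omega> \<in> paths" for \<omega> i
  proof -
    have w: "\<omega> i \<in> W" using that by (simp add: paths_def)
    have "slow \<epsilon> (growth * real (2 * bridge_length + N)) (wrap (\<omega> i))"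
      by (rule slow_short) (use admissible_wrap W_word[OF w] assms in \<open>auto simp: length_wrap\<close>)
    moreover have "slow \<epsilon> (2 * growth * real bridge_length + C) (fill i)"
    proof (cases "Ls i = 0")
      case True
      then show ?thesis using nonneg by (simp add: fill_def slow_def)
    next
      case False
      then show ?thesis unfolding fill_def
        using slow_wrap[OF admissible_initial[OF \<xi>(1)] initial_\<xi>_nonempty C(2) C(1)] assms by simp
    qed
    ultimately show ?thesis
      unfolding D_def blk_def using loop_admissible[OF loop_blk[OF that, of i]] nonneg
      by (intro slow_append[of "wrap (\<omega> i)"]) (simp_all add: blk_def)
  qed
  moreover have "0 \<le> D" unfolding D_def using growth_nonneg nonneg by simp
  ultimately show ?thesis by blast
qed

text \<open>Up to time \<open>n\<close> the growth is at most \<open>D k + \<epsilon> n / 2\<close>, where \<open>k\<close> is the number of blocks that have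
  been started. By sparseness \<open>k\<close> is small compared to \<open>n\<close>. The least \<open>k\<close> is taken in order to bound
  \<open>n\<close> from below by the length of the first \<open>k - 1\<close> blocks.\<close>

lemma point_in_L0:
  assumes "\<omega> \<in> paths"
  shows "point \<omega> \<in> L0"
proof -
  let ?\<sigma> = "flatten (blk \<omega>)"
  note \<sigma> = code_point[OF assms]
  have p\<Lambda>: "point \<omega> \<in> \<Lambda>" unfolding point_def by (rule h_in[OF \<sigma>])
  have "\<forall>\<^sub>F n in sequentially. ln \<bar>Df n (point \<omega>)\<bar> \<le> \<epsilon> * real n" if \<epsilon>: "\<epsilon> > 0" for \<epsilon>
  proof -
    have \<epsilon>2: "\<epsilon> / 2 > 0" using \<epsilon> by simp
    obtain D where D: "0 \<le> D" "\<And>i. slow (\<epsilon> / 2) D (blk \<omega> i)"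
      using slow_blk[OF \<epsilon>2] assms by blast
    have slow_k: "\<beta> (initial ?\<sigma> n) \<le> D * real k + \<epsilon> / 2 * real n" if "n \<le> length (pre (blk \<omega>) k)" for n k
    proof -
      have "slow (\<epsilon> / 2) (D * real k) (pre (blk \<omega>) k)"
        by (rule slow_pre[OF loop_blk[OF assms] D(2,1)])
      then show ?thesis
        using that initial_flatten[of "blk \<omega>" n k, OF blk_nonempty that] by (simp add: slow_def)
    qed
    have "\<forall>\<^sub>F k in sequentially. D * 2 / \<epsilon> \<le> real (\<Sum>i<k. Ls i) / real (Suc k)"
      using sparse unfolding filterlim_at_top by blast
    then obtain k0 where k0: "\<And>k. k \<ge> k0 \<Longrightarrow> D * 2 / \<epsilon> \<le> real (\<Sum>i<k. Ls i) / real (Suc k)"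
      unfolding eventually_sequentially by blast
    have k0': "D * real (Suc k) \<le> \<epsilon> / 2 * real (\<Sum>i<k. Ls i)" if "k \<ge> k0" for k
    proof -
      have "D * 2 / \<epsilon> * real (Suc k) \<le> real (\<Sum>i<k. Ls i)"
        using k0[OF that] by (subst (asm) pos_le_divide_eq) auto
      then have "\<epsilon> / 2 * (D * 2 / \<epsilon> * real (Suc k)) \<le> \<epsilon> / 2 * real (\<Sum>i<k. Ls i)"
        using \<epsilon>2 by (intro mult_left_mono) auto
      then show ?thesis using \<epsilon> by simp
    qed
    have "\<forall>\<^sub>F n in sequentially. D * real k0 * 2 / \<epsilon> \<le> real n"
      using filterlim_real_sequentially unfolding filterlim_at_top by blast
    then show ?thesis
    proof eventually_elim
      case (elim n)
      define k where "k = (LEAST k. n \<le> length (pre (blk \<omega>) k))"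
      have ex: "n \<le> length (pre (blk \<omega>) n)" by (rule length_pre_ge[OF blk_nonempty])
      have k: "n \<le> length (pre (blk \<omega>) k)" unfolding k_def by (rule LeastI[of _ n]) (rule ex)
      have "D * real k \<le> \<epsilon> / 2 * real n"
      proof (cases "k \<le> k0")
        case True
        then have "D * real k \<le> D * real k0" using D(1) by (intro mult_left_mono) auto
        also have "\<dots> \<le> \<epsilon> / 2 * real n" using elim \<epsilon> by (simp add: field_simps)
        finally show ?thesis .
      next
        case False
        then obtain j where j: "k = Suc j" "k0 \<le> j" by (cases k) auto
        have "\<not> n \<le> length (pre (blk \<omega>) j)" using not_less_Least[of j "\<lambda>k. n \<le> length (pre (blk \<omega>) k)"] j(1) unfolding k_def by simp
        then have "(\<Sum>i<j. Ls i) \<le> n" using length_pre_ge_sum[of j \<omega>] by linarith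
        then have "\<epsilon> / 2 * real (\<Sum>i<j. Ls i) \<le> \<epsilon> / 2 * real n"
          using \<epsilon>2 by (intro mult_left_mono) (simp_all only: of_nat_le_iff less_imp_le)
        then show ?thesis using k0'[OF j(2)] unfolding j(1) by linarith
      qed
      then have "\<beta> (initial ?\<sigma> n) \<le> \<epsilon> * real n" using slow_k[OF k] by simp
      then show ?case using \<beta>_initial(1)[OF \<sigma>, of n] unfolding point_def by linarith
    qed
  qed
  then show ?thesis using L0_iff[OF p\<Lambda>] by blast
qed

section \<open>Stopping at a given scale\<close>

definition bmax :: real where "bmax = Max (b ` W)"

lemma b_le_bmax: "w \<in> W \<Longrightarrow> b w \<le> bmax"
  unfolding bmax_def using finite_W by (intro Max_ge) auto

text \<open>The guaranteed length of the cylinder after \<open>k + 1\<close> blocks drops below \<open>r\<close>. With \<open>bmax\<close> in place of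
  the next term \<open>b (\<omega> k)\<close> the condition depends on the first \<open>k\<close> choices only, so the words at which
  different paths stop are never proper prefixes of each other.\<close>

definition stops :: "real \<Rightarrow> (nat \<Rightarrow> nat list) \<Rightarrow> nat \<Rightarrow> bool" where
  "stops r \<omega> k \<longleftrightarrow> width * exp (- (cost \<omega> k + bmax + loss k)) < r"

definition stop :: "real \<Rightarrow> (nat \<Rightarrow> nat list) \<Rightarrow> nat" where
  "stop r \<omega> = (LEAST k. stops r \<omega> k)"

lemma stops_stop:
  assumes "\<omega> \<in> paths" "0 < r"
  shows "stops r \<omega> (stop r \<omega>)"
proof -
  have "(\<lambda>k. width * exp (- 1) ^ k) \<longlonglongrightarrow> width * 0"
    by (intro tendsto_intros LIMSEQ_realpow_zero) auto
  then have "\<forall>\<^sub>F k in sequentially. width * exp (- 1) ^ k < r"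
    using assms by (intro order_tendstoD) auto
  then obtain k where k: "width * exp (- 1) ^ k < r" unfolding eventually_sequentially by blast
  have w: "\<omega> 0 \<in> W" using assms by (simp add: paths_def)
  have "1 \<le> bmax" using b_ge_1[OF W_word(1)[OF w] W_word(3)[OF w]] b_le_bmax[OF w] by linarith
  then have "real k \<le> cost \<omega> k + bmax + loss k" using cost_ge[OF assms(1), of k] loss_nonneg[of k] by linarith
  then have "width * exp (- (cost \<omega> k + bmax + loss k)) \<le> width * exp (real k * - 1)"
    using width_pos by simp
  also have "\<dots> = width * exp (- 1) ^ k" by (simp only: exp_of_nat_mult)
  finally have "stops r \<omega> k" using k by (simp add: stops_def)
  then show ?thesis unfolding stop_def by (rule LeastI)
qed

lemma stops_cong: "(\<And>i. i < k \<Longrightarrow> \<omega> i = \<omega>' i) \<Longrightarrow> stops r \<omega> k = stops r \<omega>' k"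
  by (simp add: stops_def cost_def)

text \<open>At the stopping index itself the guaranteed length is still at least \<open>r\<close>, because the step
  before did not stop.\<close>

lemma before_stop:
  assumes "\<omega> \<in> paths" "0 < r" "r \<le> width"
  shows "r \<le> width * exp (- cost \<omega> (stop r \<omega>))"
proof (cases "stop r \<omega>")
  case 0
  then show ?thesis using assms by (simp add: cost_def)
next
  case (Suc j)
  have "\<not> stops r \<omega> j" using not_less_Least[of j "stops r \<omega>"] Suc by (simp add: stop_def)
  then have "r \<le> width * exp (- (cost \<omega> j + bmax + loss j))" by (simp add: stops_def)
  also have "cost \<omega> (Suc j) \<le> cost \<omega> j + bmax + loss j"
    using b_le_bmax[of "\<omega> j"] assms(1) by (simp add: cost_def paths_def)
  then have "width * exp (- (cost \<omega> j + bmax + loss j)) \<le> width * exp (- cost \<omega> (Suc j))"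
    using width_pos by simp
  finally show ?thesis unfolding Suc .
qed

lemma stop_eq_if_agree:
  assumes "\<omega> \<in> paths" "\<omega>' \<in> paths" "0 < r"
    and "\<And>i. i < stop r \<omega> \<Longrightarrow> i < stop r \<omega>' \<Longrightarrow> \<omega> i = \<omega>' i"
  shows "initial \<omega> (stop r \<omega>) = initial \<omega>' (stop r \<omega>')"
proof -
  have *: "stop r \<upsilon>' \<le> stop r \<upsilon>" if "\<upsilon> \<in> paths" "\<And>i. i < stop r \<upsilon> \<Longrightarrow> \<upsilon> i = \<upsilon>' i" for \<upsilon> \<upsilon>'
    unfolding stop_def[of r \<upsilon>']
    by (rule Least_le) (use stops_stop[OF that(1) assms(3)] stops_cong[of "stop r \<upsilon>" \<upsilon> \<upsilon>'] that(2) in blast)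
  have "stop r \<omega> = stop r \<omega>'"
  proof (cases "stop r \<omega> \<le> stop r \<omega>'")
    case True
    then have "stop r \<omega>' \<le> stop r \<omega>" by (intro *[OF assms(1)] assms(4)) auto
    then show ?thesis using True by simp
  next
    case False
    then have "stop r \<omega> \<le> stop r \<omega>'" by (intro *[OF assms(2)] assms(4)[symmetric]) auto
    then show ?thesis using False by simp
  qed
  then show ?thesis using assms(4) by (auto intro: initial_cong)
qed

text \<open>All choices have the same length, so two paths run in parallel up to the first index at which
  they choose different words.\<close>

lemma pre_differ:
  assumes "\<omega> \<in> paths" "\<omega>' \<in> paths" "i < k" "i < k'" "\<omega> i \<noteq> \<omega>' i"
  shows "\<exists>j<min (length (pre (blk \<omega>) k)) (length (pre (blk \<omega>') k')).
    pre (blk \<omega>) k ! j \<noteq> pre (blk \<omega>') k' ! j"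
proof -
  define i0 where "i0 = (LEAST i. \<omega> i \<noteq> \<omega>' i)"
  have i0: "\<omega> i0 \<noteq> \<omega>' i0" "\<And>j. j < i0 \<Longrightarrow> \<omega> j = \<omega>' j"
    unfolding i0_def using LeastI[of "\<lambda>i. \<omega> i \<noteq> \<omega>' i", OF assms(5)] not_less_Least by blast+
  have "i0 \<le> i" unfolding i0_def by (rule Least_le) (rule assms(5))
  then have lt: "Suc i0 \<le> k" "Suc i0 \<le> k'" using assms by auto
  define y where "y = pre (blk \<omega>) i0"
  have y': "pre (blk \<omega>') i0 = y"
    unfolding y_def by (rule pre_cong) (simp add: blk_def i0(2))
  obtain r where r: "pre (blk \<omega>) k = y @ wrap (\<omega> i0) @ r"
    using pre_extend[OF lt(1), of "blk \<omega>"] by (auto simp: pre_Suc blk_def y_def)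
  obtain r' where r': "pre (blk \<omega>') k' = y @ wrap (\<omega>' i0) @ r'"
    using pre_extend[OF lt(2), of "blk \<omega>'"] y' by (auto simp: pre_Suc blk_def)
  have len: "length (wrap (\<omega> i0)) = length (wrap (\<omega>' i0))" "length (\<omega> i0) = length (\<omega>' i0)"
    using assms(1,2) W_word(3) by (auto simp: length_wrap paths_def)
  then have "wrap (\<omega> i0) \<noteq> wrap (\<omega>' i0)" using wrap_inj i0(1) by blast
  then obtain j where j: "j < length (wrap (\<omega> i0))" "wrap (\<omega> i0) ! j \<noteq> wrap (\<omega>' i0) ! j"
    using differ_index[OF len(1)] by blast
  show ?thesis unfolding r r'
    by (rule exI[of _ "length y + j"]) (use j len(1) in \<open>simp add: nth_append\<close>)
qed

text \<open>The initial choices, up to the stopping index, of the paths leading into \<open>U\<close>.\<close>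

definition stems :: "real \<Rightarrow> real set \<Rightarrow> nat list list set" where
  "stems r U = (\<lambda>\<omega>. initial \<omega> (stop r \<omega>)) ` {\<omega>\<in>paths. point \<omega> \<in> U}"

text \<open>The cylinders belonging to different stems are essentially disjoint, have length at least \<open>r\<close>, and
  meet a window of width \<open>r\<close>.\<close>

lemma card_stems:
  assumes "0 < r" "r \<le> width" "bounded U" "diameter U \<le> r"
  shows "finite (stems r U) \<and> card (stems r U) \<le> 3"
proof (rule finite_if_finite_subsets_card_bdd)
  fix S assume S: "S \<subseteq> stems r U" "finite S"
  have "\<forall>\<tau>\<in>S. \<exists>\<omega>. \<omega> \<in> paths \<and> point \<omega> \<in> U \<and> \<tau> = initial \<omega> (stop r \<omega>)"
    using S(1) unfolding stems_def by blast
  then obtain c where c': "\<forall>\<tau>\<in>S. c \<tau> \<in> paths \<and> point (c \<tau>) \<in> U \<and> \<tau> = initial (c \<tau>) (stop r (c \<tau>))"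
    by (rule bchoice[THEN exE])
  then have c: "\<And>\<tau>. \<tau> \<in> S \<Longrightarrow> c \<tau> \<in> paths" "\<And>\<tau>. \<tau> \<in> S \<Longrightarrow> point (c \<tau>) \<in> U"
    "\<And>\<tau>. \<tau> \<in> S \<Longrightarrow> \<tau> = initial (c \<tau>) (stop r (c \<tau>))" by blast+
  define wd where "wd \<tau> = pre (blk (c \<tau>)) (stop r (c \<tau>))" for \<tau>
  have differ: "\<exists>j<min (length (wd \<tau>)) (length (wd \<tau>')). wd \<tau> ! j \<noteq> wd \<tau>' ! j"
    if \<tau>: "\<tau> \<in> S" "\<tau>' \<in> S" "\<tau> \<noteq> \<tau>'" for \<tau> \<tau>'
  proof -
    have "initial (c \<tau>) (stop r (c \<tau>)) \<noteq> initial (c \<tau>') (stop r (c \<tau>'))" using c(3) \<tau> by metis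
    then obtain i where "i < stop r (c \<tau>)" "i < stop r (c \<tau>')" "c \<tau> i \<noteq> c \<tau>' i"
      using stop_eq_if_agree[OF c(1)[OF \<tau>(1)] c(1)[OF \<tau>(2)] assms(1)] by blast
    then show ?thesis unfolding wd_def by (rule pre_differ[OF c(1)[OF \<tau>(1)] c(1)[OF \<tau>(2)]])
  qed
  then have inj: "inj_on wd S" by (intro inj_onI) fastforce
  have "real (card (wd ` S)) * r \<le> r + 2 * r"
  proof (rule words_packing[where c = "Inf U"])
    fix u assume "u \<in> wd ` S"
    then obtain \<tau> where \<tau>: "\<tau> \<in> S" "u = wd \<tau>" by blast
    let ?\<omega> = "c \<tau>"
    note \<omega> = c(1)[OF \<tau>(1)]
    show "admissible u" unfolding \<tau>(2) wd_def by (rule admissible_pre[OF \<omega>])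
    have "r \<le> width * exp (- cost ?\<omega> (stop r ?\<omega>))" by (rule before_stop[OF \<omega> assms(1,2)])
    also have "\<dots> \<le> width * exp (- \<beta> u)"
      using \<beta>_pre_le_cost[OF \<omega>, of "stop r ?\<omega>"] width_pos unfolding \<tau>(2) wd_def by simp
    finally show "r \<le> width * exp (- \<beta> u)" .
    have pU: "point ?\<omega> \<in> U" by (rule c(2)[OF \<tau>(1)])
    have "point ?\<omega> \<in> branch u ` {fst base..snd base}"
    proof -
      let ?\<sigma> = "flatten (blk ?\<omega>)"
      have "branch u (h ((shift ^^ length u) ?\<sigma>)) = h ?\<sigma>"
        using branch_h[OF code_point[OF \<omega>], of "length u"] initial_point[of ?\<omega> "stop r ?\<omega>"]
        unfolding \<tau>(2) wd_def by simp
      moreover have "h ((shift ^^ length u) ?\<sigma>) \<in> {fst base..snd base}"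
        using h_in[OF SFT_shift[OF code_point[OF \<omega>]]] base_interval(3) by blast
      ultimately show ?thesis unfolding point_def by force
    qed
    moreover have "point ?\<omega> \<in> {Inf U..Inf U + r}"
    proof -
      have "Inf U \<le> point ?\<omega>" by (rule cInf_lower[OF pU bounded_imp_bdd_below[OF assms(3)]])
      moreover have "point ?\<omega> - r \<le> Inf U"
      proof (rule cInf_greatest)
        show "U \<noteq> {}" using pU by blast
        fix y assume "y \<in> U"
        then have "dist (point ?\<omega>) y \<le> r"
          using diameter_bounded_bound[OF assms(3) pU, of y] assms(4) by linarith
        then show "point ?\<omega> - r \<le> y" by (simp add: dist_real_def abs_le_iff)
      qed
      ultimately show ?thesis by simp
    qed
    ultimately show "branch u ` {fst base..snd base} \<inter> {Inf U..Inf U + r} \<noteq> {}" by blast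
    fix v assume "v \<in> wd ` S" "u \<noteq> v"
    then show "\<exists>k<min (length u) (length v). u ! k \<noteq> v ! k" using differ \<tau> by blast
  qed (use S assms in auto)
  then have "real (card S) * r \<le> 3 * r" using card_image[OF inj] by simp
  then show "card S \<le> 3" using assms(1) by simp
qed

section \<open>The mass distribution\<close>

text \<open>The normalised weights. The mass of a cylinder after \<open>k\<close> blocks is \<open>exp (- \<eta> k)\<close> times the
  \<open>t\<close>-th power of the factor by which the chosen words alone may shrink it.\<close>

definition q :: "nat list \<Rightarrow> real" where
  "q w = exp (- t * b w - \<eta>)"

lemma q_sum: "(\<Sum>w\<in>W. q w) = 1"
proof -
  have "(\<Sum>w\<in>W. q w) = (\<Sum>w\<in>W. exp (- t * b w)) / exp \<eta>"
    by (simp add: q_def exp_diff sum_divide_distrib)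
  then show ?thesis using sum_b by (simp add: W_def)
qed

definition C1 :: real where
  "C1 = exp (t * bmax + \<eta>) / width powr t"

text \<open>The factor \<open>exp (- \<eta> k)\<close> of the mass absorbs the losses of all insertions up to and including the
  one at the stopping index. Including that one is essential: it may shrink the cylinder from above \<open>r\<close>
  to far below \<open>r\<close> without any branching.\<close>

lemma mass_at_stop:
  assumes "\<omega> \<in> paths" "0 < r"
  shows "(\<Prod>i<stop r \<omega>. q (\<omega> i)) \<le> C1 * r powr t"
proof -
  let ?k = "stop r \<omega>"
  have "(\<Sum>i<?k. - t * b (\<omega> i) - \<eta>) = - t * cost \<omega> ?k + t * (\<Sum>i<?k. loss i) - \<eta> * real ?k"
    by (simp add: cost_def sum_subtractf sum.distrib sum_distrib_left[symmetric] sum_negf algebra_simps)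
  also have "\<dots> \<le> t * bmax + \<eta> - t * (cost \<omega> ?k + bmax + loss ?k)"
  proof -
    have "{..?k} = insert ?k {..<?k}" by auto
    then have "(\<Sum>i\<le>?k. loss i) = loss ?k + (\<Sum>i<?k. loss i)" by simp
    then have "t * loss ?k + t * (\<Sum>i<?k. loss i) \<le> \<eta> * real ?k + \<eta>"
      using budget[of ?k] by (simp add: algebra_simps)
    then show ?thesis by (simp add: algebra_simps)
  qed
  finally have "exp (\<Sum>i<?k. - t * b (\<omega> i) - \<eta>) \<le> exp (t * bmax + \<eta> - t * (cost \<omega> ?k + bmax + loss ?k))"
    by (rule exp_le_cancel_iff[THEN iffD2])
  moreover have "(\<Prod>i<?k. q (\<omega> i)) = exp (\<Sum>i<?k. - t * b (\<omega> i) - \<eta>)"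
    unfolding q_def by (simp add: exp_sum)
  ultimately have "(\<Prod>i<?k. q (\<omega> i)) \<le> exp (t * bmax + \<eta> - t * (cost \<omega> ?k + bmax + loss ?k))"
    by (simp only:)
  also have "\<dots> = C1 * (width * exp (- (cost \<omega> ?k + bmax + loss ?k))) powr t"
  proof -
    define s where "s = cost \<omega> ?k + bmax + loss ?k"
    have "(width * exp (- s)) powr t = width powr t * exp (- (t * s))"
      using width_pos by (simp add: powr_mult exp_powr_real mult.commute)
    moreover have "exp (t * bmax + \<eta> - t * s) = exp (t * bmax + \<eta>) * exp (- (t * s))"
      by (simp flip: exp_add)
    ultimately show ?thesis
      using width_pos unfolding s_def[symmetric] C1_def by simp
  qed
  also have "\<dots> \<le> C1 * r powr t"
  proof (rule mult_left_mono)
    show "(width * exp (- (cost \<omega> ?k + bmax + loss ?k))) powr t \<le> r powr t"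
      using stops_stop[OF assms] t_pos width_pos by (intro powr_mono2) (auto simp: stops_def)
  qed (simp add: C1_def)
  finally show ?thesis .
qed

text \<open>The paths leading into a set of diameter \<open>r\<close> pass through at most three stems, each of mass at
  most \<open>C1 * r powr t\<close>.\<close>

lemma dimension_ge: "ereal t \<le> hausdorff_dim L0"
proof -
  let ?M = "Pi\<^sub>M (UNIV :: nat set) (\<lambda>_. point_measure W (\<lambda>w. ennreal (q w)))"
  have q_nonneg: "0 \<le> q w" for w by (simp add: q_def)
  note cylinder_measure = emeasure_product_cylinder[OF finite_W q_sum q_nonneg]
  have space: "space ?M = paths"
    by (auto simp: space_PiM space_point_measure paths_def PiE_def)
  have C1: "0 \<le> C1" by (simp add: C1_def)
  show ?thesis
  proof (rule mass_distribution_principle[of ?M t width "3 * C1" point])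
    show "prob_space ?M" using cylinder_measure(1)[of "[]"] by simp
    show "point \<omega> \<in> L0" if "\<omega> \<in> space ?M" for \<omega> using that point_in_L0 unfolding space by blast
  next
    fix U :: "real set" and r
    assume r: "0 < r" "r \<le> width" and U: "bounded U" "diameter U \<le> r"
    let ?cyl = "\<lambda>\<tau>. {\<omega>\<in>space ?M. \<forall>i<length \<tau>. \<omega> i = \<tau> ! i}"
    let ?E = "\<Union>\<tau>\<in>stems r U. ?cyl \<tau>"
    have fin: "finite (stems r U)" and card: "card (stems r U) \<le> 3" using card_stems[OF r U] by auto
    have stem: "set \<tau> \<subseteq> W" "emeasure ?M (?cyl \<tau>) \<le> ennreal (C1 * r powr t)" "?cyl \<tau> \<in> sets ?M"
      if \<tau>: "\<tau> \<in> stems r U" for \<tau>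
    proof -
      obtain \<omega> where \<omega>: "\<omega> \<in> paths" "\<tau> = initial \<omega> (stop r \<omega>)" using \<tau> unfolding stems_def by blast
      show W: "set \<tau> \<subseteq> W" using \<omega> by (auto simp: initial_def paths_def)
      show "?cyl \<tau> \<in> sets ?M" by (rule cylinder_measure(2)[OF W])
      have "emeasure ?M (?cyl \<tau>) = ennreal (\<Prod>i<length \<tau>. q (\<tau> ! i))" by (rule cylinder_measure(3)[OF W])
      also have "(\<Prod>i<length \<tau>. q (\<tau> ! i)) = (\<Prod>i<stop r \<omega>. q (\<omega> i))" by (simp add: \<omega>(2))
      finally show "emeasure ?M (?cyl \<tau>) \<le> ennreal (C1 * r powr t)"
        using mass_at_stop[OF \<omega>(1) r(1)] by (simp add: ennreal_leI)
    qed
    show "\<exists>E\<in>sets ?M. {\<omega>\<in>space ?M. point \<omega> \<in> U} \<subseteq> E \<and> emeasure ?M E \<le> ennreal (3 * C1 * r powr t)"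
    proof (rule bexI[where x = ?E], rule conjI)
      show "?E \<in> sets ?M" by (rule sets.finite_UN[OF fin stem(3)])
      show "{\<omega>\<in>space ?M. point \<omega> \<in> U} \<subseteq> ?E"
      proof
        fix \<omega> assume \<omega>: "\<omega> \<in> {\<omega>\<in>space ?M. point \<omega> \<in> U}"
        then have "initial \<omega> (stop r \<omega>) \<in> stems r U" unfolding stems_def space by blast
        moreover have "\<omega> \<in> ?cyl (initial \<omega> (stop r \<omega>))" using \<omega> by simp
        ultimately show "\<omega> \<in> ?E" by blast
      qed
      have "emeasure ?M ?E \<le> (\<Sum>\<tau>\<in>stems r U. emeasure ?M (?cyl \<tau>))"
        by (rule emeasure_subadditive_finite[OF fin]) (use stem(3) in blast)
      also have "\<dots> \<le> (\<Sum>\<tau>\<in>stems r U. ennreal (C1 * r powr t))" by (rule sum_mono[OF stem(2)])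
      also have "\<dots> = ennreal (real (card (stems r U)) * (C1 * r powr t))"
        using C1 by (simp add: ennreal_mult ennreal_of_nat_eq_real_of_nat)
      also have "\<dots> \<le> ennreal (3 * C1 * r powr t)"
        using mult_right_mono[of "real (card (stems r U))" 3 "C1 * r powr t"] card C1
        by (intro ennreal_leI) simp
      finally show "emeasure ?M ?E \<le> ennreal (3 * C1 * r powr t)" .
    qed
  qed (use t_pos width_pos C1 in auto)
qed

end

context coded_interval_map
begin

text \<open>Positive pressure makes the sum of \<open>exp (- t \<beta> w)\<close> over admissible words of length \<open>N\<close>
  exponentially large in \<open>N\<close>, so it outweighs the constant factor lost to the bridges. The loss of an
  insertion of length \<open>L\<close> is \<open>o(L)\<close> along an orbit of the level set.\<close>

lemma dimension_ge_of_pressure_pos: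
  assumes "L0 \<noteq> {}" "0 < t" "0 < geom_pressure t"
  shows "ereal t \<le> hausdorff_dim L0"
proof -
  obtain x where x: "x \<in> L0" using assms by blast
  then have "x \<in> \<Lambda>" by (simp add: zero_level_set_def)
  then obtain \<xi> where \<xi>: "\<xi> \<in> X" "x = h \<xi>" by (rule \<Lambda>_coded)
  obtain Cb where Cb: "0 \<le> Cb" "\<And>w. admissible w \<Longrightarrow> - Cb \<le> \<beta> w" using \<beta>_bounded_below by blast
  \<comment> \<open>The first term pays for the two bridges, the others ensure \<open>b \<ge> 1\<close>.\<close>
  define B where "B = 2 * growth * real bridge_length + Cb + 1"
  define b where "b w = \<beta> w + B" for w
  \<comment> \<open>Half of the pressure is given away to distortion and to the constant factors.\<close>
  define c where "c = geom_pressure t / 2"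
  have c: "0 < c" "c < geom_pressure t" using assms by (auto simp: c_def)
  have "\<forall>\<^sub>F n in sequentially. c < ln (partition_sum t n) / real n"
    by (rule order_tendstoD(1)[OF pressure_limit c(2)])
  moreover have "\<forall>\<^sub>F n in sequentially. (2 * t) * \<rho> n \<le> c / 2" by (rule eventually_distortion_le) (use c in simp)
  moreover have "\<forall>\<^sub>F n in sequentially. (t * B + ln 5 + 1) * 2 / c \<le> real n"
    using filterlim_real_sequentially unfolding filterlim_at_top by blast
  moreover have "\<forall>\<^sub>F n :: nat in sequentially. 1 \<le> n" by (rule eventually_ge_at_top)
  ultimately have "\<forall>\<^sub>F n in sequentially. 1 \<le> n \<and> c < ln (partition_sum t n) / real n \<and> (2 * t) * \<rho> n \<le> c / 2 \<and>
      (t * B + ln 5 + 1) * 2 / c \<le> real n" by eventually_elim simp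
  then obtain N where N: "1 \<le> N" "c < ln (partition_sum t N) / real N" "(2 * t) * \<rho> N \<le> c / 2"
    "(t * B + ln 5 + 1) * 2 / c \<le> real N"
    unfolding eventually_sequentially by blast
  define S where "S = (\<Sum>w\<in>{w. admissible w \<and> length w = N}. exp (- t * b w))"
  have S_eq: "S = exp (- t * B) * adm_sum t N"
    unfolding S_def adm_sum_def b_def by (simp add: sum_distrib_left algebra_simps flip: exp_add)
  have "1 < S"
  proof -
    have "exp (real N * c) < partition_sum t N"
    proof -
      have "real N * c < ln (partition_sum t N)" using N(1,2) by (simp add: less_divide_eq mult.commute)
      then show ?thesis using partition_sum_pos[OF N(1), of t] by (metis exp_less_cancel_iff exp_ln)
    qed
    also have "partition_sum t N \<le> 5 * exp (2 * t * (real N * \<rho> N)) * adm_sum t N"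
      using partition_sum_le_adm_sum[OF N(1)] assms(2) by simp
    finally have lower: "exp (real N * c) < 5 * exp (2 * t * (real N * \<rho> N)) * adm_sum t N" .
    have expo: "t * B + ln 5 + 2 * t * (real N * \<rho> N) \<le> real N * c"
    proof -
      have "2 * t * (real N * \<rho> N) \<le> real N * (c / 2)"
        using mult_left_mono[OF N(3), of "real N"] by (simp add: algebra_simps)
      moreover have "t * B + ln 5 + 1 \<le> real N * (c / 2)" using N(4) c(1) by (simp add: field_simps)
      ultimately show ?thesis by (simp add: field_simps)
    qed
    have "exp (t * B) * (5 * exp (2 * t * (real N * \<rho> N))) = exp (t * B + ln 5 + 2 * t * (real N * \<rho> N))"
      by (simp add: exp_add)
    also have "\<dots> \<le> exp (real N * c)" using expo by simp
    also have "\<dots> < 5 * exp (2 * t * (real N * \<rho> N)) * adm_sum t N" by (rule lower)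
    finally have "exp (t * B) * (5 * exp (2 * t * (real N * \<rho> N))) < adm_sum t N * (5 * exp (2 * t * (real N * \<rho> N)))"
      by (simp add: mult_ac)
    then have "exp (t * B) < adm_sum t N" by (rule mult_right_less_imp_less) simp
    then show ?thesis unfolding S_eq by (simp add: exp_minus field_simps)
  qed
  define \<eta> where "\<eta> = ln S"
  have \<eta>: "0 < \<eta>" "exp \<eta> = S" using \<open>1 < S\<close> by (auto simp: \<eta>_def)
  \<comment> \<open>An absent insertion costs nothing; otherwise two bridges and the distortion are added.\<close>
  define lam where "lam L = (if L = 0 then 0 else 2 * growth * real bridge_length + \<bar>ln \<bar>Df L x\<bar>\<bar> + real L * \<rho> L)" for L
  have lim: "(\<lambda>L. lam L / real L) \<longlonglongrightarrow> 0"
  proof -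
    have "(\<lambda>L. ln \<bar>Df L x\<bar> / real L) \<longlonglongrightarrow> 0" using x by (simp add: zero_level_set_def)
    then have "(\<lambda>L. 2 * growth * real bridge_length / real L + \<bar>ln \<bar>Df L x\<bar> / real L\<bar> + \<rho> L) \<longlonglongrightarrow> 0 + \<bar>0\<bar> + 0"
      by (intro tendsto_add lim_const_over_n tendsto_rabs \<rho>_limit)
    moreover have "\<forall>\<^sub>F L in sequentially. lam L / real L = 2 * growth * real bridge_length / real L + \<bar>ln \<bar>Df L x\<bar> / real L\<bar> + \<rho> L"
      using eventually_gt_at_top[of 0]
      by eventually_elim (simp add: lam_def add_divide_distrib)
    ultimately show ?thesis by (simp add: tendsto_cong)
  qed
  have "lam 0 \<le> 0" "0 < \<eta> / t" using \<eta> assms(2) by (auto simp: lam_def)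
  then obtain Ls where Ls: "\<And>k. (\<Sum>j\<le>k. lam (Ls j)) \<le> \<eta> / t * real (Suc k)"
    "filterlim (\<lambda>k. real (\<Sum>j<k. Ls j) / real (Suc k)) at_top sequentially"
    using sparse_schedule[OF _ lim] by metis
  interpret branching_scheme I \<Lambda> f \<P> p A h J g \<rho> t \<eta> N \<xi> b "\<lambda>i. lam (Ls i)" Ls
  proof
    show "0 < t" "0 < \<eta>" "1 \<le> N" "\<xi> \<in> X" "h \<xi> \<in> L0" using assms \<eta> N \<xi> x by auto
    show "\<beta> (wrap w) \<le> b w" if "admissible w" "length w = N" for w
      using \<beta>_wrap[of w] that N(1) Cb(1) unfolding b_def B_def by force
    show "1 \<le> b w" if "admissible w" "length w = N" for w
    proof -
      have "0 \<le> 2 * growth * real bridge_length" using growth_nonneg by simp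
      then show ?thesis using Cb(2)[OF that(1)] unfolding b_def B_def by linarith
    qed
    show "(\<Sum>w\<in>{w. admissible w \<and> length w = N}. exp (- t * b w)) = exp \<eta>"
      using \<eta>(2) by (simp add: S_def)
    show "0 \<le> lam (Ls i)" for i
      using growth_nonneg \<rho>_pos[of "Ls i"] by (auto simp: lam_def)
    show "\<beta> (wrap (initial \<xi> (Ls i))) \<le> lam (Ls i)" if "Ls i \<noteq> 0" for i
    proof -
      have "initial \<xi> (Ls i) \<noteq> []" using that by (simp flip: length_greater_0_conv)
      then have "\<beta> (wrap (initial \<xi> (Ls i))) \<le> \<beta> (initial \<xi> (Ls i)) + 2 * growth * real bridge_length"
        by (intro \<beta>_wrap admissible_initial \<xi>)
      then show ?thesis using \<beta>_initial(2)[OF \<xi>(1), of "Ls i"] that \<xi>(2) by (simp add: lam_def)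
    qed
    show "t * (\<Sum>i\<le>k. lam (Ls i)) \<le> \<eta> * real (Suc k)" for k
      using mult_left_mono[OF Ls(1)[of k], of t] assms(2) by simp
    show "filterlim (\<lambda>k. real (\<Sum>i<k. Ls i) / real (Suc k)) at_top sequentially" by (rule Ls(2))
  qed
  show ?thesis by (rule dimension_ge)
qed

lemma F_zero_le_dimension:
  assumes "L0 \<noteq> {}"
  shows "F_zero p g J \<P> f \<Lambda> \<le> hausdorff_dim L0"
proof (rule ccontr)
  assume "\<not> ?thesis"
  then have "hausdorff_dim L0 < F_zero p g J \<P> f \<Lambda>" by simp
  then obtain t where t: "hausdorff_dim L0 < ereal t" "ereal t < F_zero p g J \<P> f \<Lambda>"
    using ereal_dense2 by blast
  have "0 < ereal t" using hausdorff_dim_nonneg[of L0] t(1) by (rule le_less_trans)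
  then have "ereal t \<le> hausdorff_dim L0"
    using dimension_ge_of_pressure_pos[OF assms _ pressure_pos_below_F_zero[OF assms t(2)]] by simp
  then show False using t(1) by simp
qed

text \<open>Only \<open>\<Lambda> - L0\<close> could increase the dimension, but it is negligible in all dimensions
  above \<open>F_zero\<close>, and the dimension of \<open>L0\<close> is at least \<open>F_zero\<close>.\<close>

lemma dimension_level_set:
  assumes "L0 \<noteq> {}"
  shows "hausdorff_dim L0 = hausdorff_dim \<Lambda>"
proof (rule antisym)
  show "hausdorff_dim L0 \<le> hausdorff_dim \<Lambda>"
    by (rule hausdorff_dim_mono) (auto simp: zero_level_set_def)
  show "hausdorff_dim \<Lambda> \<le> hausdorff_dim L0"
  proof (rule hausdorff_dim_le_of_null_difference)
    fix t assume t: "hausdorff_dim L0 < ereal t"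
    have "0 < ereal t" using hausdorff_dim_nonneg[of L0] t by (rule le_less_trans)
    moreover have "F_zero p g J \<P> f \<Lambda> < ereal t"
      using F_zero_le_dimension[OF assms] t by (rule le_less_trans)
    ultimately show "hausdorff_measure t (\<Lambda> - L0) = 0"
      by (intro complement_level_set_null assms) simp_all
  qed
qed

end

section \<open>Dimension and entropy of the level set\<close>

theorem theorem2:
  fixes I \<Lambda> :: "real set" and f :: "real \<Rightarrow> real" and \<P> :: "real set set"
    and p :: nat and A :: "nat \<Rightarrow> nat \<Rightarrow> bool" and h :: "(nat \<Rightarrow> nat) \<Rightarrow> real"
    and J :: "nat \<Rightarrow> real set" and g :: "nat \<Rightarrow> real \<Rightarrow> real"
    and \<Lambda>s :: "nat \<Rightarrow> real set"
  assumes "is_interval I" and "f \<in> I \<rightarrow> I" and "piecewise_monotone_C1 I \<P> f"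
    and "compact \<Lambda>" and "\<Lambda> \<subseteq> I" and "f ` \<Lambda> \<subseteq> \<Lambda>"
    and "topologically_mixing_on (SFT p A) shift"
    and "topological_conjugacy (SFT p A) shift \<Lambda> f h"
    and "\<And>x. x \<in> \<Lambda> \<Longrightarrow> piece_deriv \<P> f x \<noteq> 0"
    and "continuous_on \<Lambda> (\<lambda>x. ln \<bar>piece_deriv \<P> f x\<bar>)"
    and "\<not> (\<exists>\<psi> c. continuous_on \<Lambda> \<psi> \<and> (\<forall>x\<in>\<Lambda>. ln \<bar>piece_deriv \<P> f x\<bar> = \<psi> x - \<psi> (f x) + c))"
    and "\<And>i. i \<in> {1..p} \<Longrightarrow> compact (J i) \<and> is_interval (J i) \<and> J i \<subseteq> I"
    and "disjoint_family_on (\<lambda>i. interior (J i)) {1..p}"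
    and "\<And>i. i \<in> {1..p} \<Longrightarrow> continuous_on I (g i) \<and> g i ` I \<subseteq> J i"
    and "\<And>i y. i \<in> {1..p} \<Longrightarrow> y \<in> I \<Longrightarrow> f (g i y) = y"
    and "\<And>i \<omega>. \<omega> \<in> SFT p A \<Longrightarrow> prepend i \<omega> \<in> SFT p A \<Longrightarrow> g i (h \<omega>) = h (prepend i \<omega>)"
    and "tempered_distortion p g J \<P> f \<Lambda>"
    and "incseq \<Lambda>s"
    and "\<And>m. \<Lambda>s m \<noteq> {} \<and> compact (\<Lambda>s m) \<and> \<Lambda>s m \<subseteq> \<Lambda> \<and> f ` \<Lambda>s m \<subseteq> \<Lambda>s m"
    and "(\<lambda>m. hausdorff_distance (\<Lambda>s m) \<Lambda>) \<longlonglongrightarrow> 0"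
    and "\<And>m. \<exists>q B h'. topological_conjugacy (SFT q B) shift (\<Lambda>s m) f h'"
    and "\<And>m. uniformly_expanding \<P> f (\<Lambda>s m)"
    and "\<And>m. bounded_distortion p g J \<P> f (\<Lambda>s m)"
    and "zero_level_set \<P> f \<Lambda> \<noteq> {}"
  shows "hausdorff_dim (zero_level_set \<P> f \<Lambda>) = hausdorff_dim \<Lambda>
    \<and> hausdorff_dim \<Lambda> \<ge> F_zero p g J \<P> f \<Lambda>
    \<and> bowen_entropy f \<Lambda> (zero_level_set \<P> f \<Lambda>) = 0"
proof -
  obtain \<rho> where \<rho>: "\<And>n. \<rho> n > 0" "decseq \<rho>" "\<rho> \<longlonglongrightarrow> 0"
    and distortion: "\<And>n w x y. n \<ge> 1 \<Longrightarrow> w \<in> words_meeting p g J \<Lambda> n \<Longrightarrow> x \<in> cylinder g J w \<Longrightarrow>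
      y \<in> cylinder g J w \<Longrightarrow> \<bar>iter_deriv \<P> f n x\<bar> \<le> exp (real n * \<rho> n) * \<bar>iter_deriv \<P> f n y\<bar>"
    using assms(17) unfolding tempered_distortion_def by blast
  have "\<Lambda> \<noteq> {}" using assms(24) by (auto simp: zero_level_set_def)
  then interpret coded_interval_map I \<Lambda> f \<P> p A h J g \<rho>
    by unfold_locales (use assms(1,3-10,13) assms(12,14-16) \<rho> distortion in \<open>auto simp: image_subset_iff\<close>)
  show ?thesis
    using dimension_level_set[OF assms(24)] F_zero_le_dimension[OF assms(24)]
      entropy_level_set[OF assms(24)] by simp
qed

end
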